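(* The Moyal star-product $$F\star_\hbar G={:F.G:}+\sum_{r\ge1}\frac{\hbar^r}{r!}P^r(F,G),\qquad F,G\in\mathrm{CO}_{\infty-},$$ where for $r\geq 1$ $$P^r(F,G)=\sum_{n,m}\ \sum_{\substack{1\le i_1,\dots,i_r\le d\\1\le j_1,\dots,j_r\le d\\k_1,\dots,k_r\in\mathbb Z}}\ \prod_{l=1}^r(\lambda k_l^2+1)\,\omega^{i_1j_1}\cdots\omega^{i_rj_r}\ {:a_{\gamma_{i_1,k_1}}\cdots a_{\gamma_{i_r,k_r}}F^n.\,a_{\gamma_{j_1,k_1}}\cdots a_{\gamma_{j_r,k_r}}G^m:},$$ extended $\mathbb K[[\hbar]]$-bilinearly to $\mathrm{CO}_{\infty-}[[\hbar]]$, defines a deformation quantization on $\mathrm{CO}_{\infty-}$ of the Poisson bracket $$\{F,G\}=\sum_{m,n}\sum_{i,j=1}^d\sum_{k\in\mathbb Z}(\lambda k^2+1)\,\omega^{ij}\,{:a_{\gamma_{i,k}}F^n.a_{\gamma_{j,k}}G^m:}.$$ That is, with $P^0(F,G)={:F.G:}$, each $P^r$, $r\ge0$, is a well-defined bilinear map $\mathrm{CO}_{\infty-}\times\mathrm{CO}_{\infty-}\to\mathrm{CO}_{\infty-}$ and: (1) $P^0(F_1,F_2)={:F_1.F_2:}$; (2) $P^1(F_1,F_2)-P^1(F_2,F_1)=2\{F_1,F_2\}$ for all $F_1,F_2\in\mathrm{CO}_{\infty-}$; (3) for all $r>0$ and all $k,C>0$ there are $K,k_1,C_1>0$ such that $\|P^r(F_1,F_2)\|_{k,C}\le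 K\|F_1\|_{k_1,C_1}\|F_2\|_{k_1,C_1}$ for all $F_1,F_2\in\mathrm{CO}_{\infty-}$; (4) $F_1\star_\hbar(F_2\star_\hbar F_3)=(F_1\star_\hbar F_2)\star_\hbar F_3$ for all $F_1,F_2,F_3\in\mathrm{CO}_{\infty-}$.
   Context: Let $\mathbb K=\mathbb R$ or $\mathbb C$, $S^1=[0,1]/(0\sim 1)$, $d\ge 1$. $\mathcal H=\mathcal H(S^1,\mathbb R^d)$ is the Hilbert space of maps $\gamma:S^1\to\mathbb R^d$ with $\|\gamma\|^2=\int_0^1|\gamma(s)|^2ds+\int_0^1|\dot\gamma(s)|^2ds<\infty$. An element of the symmetric tensor power $\mathcal H^{\widehat\otimes n}$ (complexified if $\mathbb K=\mathbb C$) is regarded as a function $(S^1)^n\to(\mathbb K^d)^{\otimes n}$, invariant under simultaneous permutation of the variables and of the tensor factors. Connes space: consider formal sums $F=\sum_{n\ge 0}F^n$ with $F^n\in\mathcal H^{\widehat\otimes n}$ a $C^\infty$ function of its $n$ variables ($F^0$ is a constant). For $k\in\mathbb N$ put $$\|F^n\|_k=\sum_{(m_1,\dots,m_n)\in\{0,\dots,k\}^n}\Big\|\frac{\partial^{m_1+\cdots+m_n}}{\partial s_1^{m_1}\cdots\partial s_n^{m_n}}F^n\Big\|_\infty,$$ and for $C>0$ put $\|F\|_{k,C}=\sum_n C^n\|F^n\|_k$. $\mathrm{CO}_{k,C}$ is the space of such $F$ with $\|F\|_{k,C}<\infty$, and $\mathrm{CO}_{\infty-}=\bigcap_{k,C}\mathrm{CO}_{k,C}$,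 with the topology given by all the norms $\|\cdot\|_{k,C}$. $\mathrm{CO}_{\infty-}[[\hbar]]$ is the set of formal power series in $\hbar$ with coefficients in $\mathrm{CO}_{\infty-}$. Wick product: ${:F.G:}=\sum_{n,m}F^n\widehat\otimes G^m$, where $F^n\widehat\otimes G^m=\frac{1}{(n+m)!}\sum_{\sigma\in\mathfrak S_{n+m}}F^n\otimes_\sigma G^m$ is the symmetrization of $F^n\otimes G^m$. Annihilation operator: for $h\in\mathcal H$ and $F=\sum F^n\in\mathrm{CO}_{\infty-}$, $$a_hF=\sum_{n\ge1}\sum_{i=1}^n\int_{S^1}\Big[\langle F^n(s_1,\dots,\bar s_i,\dots,s_{n-1}),h(\bar s_i)\rangle+\Big\langle\frac{d}{d\bar s_i}F^n(s_1,\dots,\bar s_i,\dots,s_{n-1}),\dot h(\bar s_i)\Big\rangle\Big]d\bar s_i,$$ where $\bar s_i$ is placed in the $i$-th slot, the other slots are filled in order by $s_1,\dots,s_{n-1}$, and $\langle\cdot,h(\bar s_i)\rangle$ is contraction ($\mathbb K$-bilinear) of the $i$-th tensor factor with $h(\bar s_i)$. Basis: with $(e_i)_{1\le i\le d}$ the canonical basis of $\mathbb R^d$ and $\lambda=4\pi^2$, the orthonormal Fourier basis $(\gamma_{i,k})_{1\le i\le d,\,k\in\mathbb Z}$ of $\mathcal H$ is $\gamma_{i,k}(s)=c_k\frac{\cos(2k\pi s)}{\sqrt{\lambda k^2+1}}e_i$ for $k\ge 0$ and $\gamma_{i,k}(s)=c_k\frac{\sin(2k\pi s)}{\sqrt{\lambda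 k^2+1}}e_i$ for $k<0$, where $c_0=1$, $c_k=\sqrt2$ for $k\neq0$. Symplectic form: $\omega=(\omega_{ij})$ is a non-degenerate antisymmetric bilinear form on $\mathbb R^d$, and $(\omega^{ij})$ is the inverse matrix of $(\omega_{ij})$. The bracket is the one associated with the form $\Omega(\gamma_1,\gamma_2)=\int_{S^1}\omega(\gamma_1(s),\gamma_2(s))ds$ on $\mathcal H$. *)

theory Defs
  imports
    "HOL-Analysis.Analysis"
    "HOL-Combinatorics.Permutations"
    "HOL-Computational_Algebra.Formal_Power_Series"
    "HOL-Library.Function_Algebras"
begin

text \<open>
  A formal sum \<open>F = \<Sum>\<^sub>n F\<^sup>n\<close>, where \<open>F\<^sup>n\<close> is a function from \<open>(S\<^sup>1)\<^sup>n\<close> to the \<open>n\<close>-th tensor power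
  of \<open>K\<^sup>d\<close>, is encoded by its coordinate functions: \<open>F [(s\<^sub>1,i\<^sub>1), \<dots>, (s\<^sub>n,i\<^sub>n)]\<close> is the coefficient
  of \<open>e\<^bsub>i\<^sub>1\<^esub> \<otimes> \<dots> \<otimes> e\<^bsub>i\<^sub>n\<^esub>\<close> in \<open>F\<^sup>n(s\<^sub>1,\<dots>,s\<^sub>n)\<close>. Thus \<open>F\<^sup>n\<close> is the restriction of \<open>F\<close> to lists of
  length \<open>n\<close>, and every value of \<open>F\<close> is meaningful. Functions on \<open>S\<^sup>1\<close> are 1-periodic functions on
  the reals, and \<open>{1,\<dots>,d}\<close> is a finite type \<open>'d\<close>. The scalar field is a type of class
  \<open>{real_normed_field, euclidean_space}\<close>; both \<open>real\<close> and \<open>complex\<close> are instances.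
\<close>

type_synonym ('d, 'k) chaos = "(real \<times> 'd) list \<Rightarrow> 'k"

definition chaos_component :: "nat \<Rightarrow> ('d, 'k::zero) chaos \<Rightarrow> ('d, 'k) chaos" where
  "chaos_component n F = (\<lambda>ps. if length ps = n then F ps else 0)"

definition chaos_scale :: "'k::times \<Rightarrow> ('d, 'k) chaos \<Rightarrow> ('d, 'k) chaos" where
  "chaos_scale c F = (\<lambda>ps. c * F ps)"


section \<open>The Connes space\<close>

text \<open>Invariance under simultaneous permutation of the variables and of the tensor factors.\<close>

definition chaos_symmetric :: "('d, 'k) chaos \<Rightarrow> bool" where
  "chaos_symmetric F \<longleftrightarrow> (\<forall>ps qs. mset ps = mset qs \<longrightarrow> F ps = F qs)"

definition chaos_periodic :: "('d, 'k) chaos \<Rightarrow> bool" where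
  "chaos_periodic F \<longleftrightarrow>
     (\<forall>ps j. j < length ps \<longrightarrow> F (ps[j := (fst (ps ! j) + 1, snd (ps ! j))]) = F ps)"

text \<open>Variables are numbered from 0. On lists of length at most \<open>j\<close> the derivative is 0.\<close>

definition chaos_partial :: "nat \<Rightarrow> ('d, 'k::real_normed_vector) chaos \<Rightarrow> ('d, 'k) chaos" where
  "chaos_partial j F =
     (\<lambda>ps. vector_derivative (\<lambda>t. F (ps[j := (t, snd (ps ! j))])) (at (fst (ps ! j))))"

text \<open>
  Every \<open>F\<^sup>n\<close> is smooth: all iterated partial derivatives exist and are jointly continuous.
  In the last line only the first \<open>length is\<close> coordinates of the sequence \<open>s\<close> matter, so continuity
  for the product topology is joint continuity in these coordinates. A smooth, periodic, symmetric
  \<open>F\<^sup>n\<close> has square-integrable derivatives of order at most one in each variable, hence lies in the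
  symmetric tensor power of \<open>H\<close>; this is not a separate condition.
\<close>

definition chaos_smooth :: "('d, 'k::real_normed_vector) chaos \<Rightarrow> bool" where
  "chaos_smooth F \<longleftrightarrow>
     (\<forall>js.
        (\<forall>ps j. j < length ps \<longrightarrow>
           (\<lambda>t. foldr chaos_partial js F (ps[j := (t, snd (ps ! j))]))
             differentiable (at (fst (ps ! j)))) \<and>
        (\<forall>is. continuous_on UNIV
           (\<lambda>s :: nat \<Rightarrow> real. foldr chaos_partial js F (zip (map s [0..<length is]) is))))"

definition multi_partial :: "nat list \<Rightarrow> ('d, 'k::real_normed_vector) chaos \<Rightarrow> ('d, 'k) chaos" where
  "multi_partial ms F = foldr (\<lambda>j. chaos_partial j ^^ (ms ! j)) [0..<length ms] F"

text \<open>Sup norm of the degree-\<open>n\<close> part, for the Hilbert tensor norm on the tensor power of \<open>K\<^sup>d\<close>.\<close>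

definition chaos_sup_norm :: "nat \<Rightarrow> ('d::finite, 'k::real_normed_vector) chaos \<Rightarrow> ennreal" where
  "chaos_sup_norm n F =
     (SUP s\<in>{s. length s = n}.
        ennreal (sqrt (\<Sum>is\<in>{is. length is = n}. (norm (F (zip s is)))\<^sup>2)))"

definition degree_norm :: "nat \<Rightarrow> nat \<Rightarrow> ('d::finite, 'k::real_normed_vector) chaos \<Rightarrow> ennreal" where
  "degree_norm k n F =
     (\<Sum>ms\<in>{ms. length ms = n \<and> set ms \<subseteq> {0..k}}. chaos_sup_norm n (multi_partial ms F))"

definition CO_norm :: "nat \<Rightarrow> real \<Rightarrow> ('d::finite, 'k::real_normed_vector) chaos \<Rightarrow> ennreal" where
  "CO_norm k C F = (\<Sum>n. ennreal (C ^ n) * degree_norm k n F)"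

definition CO :: "nat \<Rightarrow> real \<Rightarrow> ('d::finite, 'k::real_normed_vector) chaos set" where
  "CO k C = {F. chaos_symmetric F \<and> chaos_periodic F \<and> chaos_smooth F \<and> CO_norm k C F < \<infinity>}"

definition CO_inf :: "('d::finite, 'k::real_normed_vector) chaos set" where
  "CO_inf = (\<Inter>k. \<Inter>C\<in>{0<..}. CO k C)"

text \<open>Unconditional convergence of a family in the topology given by all the norms.\<close>

definition CO_has_sum ::
    "('i \<Rightarrow> ('d::finite, 'k::real_normed_vector) chaos) \<Rightarrow> 'i set \<Rightarrow> ('d, 'k) chaos \<Rightarrow> bool" where
  "CO_has_sum f A S \<longleftrightarrow>
     (\<forall>x\<in>A. f x \<in> CO_inf) \<and> S \<in> CO_inf \<and>
     (\<forall>k. \<forall>C>0. ((\<lambda>X. CO_norm k C (sum f X - S)) \<longlongrightarrow> 0) (finite_subsets_at_top A))"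

definition bilinear_on_CO ::
    "(('d::finite, 'k::real_normed_field) chaos \<Rightarrow> ('d, 'k) chaos \<Rightarrow> ('d, 'k) chaos) \<Rightarrow> bool" where
  "bilinear_on_CO B \<longleftrightarrow>
     (\<forall>F\<in>CO_inf. \<forall>G\<in>CO_inf. B F G \<in> CO_inf) \<and>
     (\<forall>F\<in>CO_inf. \<forall>F'\<in>CO_inf. \<forall>G\<in>CO_inf.
        B (F + F') G = B F G + B F' G \<and> B G (F + F') = B G F + B G F') \<and>
     (\<forall>F\<in>CO_inf. \<forall>G\<in>CO_inf. \<forall>c.
        B (chaos_scale c F) G = chaos_scale c (B F G) \<and>
        B F (chaos_scale c G) = chaos_scale c (B F G))"


section \<open>Wick product and annihilation operators\<close>

text \<open>The symmetrization of the tensor product of \<open>F\<^sup>n\<close> and \<open>G\<^sup>m\<close>.\<close>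

definition sym_tensor ::
    "nat \<Rightarrow> nat \<Rightarrow> ('d, 'k::real_normed_field) chaos \<Rightarrow> ('d, 'k) chaos \<Rightarrow> ('d, 'k) chaos" where
  "sym_tensor n m F G = (\<lambda>ps. if length ps = n + m then
     (\<Sum>\<sigma>\<in>{\<sigma>. \<sigma> permutes {..<n + m}}.
        F (take n (permute_list \<sigma> ps)) * G (drop n (permute_list \<sigma> ps))) / fact (n + m) else 0)"

text \<open>In a given degree only the finitely many \<open>(n, m)\<close> with \<open>n + m\<close> equal to it contribute.\<close>

definition wick ::
    "('d, 'k::real_normed_field) chaos \<Rightarrow> ('d, 'k) chaos \<Rightarrow> ('d, 'k) chaos" where
  "wick F G = (\<lambda>ps. \<Sum>n\<le>length ps. sym_tensor n (length ps - n) F G ps)"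

text \<open>\<open>ps\<close> lists the remaining variables; the integration variable is inserted in the slot \<open>i\<close>.\<close>

definition annih ::
    "(real \<Rightarrow> real ^ 'd) \<Rightarrow> ('d::finite, 'k::euclidean_space) chaos \<Rightarrow> ('d, 'k) chaos" where
  "annih h F = (\<lambda>ps. \<Sum>i\<le>length ps. integral {0..1} (\<lambda>s.
     (\<Sum>j\<in>UNIV. h s $ j *\<^sub>R F (take i ps @ (s, j) # drop i ps)) +
     (\<Sum>j\<in>UNIV. vector_derivative h (at s) $ j *\<^sub>R
        chaos_partial i F (take i ps @ (s, j) # drop i ps))))"

definition fourier_weight :: "int \<Rightarrow> real" where
  "fourier_weight k = 4 * pi\<^sup>2 * (of_int k)\<^sup>2 + 1"

definition fourier_basis :: "'d::finite \<Rightarrow> int \<Rightarrow> real \<Rightarrow> real ^ 'd" where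
  "fourier_basis i k s =
     ((if k = 0 then 1 else sqrt 2) *
      (if k \<ge> 0 then cos (2 * of_int k * pi * s) else sin (2 * of_int k * pi * s)) /
      sqrt (fourier_weight k)) *\<^sub>R axis i 1"


section \<open>Poisson bracket and star-product\<close>

definition symplectic_form :: "(real ^ 'd::finite \<Rightarrow> real ^ 'd \<Rightarrow> real) \<Rightarrow> bool" where
  "symplectic_form \<omega> \<longleftrightarrow>
     bilinear \<omega> \<and> (\<forall>x y. \<omega> x y = - \<omega> y x) \<and> (\<forall>x. (\<forall>y. \<omega> x y = 0) \<longrightarrow> x = 0)"

definition form_matrix :: "(real ^ 'd::finite \<Rightarrow> real ^ 'd \<Rightarrow> real) \<Rightarrow> real ^ 'd ^ 'd" where
  "form_matrix \<omega> = (\<chi> i j. \<omega> (axis i 1) (axis j 1))"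

definition inv_form :: "(real ^ 'd::finite \<Rightarrow> real ^ 'd \<Rightarrow> real) \<Rightarrow> 'd \<Rightarrow> 'd \<Rightarrow> real" where
  "inv_form \<omega> i j = matrix_inv (form_matrix \<omega>) $ i $ j"

fun poisson_term ::
    "(real ^ 'd \<Rightarrow> real ^ 'd \<Rightarrow> real) \<Rightarrow>
     ('d::finite, 'k::{real_normed_field, euclidean_space}) chaos \<Rightarrow> ('d, 'k) chaos \<Rightarrow>
     nat \<times> nat \<times> 'd \<times> 'd \<times> int \<Rightarrow> ('d, 'k) chaos" where
  "poisson_term \<omega> F G (n, m, i, j, k) =
     chaos_scale (of_real (fourier_weight k * inv_form \<omega> i j))
       (wick (annih (fourier_basis i k) (chaos_component n F))
             (annih (fourier_basis j k) (chaos_component m G)))"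

definition poisson ::
    "(real ^ 'd \<Rightarrow> real ^ 'd \<Rightarrow> real) \<Rightarrow>
     ('d::finite, 'k::{real_normed_field, euclidean_space}) chaos \<Rightarrow> ('d, 'k) chaos \<Rightarrow>
     ('d, 'k) chaos" where
  "poisson \<omega> F G = (\<lambda>ps. \<Sum>\<^sub>\<infinity>x. poisson_term \<omega> F G x ps)"

definition iter_annih ::
    "'d list \<Rightarrow> int list \<Rightarrow> ('d::finite, 'k::euclidean_space) chaos \<Rightarrow> ('d, 'k) chaos" where
  "iter_annih is ks F = foldr (\<lambda>(i, k). annih (fourier_basis i k)) (zip is ks) F"

definition moyal_indices ::
    "nat \<Rightarrow> (nat \<times> nat \<times> 'd::finite list \<times> 'd list \<times> int list) set" where
  "moyal_indices r = {(n, m, is, js, ks). length is = r \<and> length js = r \<and> length ks = r}"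

fun moyal_term ::
    "(real ^ 'd \<Rightarrow> real ^ 'd \<Rightarrow> real) \<Rightarrow> nat \<Rightarrow>
     ('d::finite, 'k::{real_normed_field, euclidean_space}) chaos \<Rightarrow> ('d, 'k) chaos \<Rightarrow>
     nat \<times> nat \<times> 'd list \<times> 'd list \<times> int list \<Rightarrow> ('d, 'k) chaos" where
  "moyal_term \<omega> r F G (n, m, is, js, ks) =
     chaos_scale
       (of_real ((\<Prod>l<r. fourier_weight (ks ! l)) * (\<Prod>l<r. inv_form \<omega> (is ! l) (js ! l))))
       (wick (iter_annih is ks (chaos_component n F)) (iter_annih js ks (chaos_component m G)))"

definition moyal ::
    "(real ^ 'd \<Rightarrow> real ^ 'd \<Rightarrow> real) \<Rightarrow> nat \<Rightarrow>
     ('d::finite, 'k::{real_normed_field, euclidean_space}) chaos \<Rightarrow> ('d, 'k) chaos \<Rightarrow>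
     ('d, 'k) chaos" where
  "moyal \<omega> r F G = (if r = 0 then wick F G
     else (\<lambda>ps. \<Sum>\<^sub>\<infinity>x\<in>moyal_indices r. moyal_term \<omega> r F G x ps))"

text \<open>The extension to formal power series in \<open>\<hbar>\<close>, bilinear over the formal power series in \<open>\<hbar>\<close>.\<close>

definition moyal_star ::
    "(real ^ 'd \<Rightarrow> real ^ 'd \<Rightarrow> real) \<Rightarrow>
     ('d::finite, 'k::{real_normed_field, euclidean_space}) chaos fps \<Rightarrow> ('d, 'k) chaos fps \<Rightarrow>
     ('d, 'k) chaos fps" where
  "moyal_star \<omega> F G = Abs_fps (\<lambda>N. \<Sum>r\<le>N. \<Sum>a\<le>N - r.
     chaos_scale (1 / fact r) (moyal \<omega> r (fps_nth F a) (fps_nth G (N - r - a))))"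

end

theory Submission
  imports Defs
begin

text \<open>
  The star-product is the exponential of a bidifferential operator with constant coefficients,
  followed by multiplication. Write \<open>F \<otimes> G\<close> for the function of two groups of points, and let \<open>\<Pi>\<close> be
  the sum over \<open>i, j, k\<close> of the weighted products of an annihilation operator acting on the first
  group with one acting on the second. Annihilation operators are derivations of the Wick product and
  commute, so \<open>P\<^sup>r(F, G)\<close> is \<open>\<Pi>\<^sup>r (F \<otimes> G)\<close> with the two groups of points merged. For three factors there
  are three commuting operators \<open>\<Pi>\<^sub>1\<^sub>2, \<Pi>\<^sub>1\<^sub>3, \<Pi>\<^sub>2\<^sub>3\<close>, and the coefficient of \<open>\<hbar>\<^sup>N\<close> in either bracketing of
  \<open>F \<star> G \<star> H\<close> is \<open>(\<Pi>\<^sub>1\<^sub>2 + \<Pi>\<^sub>1\<^sub>3 + \<Pi>\<^sub>2\<^sub>3)\<^sup>N (F \<otimes> G \<otimes> H) / N!\<close> with the three groups merged: associativity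
  is the binomial theorem (\<open>contr_binomial\<close>, \<open>star_jet_assoc\<close>).

  To turn this into a proof about infinite sums of smooth functions, the chaos \<open>F\<close> is replaced by a
  \<^emph>\<open>jet\<close>, a function \<open>J\<close> of lists of triples \<open>(s, i, m)\<close>: the value of \<open>J\<close> is the mixed partial derivative
  of \<open>n! F\<^sup>n\<close> of order \<open>m\<close> in the variable \<open>s\<close> with tensor index \<open>i\<close>, for all slots at once. By
  Schwarz's theorem \<open>J\<close> is invariant under permutations of the triples. Differentiation just raises an
  order, and membership in the space \<open>CO_inf\<close> becomes a growth bound on \<open>J\<close> that controls all
  orders up to \<open>k\<close> (\<open>jet_of_in_jets\<close>, \<open>chaos_of_in_CO_inf\<close>). The bounds make jets Lipschitz
  and their first order Taylor expansions uniform, which is why sums and integrals of jets can be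
  differentiated termwise (\<open>has_vector_derivative_quadratic\<close>).

  The factor \<open>n!\<close> removes the combinatorics. The Wick product becomes the sum over all ways of
  distributing the points over two lists (\<open>wick_chaos_of\<close>), and the annihilation operator becomes a
  single integral over an inserted point (\<open>annih_chaos_of\<close>). Jets are taken over an arbitrary finite type
  of labels, so that \<open>F \<otimes> G\<close> is a jet with labels in \<open>'d + 'd\<close> and merging the groups is the
  push-forward along a map of labels. The rule \<open>contr_push\<close> that moves a contraction past a
  push-forward is then the Leibniz rule for every number of factors.

  Convergence comes from integration by parts: each Fourier coefficient gains two powers of
  \<open>\<lambda>k\<^sup>2 + 1\<close> at the price of four derivatives (\<open>lower_bound\<close>), so the terms of \<open>\<Pi>\<close> are operators whose
  bounds are summable over \<open>k\<close>. Continuous linear operators commute with absolutely summable families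
  of jets (\<open>jet_op_infsum\<close>), and families of operators with summable bounds can be added, composed
  and iterated; this gives the well-definedness and the continuity of every \<open>P\<^sup>r\<close>.
\<close>

section \<open>Jets\<close>

text \<open>
  The entry \<open>(s, a, m)\<close> of the list stands for a variable \<open>s\<close> with label \<open>a\<close> in which the function is
  differentiated \<open>m\<close> times. Labels are tensor indices, or tensor indices tagged with the factor of a
  tensor product that they belong to.
\<close>

type_synonym ('l, 'k) jet = "(real \<times> 'l \<times> nat) list \<Rightarrow> 'k"

abbreviation order_of :: "real \<times> 'l \<times> nat \<Rightarrow> nat" where
  "order_of q \<equiv> snd (snd q)"

text \<open>
  The factorial is there because a jet carries the factor \<open>n!\<close> in degree \<open>n\<close>.
\<close>

definition jet_bounded :: "nat \<Rightarrow> real \<Rightarrow> real \<Rightarrow> ('l, 'k::real_normed_vector) jet \<Rightarrow> bool" where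
  "jet_bounded k C B J \<longleftrightarrow>
     (\<forall>qs. (\<forall>q\<in>set qs. order_of q \<le> k) \<longrightarrow> C ^ length qs * norm (J qs) \<le> B * fact (length qs))"

text \<open>
  The order of differentiation is part of the argument, so the third condition says that \<open>J\<close> is the
  system of all derivatives of a single function. The bounds on all orders imply joint continuity.
\<close>

definition jets :: "('l, 'k::real_normed_vector) jet set" where
  "jets = {J. (\<forall>ps qs. mset ps = mset qs \<longrightarrow> J ps = J qs) \<and>
     (\<forall>s a m qs. J ((s + 1, a, m) # qs) = J ((s, a, m) # qs)) \<and>
     (\<forall>s a m qs. ((\<lambda>t. J ((t, a, m) # qs)) has_vector_derivative J ((s, a, Suc m) # qs)) (at s)) \<and>
     (\<forall>k. \<forall>C>0. \<exists>B. jet_bounded k C B J)}"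

lemma jets_perm: "J \<in> jets \<Longrightarrow> mset ps = mset qs \<Longrightarrow> J ps = J qs"
  unfolding jets_def by blast

lemma jets_swap: "J \<in> jets \<Longrightarrow> J (p # q # qs) = J (q # p # qs)"
  by (erule jets_perm) simp

lemma jets_periodic: "J \<in> jets \<Longrightarrow> J ((s + 1, a, m) # qs) = J ((s, a, m) # qs)"
  unfolding jets_def by blast

lemma jets_deriv:
  "J \<in> jets \<Longrightarrow> ((\<lambda>t. J ((t, a, m) # qs)) has_vector_derivative J ((s, a, Suc m) # qs)) (at s)"
  unfolding jets_def by blast

lemma jets_bounded: "J \<in> jets \<Longrightarrow> C > 0 \<Longrightarrow> \<exists>B. jet_bounded k C B J"
  unfolding jets_def by blast

lemma jet_boundedD:
  "jet_bounded k C B J \<Longrightarrow> (\<And>q. q \<in> set qs \<Longrightarrow> order_of q \<le> k) \<Longrightarrow>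
     C ^ length qs * norm (J qs) \<le> B * fact (length qs)"
  unfolding jet_bounded_def by blast

lemma jet_bounded_nonneg: "jet_bounded k C B J \<Longrightarrow> 0 \<le> B"
  using jet_boundedD[of k C B J "[]"] norm_ge_zero[of "J []"] by (simp del: norm_ge_zero)

lemma jet_bounded_mono:
  assumes "jet_bounded k C B J" "k' \<le> k" "0 \<le> C'" "C' \<le> C" "B \<le> B'"
  shows "jet_bounded k' C' B' J"
  unfolding jet_bounded_def
proof (intro allI impI)
  fix qs :: "(real \<times> 'a \<times> nat) list"
  assume *: "\<forall>q\<in>set qs. order_of q \<le> k'"
  have "C' ^ length qs * norm (J qs) \<le> C ^ length qs * norm (J qs)"
    by (intro mult_right_mono power_mono assms) auto
  also have "\<dots> \<le> B * fact (length qs)"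
    using assms * by (intro jet_boundedD[OF assms(1)]) auto
  also have "\<dots> \<le> B' * fact (length qs)"
    using assms by (intro mult_right_mono) auto
  finally show "C' ^ length qs * norm (J qs) \<le> B' * fact (length qs)" .
qed

lemma jet_bounded_norm:
  assumes "jet_bounded k 1 B J" "\<And>q. q \<in> set qs \<Longrightarrow> order_of q \<le> k"
  shows "norm (J qs) \<le> B * fact (length qs)"
  using jet_boundedD[OF assms] by simp

definition max_order :: "(real \<times> 'l \<times> nat) list \<Rightarrow> nat" where
  "max_order qs = Max (insert 0 (order_of ` set qs))"

lemma max_order_ge: "q \<in> set qs \<Longrightarrow> order_of q \<le> max_order qs"
  unfolding max_order_def by (intro Max_ge) auto

lemma jets_uniform_bound:
  assumes "J \<in> jets"
  shows "\<exists>M\<ge>0. \<forall>qs. length qs = n \<longrightarrow> (\<forall>q\<in>set qs. order_of q \<le> k) \<longrightarrow> norm (J qs) \<le> M"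
proof -
  obtain B where B: "jet_bounded k 1 B J" using jets_bounded[OF assms, of 1] by auto
  show ?thesis
    by (rule exI[of _ "B * fact n"])
       (use jet_bounded_norm[OF B] jet_bounded_nonneg[OF B] in auto)
qed

text \<open>
  Taylor expansion with a uniform quadratic remainder. Unlike the existence of a derivative, this
  inequality survives integration and absolutely convergent summation.
\<close>

lemma quadratic_estimate:
  fixes f :: "real \<Rightarrow> 'k::real_normed_vector"
  assumes "\<And>u. (f has_vector_derivative f' u) (at u)" "\<And>u. (f' has_vector_derivative f'' u) (at u)"
    and "\<And>u. norm (f'' u) \<le> M"
  shows "norm (f t - f s - (t - s) *\<^sub>R f' s) \<le> M * (t - s)\<^sup>2"
proof -
  have 1: "norm (f' u - f' s) \<le> M * \<bar>u - s\<bar>" for u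
    using differentiable_bound[of UNIV f' "\<lambda>u h. h *\<^sub>R f'' u" M u s] assms(2,3)
    by (simp add: has_vector_derivative_def onorm_scaleR_left_lemma
        onorm_scaleR_left[OF bounded_linear_ident] onorm_id)
  have M: "M \<ge> 0" using assms(3)[of 0] norm_ge_zero order_trans by blast
  define g where "g u = f u - (u - s) *\<^sub>R f' s" for u
  have g: "(g has_vector_derivative (f' u - f' s)) (at u within closed_segment s t)" for u
    unfolding g_def by (rule has_vector_derivative_at_within)
      (auto intro!: derivative_eq_intros assms(1))
  have "norm (g t - g s) \<le> (M * \<bar>t - s\<bar>) * norm (t - s)"
  proof (rule differentiable_bound[of "closed_segment s t" g "\<lambda>u h. h *\<^sub>R (f' u - f' s)"])
    fix u assume u: "u \<in> closed_segment s t"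
    show "(g has_derivative (\<lambda>h. h *\<^sub>R (f' u - f' s))) (at u within closed_segment s t)"
      using g by (simp add: has_vector_derivative_def)
    have "\<bar>u - s\<bar> \<le> \<bar>t - s\<bar>"
      using u by (auto simp: closed_segment_eq_real_ivl split: if_splits)
    then have "norm (f' u - f' s) \<le> M * \<bar>t - s\<bar>"
      using 1[of u] M by (meson mult_left_mono order_trans)
    then show "onorm (\<lambda>h. h *\<^sub>R (f' u - f' s)) \<le> M * \<bar>t - s\<bar>"
      by (simp add: onorm_scaleR_left[OF bounded_linear_ident] onorm_id)
  qed auto
  then show ?thesis by (simp add: g_def power2_eq_square algebra_simps)
qed

text \<open>
  The converse of the Taylor estimate; together they differentiate integrals and series of jets
  termwise, the bound on second derivatives playing the part of dominated convergence.
\<close>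

lemma has_vector_derivative_quadratic:
  fixes f :: "real \<Rightarrow> 'k::real_normed_vector"
  assumes "\<And>t. norm (f t - f s - (t - s) *\<^sub>R D) \<le> M * (t - s)\<^sup>2"
  shows "(f has_vector_derivative D) (at s)"
  unfolding has_vector_derivative_def has_derivative_at_within
proof
  show "bounded_linear (\<lambda>x. x *\<^sub>R D)" by (rule bounded_linear_scaleR_left)
  have lim: "((\<lambda>t. \<bar>M\<bar> * \<bar>t - s\<bar>) \<longlongrightarrow> 0) (at s)"
    by (intro tendsto_mult_right_zero tendsto_rabs_zero LIM_zero tendsto_ident_at)
  show "((\<lambda>y. (f y - f s - (y - s) *\<^sub>R D) /\<^sub>R norm (y - s)) \<longlongrightarrow> 0) (at s)"
  proof (rule Lim_null_comparison[OF _ lim], rule always_eventually, rule allI)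
    fix y
    show "norm ((f y - f s - (y - s) *\<^sub>R D) /\<^sub>R norm (y - s)) \<le> \<bar>M\<bar> * \<bar>y - s\<bar>"
    proof (cases "y = s")
      case False
      have "norm (f y - f s - (y - s) *\<^sub>R D) \<le> \<bar>M\<bar> * (y - s)\<^sup>2"
        using assms[of y] by (meson abs_ge_self mult_right_mono order_trans zero_le_power2)
      also have "\<dots> = \<bar>M\<bar> * \<bar>y - s\<bar> * \<bar>y - s\<bar>" by (simp add: power2_eq_square)
      finally show ?thesis using False by (simp add: divide_simps)
    qed simp
  qed
qed

lemma jets_quadratic:
  assumes J: "J \<in> jets" and "\<And>u. norm (J ((u, a, Suc (Suc m)) # qs)) \<le> M"
  shows "norm (J ((t, a, m) # qs) - J ((s, a, m) # qs) - (t - s) *\<^sub>R J ((s, a, Suc m) # qs)) \<le> M * (t - s)\<^sup>2"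
  by (rule quadratic_estimate[OF jets_deriv[OF J] jets_deriv[OF J] assms(2)])

lemma jetsI:
  assumes "\<And>ps qs. mset ps = mset qs \<Longrightarrow> J ps = J qs"
    and "\<And>s a m qs. J ((s + 1, a, m) # qs) = J ((s, a, m) # qs)"
    and "\<And>s a m qs. ((\<lambda>t. J ((t, a, m) # qs)) has_vector_derivative J ((s, a, Suc m) # qs)) (at s)"
    and "\<And>k C. C > 0 \<Longrightarrow> \<exists>B. jet_bounded k C B J"
  shows "J \<in> jets"
  using assms unfolding jets_def by blast

text \<open>
  The variables are changed one at a time, and each change costs the supremum of a first derivative. By
  symmetry the changed entry may be moved to the head of the list.
\<close>

lemma jets_lipschitz:
  assumes J: "J \<in> jets"
  shows "\<exists>L\<ge>0. \<forall>\<sigma> \<tau>. norm (J (map (\<lambda>i. (\<sigma> i, l i, c i)) xs) - J (map (\<lambda>i. (\<tau> i, l i, c i)) xs))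
            \<le> L * (\<Sum>i\<leftarrow>xs. \<bar>\<sigma> i - \<tau> i\<bar>)"
proof -
  \<comment> \<open>one order more than occurs in the list, for the derivatives in the mean value estimate\<close>
  define k where "k = Suc (Max (insert 0 (c ` set xs)))"
  have ck: "Suc (c i) \<le> k" if "i \<in> set xs" for i
    unfolding k_def using that by (auto intro!: Max_ge)
  obtain L where L: "L \<ge> 0" "\<And>qs. length qs = length xs \<Longrightarrow> (\<And>q. q \<in> set qs \<Longrightarrow> order_of q \<le> k) \<Longrightarrow> norm (J qs) \<le> L"
    using jets_uniform_bound[OF J, of "length xs" k] by blast
  have "norm (J (map (\<lambda>i. (\<sigma> i, l i, c i)) ys @ qs) - J (map (\<lambda>i. (\<tau> i, l i, c i)) ys @ qs))
            \<le> L * (\<Sum>i\<leftarrow>ys. \<bar>\<sigma> i - \<tau> i\<bar>)"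
    if "set ys \<subseteq> set xs" "length ys + length qs = length xs" "\<And>q. q \<in> set qs \<Longrightarrow> order_of q \<le> k"
    for \<sigma> \<tau> ys qs
    using that
  proof (induction ys arbitrary: qs)
    case (Cons y ys)
    let ?S = "map (\<lambda>i. (\<sigma> i, l i, c i)) ys" and ?T = "map (\<lambda>i. (\<tau> i, l i, c i)) ys"
    have "norm (J ((\<sigma> y, l y, c y) # ?S @ qs) - J ((\<tau> y, l y, c y) # ?S @ qs)) \<le> L * norm (\<sigma> y - \<tau> y)"
    proof (rule differentiable_bound[of UNIV "\<lambda>t. J ((t, l y, c y) # ?S @ qs)"
            "\<lambda>u h. h *\<^sub>R J ((u, l y, Suc (c y)) # ?S @ qs)"])
      fix u
      have "norm (J ((u, l y, Suc (c y)) # ?S @ qs)) \<le> L"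
        using Cons.prems ck by (intro L) (auto simp: subset_iff Suc_le_eq less_imp_le)
      then show "onorm (\<lambda>h. h *\<^sub>R J ((u, l y, Suc (c y)) # ?S @ qs)) \<le> L"
        by (simp add: onorm_scaleR_left[OF bounded_linear_ident] onorm_id)
    qed (use jets_deriv[OF J] in \<open>auto simp: has_vector_derivative_def\<close>)
    moreover have "norm (J (?S @ (\<tau> y, l y, c y) # qs) - J (?T @ (\<tau> y, l y, c y) # qs))
        \<le> L * (\<Sum>i\<leftarrow>ys. \<bar>\<sigma> i - \<tau> i\<bar>)"
      using Cons.prems ck by (intro Cons.IH) (auto simp: Suc_le_eq less_imp_le)
    moreover have "J (?S @ (\<tau> y, l y, c y) # qs) = J ((\<tau> y, l y, c y) # ?S @ qs)"
      "J (?T @ (\<tau> y, l y, c y) # qs) = J ((\<tau> y, l y, c y) # ?T @ qs)"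
      by (auto intro!: jets_perm[OF J])
    ultimately have "norm (J ((\<sigma> y, l y, c y) # ?S @ qs) - J ((\<tau> y, l y, c y) # ?T @ qs))
      \<le> L * \<bar>\<sigma> y - \<tau> y\<bar> + L * (\<Sum>i\<leftarrow>ys. \<bar>\<sigma> i - \<tau> i\<bar>)"
      using norm_triangle_ineq[of "J ((\<sigma> y, l y, c y) # ?S @ qs) - J ((\<tau> y, l y, c y) # ?S @ qs)"
        "J ((\<tau> y, l y, c y) # ?S @ qs) - J ((\<tau> y, l y, c y) # ?T @ qs)"] by simp
    then show ?case by (simp add: algebra_simps)
  qed simp
  from this[of xs "[]"] L(1) show ?thesis by auto
qed

lemma tendsto_sum_list_0:
  fixes f :: "'i \<Rightarrow> 'v \<Rightarrow> real"
  assumes "\<And>i. i \<in> set xs \<Longrightarrow> ((\<lambda>v. f i v) \<longlongrightarrow> 0) F"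
  shows "((\<lambda>v. \<Sum>i\<leftarrow>xs. f i v) \<longlongrightarrow> 0) F"
  using assms
proof (induction xs)
  case (Cons x xs)
  then have "((\<lambda>v. f x v + (\<Sum>i\<leftarrow>xs. f i v)) \<longlongrightarrow> 0 + 0) F" by (intro tendsto_add) auto
  then show ?case by simp
qed simp

text \<open>
  Joint continuity in all variables, for any topology on the parameter space; the product topology on
  sequences is the case used for smoothness of chaoses, pairs of reals the one used for Fubini.
\<close>

lemma continuous_on_jets:
  assumes J: "J \<in> jets" and f: "\<And>i. i \<in> set xs \<Longrightarrow> continuous_on S (\<lambda>v. f i v)"
  shows "continuous_on S (\<lambda>v. J (map (\<lambda>i. (f i v, l i, c i)) xs))"
  unfolding continuous_on_def
proof
  fix v assume v: "v \<in> S"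
  obtain L where L: "\<And>\<sigma> \<tau>. norm (J (map (\<lambda>i. (\<sigma> i, l i, c i)) xs) - J (map (\<lambda>i. (\<tau> i, l i, c i)) xs))
            \<le> L * (\<Sum>i\<leftarrow>xs. \<bar>\<sigma> i - \<tau> i\<bar>)"
    using jets_lipschitz[OF J] by blast
  have "((\<lambda>w. \<Sum>i\<leftarrow>xs. \<bar>f i w - f i v\<bar>) \<longlongrightarrow> 0) (at v within S)"
  proof (rule tendsto_sum_list_0)
    fix i assume "i \<in> set xs"
    then have "((\<lambda>w. f i w) \<longlongrightarrow> f i v) (at v within S)"
      using f v by (auto simp: continuous_on_def)
    then show "((\<lambda>w. \<bar>f i w - f i v\<bar>) \<longlongrightarrow> 0) (at v within S)"
      by (intro tendsto_rabs_zero LIM_zero)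
  qed
  then have "((\<lambda>w. L * (\<Sum>i\<leftarrow>xs. \<bar>f i w - f i v\<bar>)) \<longlongrightarrow> 0) (at v within S)"
    by (rule tendsto_mult_right_zero)
  then show "((\<lambda>v. J (map (\<lambda>i. (f i v, l i, c i)) xs)) \<longlongrightarrow> J (map (\<lambda>i. (f i v, l i, c i)) xs)) (at v within S)"
    by (rule LIM_zero_cancel[OF Lim_null_comparison[OF always_eventually[OF allI[OF L]]]])
qed

lemma continuous_on_jets_head:
  assumes J: "J \<in> jets"
  shows "continuous_on S (\<lambda>s. J ((s, a, m) # qs))"
  by (rule continuous_at_imp_continuous_on)
     (auto intro!: has_vector_derivative_continuous[OF jets_deriv[OF J]])

lemma continuous_on_jets_head2:
  assumes J: "J \<in> jets" and "continuous_on S f" "continuous_on S g"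
  shows "continuous_on S (\<lambda>v. J ((f v, a, m) # (g v, b, n) # qs))"
proof -
  define xs where "xs = None # Some None # map (Some \<circ> Some) [0..<length qs]"
  define F where "F i v = (case i of None \<Rightarrow> f v | Some None \<Rightarrow> g v | Some (Some j) \<Rightarrow> fst (qs ! j))" for i v
  define l where "l i = (case i of None \<Rightarrow> a | Some None \<Rightarrow> b | Some (Some j) \<Rightarrow> fst (snd (qs ! j)))" for i
  define c where "c i = (case i of None \<Rightarrow> m | Some None \<Rightarrow> n | Some (Some j) \<Rightarrow> snd (snd (qs ! j)))" for i
  have "map (\<lambda>i. (F i v, l i, c i)) xs = (f v, a, m) # (g v, b, n) # qs" for v
    by (auto simp: xs_def F_def l_def c_def o_def map_nth)
  moreover have "continuous_on S (\<lambda>v. J (map (\<lambda>i. (F i v, l i, c i)) xs))"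
    using assms by (intro continuous_on_jets) (auto simp: F_def xs_def)
  ultimately show ?thesis by simp
qed

section \<open>Mixed partial derivatives of a chaos\<close>

text \<open>
  Schwarz's theorem. Differentiating \<open>g x t - g x c = \<integral> gy x\<close> under the integral sign expresses
  \<open>gx x t - gx x c\<close> as the integral of the continuous function \<open>gyx x\<close>; differentiate this in \<open>t\<close>.
\<close>

lemma mixed_partials_eq:
  fixes g :: "real \<Rightarrow> real \<Rightarrow> 'k::banach"
  assumes gx: "\<And>x y. ((\<lambda>x. g x y) has_vector_derivative gx x y) (at x)"
    and gy: "\<And>x y. ((\<lambda>y. g x y) has_vector_derivative gy x y) (at y)"
    and gxy: "\<And>x y. ((\<lambda>y. gx x y) has_vector_derivative gxy x y) (at y)"
    and gyx: "\<And>x y. ((\<lambda>x. gy x y) has_vector_derivative gyx x y) (at x)"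
    and cont: "continuous_on UNIV (\<lambda>(x, y). gyx x y)"
  shows "gxy x y = gyx x y"
proof -
  \<comment> \<open>a base point to the left of \<open>y\<close>, so that \<open>y\<close> lies inside the interval \<open>{c..y + 1}\<close>\<close>
  define c where "c = y - 1"
  have int_gy: "(gy x has_integral g x t - g x c) {c..t}" if "c \<le> t" for x t
    using that by (rule fundamental_theorem_of_calculus) (rule has_vector_derivative_at_within[OF gy])
  have cont': "continuous_on S (gyx x)" for S
  proof -
    have "continuous_on S (\<lambda>y. (\<lambda>(x, y). gyx x y) (x, y))"
      by (rule continuous_on_compose2[OF cont continuous_on_Pair[OF continuous_on_const continuous_on_id]]) auto
    then show ?thesis by simp
  qed
  have eq: "gx x t - gx x c = integral {c..t} (gyx x)" if "c \<le> t" for t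
  proof -
    have "((\<lambda>x. integral (cbox c t) (gy x)) has_vector_derivative integral (cbox c t) (gyx x)) (at x within UNIV)"
      using int_gy[OF that] gyx
      by (intro leibniz_rule_vector_derivative)
         (auto intro: continuous_on_subset[OF cont] simp: integrable_on_def)
    moreover have "integral (cbox c t) (gy x) = g x t - g x c" for x
      using int_gy[OF that] by (simp add: integral_unique)
    moreover have "((\<lambda>x. g x t - g x c) has_vector_derivative gx x t - gx x c) (at x)"
      by (intro has_vector_derivative_diff gx)
    ultimately show ?thesis
      using vector_derivative_unique_at by fastforce
  qed
  have "((\<lambda>t. integral {c..t} (gyx x)) has_vector_derivative gyx x y) (at y within {c..y+1})"
    by (rule integral_has_vector_derivative) (auto simp: c_def intro: cont')
  then have "((\<lambda>t. gx x t - gx x c) has_vector_derivative gyx x y) (at y within {c..y+1})"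
    by (rule has_vector_derivative_transform[rotated 2]) (use eq in \<open>auto simp: c_def\<close>)
  moreover have "((\<lambda>t. gx x t - gx x c) has_vector_derivative gxy x y - 0) (at y within {c..y+1})"
    by (rule has_vector_derivative_at_within) (intro has_vector_derivative_diff gxy has_vector_derivative_const)
  ultimately show ?thesis
    using vector_derivative_unique_within_closed_interval[of c "y + 1" y] by (auto simp: c_def)
qed

text \<open>
  Each slot \<open>j\<close> is repeated as often as it is to be differentiated, so that iterated derivatives with
  multi-orders become plain sequences of single derivatives.
\<close>

definition expand_orders :: "nat list \<Rightarrow> nat list" where
  "expand_orders ms = concat (map (\<lambda>j. replicate (ms ! j) j) [0..<length ms])"

lemma foldr_replicate_concat:
  "foldr (\<lambda>j. f j ^^ c j) xs G = foldr f (concat (map (\<lambda>j. replicate (c j) j) xs)) G"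
proof -
  have *: "foldr f (replicate n j) G = (f j ^^ n) G" for n j G
    by (induction n) auto
  show ?thesis by (induction xs) (auto simp: *)
qed

lemma multi_partial_expand: "multi_partial ms F = foldr chaos_partial (expand_orders ms) F"
  unfolding multi_partial_def expand_orders_def by (rule foldr_replicate_concat)

lemma expand_orders_Cons_Suc: "expand_orders (Suc m # ms) = 0 # expand_orders (m # ms)"
  by (simp add: expand_orders_def upt_conv_Cons del: upt_Suc)
     (rule arg_cong[where f = concat], auto simp: nth_Cons split: nat.splits)

lemma chaos_partial_short: "length ps \<le> j \<Longrightarrow> chaos_partial j F ps = 0"
  by (simp add: chaos_partial_def list_update_beyond vector_derivative_at[OF has_vector_derivative_const])

lemma chaos_smooth_deriv:
  assumes "chaos_smooth F" "j < length ps"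
  shows "((\<lambda>t. foldr chaos_partial js F (ps[j := (t, a)])) has_vector_derivative
     chaos_partial j (foldr chaos_partial js F) (ps[j := (u, a)])) (at u)"
proof -
  have "(\<lambda>t. foldr chaos_partial js F ((ps[j := (u, a)])[j := (t, snd ((ps[j := (u, a)]) ! j))]))
          differentiable (at (fst ((ps[j := (u, a)]) ! j)))"
    using assms unfolding chaos_smooth_def by (metis length_list_update)
  with assms(2) show ?thesis
    by (simp add: chaos_partial_def vector_derivative_works)
qed

lemma chaos_smooth_continuous2:
  assumes "chaos_smooth F" "i < length ps" "j < length ps" "i \<noteq> j"
  shows "continuous_on UNIV (\<lambda>(x, y). foldr chaos_partial js F (ps[i := (x, a), j := (y, b)]))"
proof -
  define is' where "is' = (map snd ps)[i := a, j := b]"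
  \<comment> \<open>the plane of the variables \<open>i\<close> and \<open>j\<close>, embedded continuously into the space of sequences\<close>
  define s where "s z n = (if n = i then fst z else if n = j then snd z else fst (ps ! n))" for z :: "real \<times> real" and n
  have "continuous_on UNIV s"
    proof (rule continuous_on_coordinatewise_then_product)
    show "continuous_on UNIV (\<lambda>z. s z n)" for n
      by (cases "n = i"; cases "n = j") (auto simp: s_def intro!: continuous_intros)
  qed
  moreover have "continuous_on UNIV (\<lambda>s :: nat \<Rightarrow> real. foldr chaos_partial js F (zip (map s [0..<length is']) is'))"
    using assms(1) unfolding chaos_smooth_def by blast
  ultimately have "continuous_on UNIV (\<lambda>z. foldr chaos_partial js F (zip (map (s z) [0..<length is']) is'))"
    using continuous_on_compose2[of UNIV "\<lambda>s. foldr chaos_partial js F (zip (map s [0..<length is']) is')" UNIV s]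
    by simp
  moreover have "zip (map (s z) [0..<length is']) is' = ps[i := (fst z, a), j := (snd z, b)]" for z
    using assms(2-) by (intro nth_equalityI) (auto simp: is'_def s_def nth_list_update prod_eq_iff)
  ultimately show ?thesis by (simp add: case_prod_unfold)
qed

text \<open>
  The derivatives of a smooth chaos are jointly continuous in any two of its variables, so Schwarz's theorem
  applies slotwise; derivatives in slots that do not exist vanish.
\<close>

lemma chaos_partial_commute:
  fixes F :: "('d, 'k::banach) chaos"
  assumes F: "chaos_smooth F"
  defines "G \<equiv> \<lambda>js. foldr chaos_partial js F"
  shows "chaos_partial i (chaos_partial j (G js)) = chaos_partial j (chaos_partial i (G js))"
proof (cases "i = j")
  case False
  have G: "chaos_partial j (G js) = G (j # js)" for j js by (simp add: G_def)
  have zero: "chaos_partial i (chaos_partial j (G js)) ps = 0" if "length ps \<le> j" for i j ps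
    by (simp add: chaos_partial_def[of i] chaos_partial_short that)
  show ?thesis
  proof
    fix ps :: "(real \<times> 'd) list"
    show "chaos_partial i (chaos_partial j (G js)) ps = chaos_partial j (chaos_partial i (G js)) ps"
    proof (cases "i < length ps \<and> j < length ps")
      case True
      define a b where "a = snd (ps ! i)" and "b = snd (ps ! j)"
      let ?p = "\<lambda>x y. ps[i := (x, a), j := (y, b)]"
      have sw: "?p x y = ps[j := (y, b), i := (x, a)]" for x y
        using False by (simp add: list_update_swap)
      have y: "((\<lambda>y. G js' (?p x y)) has_vector_derivative chaos_partial j (G js') (?p x y)) (at y)" for js' x y
        using chaos_smooth_deriv[OF F, of j "ps[i := (x, a)]" js' b y] True by (simp add: G_def)
      have x: "((\<lambda>x. G js' (?p x y)) has_vector_derivative chaos_partial i (G js') (?p x y)) (at x)" for js' x y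
        using chaos_smooth_deriv[OF F, of i "ps[j := (y, b)]" js' a x] True by (simp add: G_def sw)
      have "chaos_partial j (chaos_partial i (G js)) (?p x y) = chaos_partial i (chaos_partial j (G js)) (?p x y)" for x y
      proof (rule mixed_partials_eq[of "\<lambda>x y. G js (?p x y)" "\<lambda>x y. chaos_partial i (G js) (?p x y)"
            "\<lambda>x y. chaos_partial j (G js) (?p x y)"])
        show "((\<lambda>y. chaos_partial i (G js) (?p x y)) has_vector_derivative
            chaos_partial j (chaos_partial i (G js)) (?p x y)) (at y)" for x y
          using y[of "i # js"] by (simp add: G)
        show "((\<lambda>x. chaos_partial j (G js) (?p x y)) has_vector_derivative
            chaos_partial i (chaos_partial j (G js)) (?p x y)) (at x)" for x y
          using x[of "j # js"] by (simp add: G)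
        show "continuous_on UNIV (\<lambda>(x, y). chaos_partial i (chaos_partial j (G js)) (?p x y))"
          using chaos_smooth_continuous2[OF F, of i ps j "i # j # js" a b] True False by (simp add: G_def)
      qed (rule x y)+
      moreover have "?p (fst (ps ! i)) (fst (ps ! j)) = ps"
        unfolding a_def b_def by simp
      ultimately show ?thesis by metis
    next
      case *: False
      then show ?thesis using zero chaos_partial_short by (metis not_less)
    qed
  qed
qed simp

lemma foldr_partial_move:
  fixes F :: "('d, 'k::banach) chaos"
  assumes F: "chaos_smooth F"
  shows "foldr chaos_partial (us @ j # vs) F = foldr chaos_partial (j # us @ vs) F"
proof (induction us)
  case (Cons u us)
  then show ?case using chaos_partial_commute[OF F, of u j "us @ vs"] by simp
qed simp

lemma foldr_partial_mset:
  fixes F :: "('d, 'k::banach) chaos"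
  assumes F: "chaos_smooth F"
  shows "mset js = mset js' \<Longrightarrow> foldr chaos_partial js F = foldr chaos_partial js' F"
proof (induction js arbitrary: js')
  case (Cons j js)
  then have "j \<in> set js'" by (metis list.set_intros(1) mset_eq_setD)
  then obtain us vs where js': "js' = us @ j # vs" by (metis split_list)
  then have "foldr chaos_partial js F = foldr chaos_partial (us @ vs) F"
    using Cons.prems by (intro Cons.IH) simp
  then show ?case unfolding js' foldr_partial_move[OF F] by simp
qed simp

lemma permute_list_update:
  assumes \<sigma>: "\<sigma> permutes {..<length ps}" and j: "j < length ps"
  shows "(permute_list \<sigma> ps)[j := x] = permute_list \<sigma> (ps[\<sigma> j := x])"
proof (rule nth_equalityI)
  fix i assume "i < length ((permute_list \<sigma> ps)[j := x])"
  then have i: "i < length ps" by simp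
  have "\<sigma> i < length ps" "\<sigma> j < length ps"
    using permutes_in_image[OF \<sigma>] i j by auto
  moreover have "\<sigma> i = \<sigma> j \<longleftrightarrow> i = j"
    using permutes_inj[OF \<sigma>] by (simp add: inj_eq)
  ultimately show "(permute_list \<sigma> ps)[j := x] ! i = permute_list \<sigma> (ps[\<sigma> j := x]) ! i"
    using i j permute_list_nth[OF \<sigma>] permute_list_nth[of \<sigma> "ps[\<sigma> j := x]"] \<sigma>
    by (auto simp add: nth_list_update)
qed simp

text \<open>
  Symmetry of \<open>F\<close> is the case without derivatives, and each further derivative only uses that slot \<open>j\<close> of the
  permuted list holds the entry \<open>\<sigma> j\<close> of the original one.
\<close>

lemma foldr_partial_permute:
  assumes F: "chaos_symmetric F" and \<sigma>: "\<sigma> permutes {..<length ps}"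
  shows "foldr chaos_partial js F (permute_list \<sigma> ps) = foldr chaos_partial (map \<sigma> js) F ps"
  using \<sigma>
proof (induction js arbitrary: ps)
  case Nil
  then have "mset (permute_list \<sigma> ps) = mset ps" by simp
  then have "F (permute_list \<sigma> ps) = F ps" using F unfolding chaos_symmetric_def by blast
  then show ?case by simp
next
  case (Cons j js)
  show ?case
  proof (cases "j < length ps")
    case True
    have nth: "permute_list \<sigma> ps ! j = ps ! \<sigma> j"
      using Cons.prems True by (simp add: permute_list_nth)
    have "foldr chaos_partial js F ((permute_list \<sigma> ps)[j := (t, a)]) =
          foldr chaos_partial (map \<sigma> js) F (ps[\<sigma> j := (t, a)])" for t a
      using Cons.IH[of "ps[\<sigma> j := (t, a)]"] Cons.prems True by (simp add: permute_list_update)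
    then show ?thesis by (simp add: chaos_partial_def[of j] chaos_partial_def[of "\<sigma> j"] nth)
  next
    case False
    then have "\<sigma> j = j" using Cons.prems by (auto simp: permutes_def)
    then show ?thesis using False by (simp add: chaos_partial_short)
  qed
qed

lemma foldr_partial_periodic:
  assumes F: "chaos_smooth F" and per: "chaos_periodic F"
  shows "chaos_periodic (foldr chaos_partial js F)"
proof (induction js)
  case (Cons j js)
  let ?G = "foldr chaos_partial js F"
  have IH: "?G (ps[i := (t + 1, a)]) = ?G (ps[i := (t, a)])" for ps i t a
  proof (cases "i < length ps")
    case True
    then show ?thesis
      using Cons unfolding chaos_periodic_def
      by (auto dest!: spec[of _ "ps[i := (t, a)]"] spec[of _ i])
  qed (simp add: list_update_beyond)
  show ?case unfolding chaos_periodic_def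
  proof (intro allI impI)
    fix ps :: "(real \<times> 'a) list" and i assume i: "i < length ps"
    show "foldr chaos_partial (j # js) F (ps[i := (fst (ps ! i) + 1, snd (ps ! i))]) =
          foldr chaos_partial (j # js) F ps"
    proof (cases "j = i")
      case False
      have "?G (ps[i := (fst (ps ! i) + 1, snd (ps ! i)), j := q]) = ?G (ps[j := q])" for q
        using IH[of "ps[j := q]" i "fst (ps ! i)" "snd (ps ! i)"] False
        by (simp add: list_update_swap) (metis list_update_id list_update_swap)
      then show ?thesis using False by (simp add: chaos_partial_def)
    next
      case [simp]: True
      define a s where "a = snd (ps ! i)" and "s = fst (ps ! i)"
      have 1: "((\<lambda>t. ?G (ps[i := (t, a)])) has_vector_derivative chaos_partial i ?G (ps[i := (u, a)])) (at u)" for u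
        by (rule chaos_smooth_deriv[OF F i])
      have "(((\<lambda>t. ?G (ps[i := (t, a)])) \<circ> (\<lambda>t. t + 1)) has_vector_derivative
          (1 *\<^sub>R chaos_partial i ?G (ps[i := (s + 1, a)]))) (at s)"
        by (rule vector_diff_chain_at) (auto intro!: derivative_eq_intros 1)
      then have "((\<lambda>t. ?G (ps[i := (t, a)])) has_vector_derivative chaos_partial i ?G (ps[i := (s + 1, a)])) (at s)"
        by (simp add: o_def IH)
      from vector_derivative_unique_at[OF this 1]
      show ?thesis by (simp add: a_def s_def)
    qed
  qed
qed (use per in simp)

definition jet_of :: "('d, 'k::real_normed_field) chaos \<Rightarrow> ('d, 'k) jet" where
  "jet_of F qs = fact (length qs) * multi_partial (map order_of qs) F (map (\<lambda>(s, i, m). (s, i)) qs)"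

lemma mset_concat_map: "mset xs = mset ys \<Longrightarrow> mset (concat (map f xs)) = mset (concat (map f ys))"
  by (simp add: mset_concat o_def) (metis mset_map sum_mset_sum_list)

text \<open>
  A permutation of the triples permutes variables and orders simultaneously. Symmetry of \<open>F\<close> turns the
  former into a permutation of the order of differentiation, which is immaterial by Schwarz's theorem.
\<close>

lemma jet_of_mset:
  fixes F :: "('d, 'k::{real_normed_field, banach}) chaos"
  assumes F: "chaos_smooth F" "chaos_symmetric F" and eq: "mset ps = mset qs"
  shows "jet_of F ps = jet_of F qs"
proof -
  obtain \<sigma> where \<sigma>: "\<sigma> permutes {..<length qs}" "permute_list \<sigma> qs = ps"
    using mset_eq_permutation[OF eq] by blast
  define ms where "ms = map order_of qs"
  have len: "length ms = length qs" by (simp add: ms_def)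
  have 1: "map order_of ps = permute_list \<sigma> ms" "map (\<lambda>(s, i, m). (s, i)) ps = permute_list \<sigma> (map (\<lambda>(s, i, m). (s, i)) qs)"
    using \<sigma> by (auto simp: permute_list_map ms_def)
  have "map \<sigma> (expand_orders (permute_list \<sigma> ms)) = concat (map (\<lambda>j. replicate (ms ! \<sigma> j) (\<sigma> j)) [0..<length ms])"
    unfolding expand_orders_def using \<sigma>(1) len
    by (simp add: map_concat o_def) (rule arg_cong[where f = concat], auto simp: permute_list_nth)
  also have "\<dots> = concat (map (\<lambda>j. replicate (ms ! j) j) (map \<sigma> [0..<length ms]))"
    by (simp add: o_def)
  also have "mset \<dots> = mset (expand_orders ms)"
    unfolding expand_orders_def
  proof (rule mset_concat_map)
    have "mset (map \<sigma> [0..<length ms]) = mset (permute_list \<sigma> [0..<length ms])"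
      using \<sigma>(1) len by (intro arg_cong[where f = mset] nth_equalityI) (auto simp: permute_list_nth permutes_in_image[of \<sigma> "{..<length qs}", simplified])
    then show "mset (map \<sigma> [0..<length ms]) = mset [0..<length ms]"
      using \<sigma>(1) len by simp
  qed
  finally have "foldr chaos_partial (map \<sigma> (expand_orders (permute_list \<sigma> ms))) F = foldr chaos_partial (expand_orders ms) F"
    by (intro foldr_partial_mset F(1))
  moreover have "length ps = length qs" using eq by (metis size_mset)
  ultimately show ?thesis
    unfolding jet_of_def multi_partial_expand 1 using \<sigma>(1)
    by (simp add: foldr_partial_permute[OF F(2)] flip: ms_def)
qed

lemma jet_of_deriv:
  assumes F: "chaos_smooth F"
  shows "((\<lambda>t. jet_of F ((t, a, m) # qs)) has_vector_derivative jet_of F ((s, a, Suc m) # qs)) (at s)"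
proof -
  let ?ps = "(s, a) # map (\<lambda>(s, i, m). (s, i)) qs"
  have "((\<lambda>t. foldr chaos_partial (expand_orders (m # map order_of qs)) F (?ps[0 := (t, a)])) has_vector_derivative
     chaos_partial 0 (foldr chaos_partial (expand_orders (m # map order_of qs)) F) (?ps[0 := (s, a)])) (at s)"
    by (rule chaos_smooth_deriv[OF F]) simp
  then show ?thesis
    unfolding jet_of_def multi_partial_expand
    by (simp add: expand_orders_Cons_Suc has_vector_derivative_mult_right)
qed

lemma jet_of_periodic:
  assumes F: "chaos_smooth F" "chaos_periodic F"
  shows "jet_of F ((s + 1, a, m) # qs) = jet_of F ((s, a, m) # qs)"
  using foldr_partial_periodic[OF F, of "expand_orders (m # map order_of qs)"]
  unfolding jet_of_def multi_partial_expand chaos_periodic_def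
  by (auto dest!: spec[of _ "(s, a) # map (\<lambda>(s, i, m). (s, i)) qs"] spec[of _ 0])

section \<open>Jets and the Connes space\<close>

text \<open>
  The inverse of \<open>jet_of\<close>, by \<open>jet_of_chaos_of\<close> and \<open>chaos_of_jet_of\<close>.
\<close>

definition chaos_of :: "('d, 'k::real_normed_field) jet \<Rightarrow> ('d, 'k) chaos" where
  "chaos_of J ps = J (map (\<lambda>(s, i). (s, i, 0)) ps) / fact (length ps)"

lemma jets_deriv_at:
  assumes J: "J \<in> jets" and j: "j < n"
  shows "((\<lambda>t. J (map (\<lambda>i. (if i = j then t else \<sigma> i, l i, c i)) [0..<n])) has_vector_derivative
     J (map (\<lambda>i. (if i = j then u else \<sigma> i, l i, if i = j then Suc (c i) else c i)) [0..<n])) (at u)"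
proof -
  let ?R = "remove1 j [0..<n]"
  have R: "J (map f [0..<n]) = J (f j # map f ?R)" for f
    by (rule jets_perm[OF J]) (use j in \<open>simp flip: mset_map image_mset_add_mset add: mset_map\<close>)
  have j': "j \<notin> set ?R" by simp
  let ?M = "map (\<lambda>i. (\<sigma> i, l i, c i)) ?R"
  have "map (\<lambda>i. (if i = j then t else \<sigma> i, l i, c i)) ?R = ?M"
    "map (\<lambda>i. (if i = j then t else \<sigma> i, l i, if i = j then Suc (c i) else c i)) ?R = ?M" for t
    using j' by (auto intro!: map_cong)
  then have "J (map (\<lambda>i. (if i = j then t else \<sigma> i, l i, c i)) [0..<n]) = J ((t, l j, c j) # ?M)"
    "J (map (\<lambda>i. (if i = j then t else \<sigma> i, l i, if i = j then Suc (c i) else c i)) [0..<n]) = J ((t, l j, Suc (c j)) # ?M)" for t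
    by (simp_all only: R if_True refl)
  then show ?thesis using jets_deriv[OF J, of "l j" "c j" ?M u] by (simp only:)
qed

text \<open>
  Each derivative raises the order of its slot by one, and a slot beyond the length of the list
  differentiates a constant function.
\<close>

lemma foldr_partial_chaos_of:
  assumes J: "J \<in> jets"
  shows "foldr chaos_partial js (chaos_of J) ps = (if \<forall>j\<in>set js. j < length ps
     then J (map (\<lambda>j. (fst (ps ! j), snd (ps ! j), count_list js j)) [0..<length ps]) / fact (length ps) else 0)"
proof (induction js arbitrary: ps)
  case Nil
  have "map (\<lambda>(s, i). (s, i, 0)) ps = map (\<lambda>j. (fst (ps ! j), snd (ps ! j), 0)) [0..<length ps]"
    by (intro nth_equalityI) (auto simp: case_prod_unfold)
  then have "J (map (\<lambda>(s, i). (s, i, 0)) ps) = J (map (\<lambda>j. (fst (ps ! j), snd (ps ! j), 0)) [0..<length ps])"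
    by (rule arg_cong)
  then show ?case by (simp add: chaos_of_def)
next
  case (Cons j js)
  show ?case
  proof (cases "\<forall>j\<in>set (j # js). j < length ps")
    case True
    then have j: "j < length ps" by simp
    have "foldr chaos_partial js (chaos_of J) (ps[j := (t, snd (ps ! j))]) =
      J (map (\<lambda>i. (if i = j then t else fst (ps ! i), snd (ps ! i), count_list js i)) [0..<length ps]) / fact (length ps)" for t
      using True unfolding Cons by (auto intro!: arg_cong[where f = J] nth_equalityI simp: nth_list_update)
    moreover have "((\<lambda>t. J (map (\<lambda>i. (if i = j then t else fst (ps ! i), snd (ps ! i), count_list js i)) [0..<length ps]) / fact (length ps))
       has_vector_derivative J (map (\<lambda>i. (if i = j then fst (ps ! j) else fst (ps ! i), snd (ps ! i),
           if i = j then Suc (count_list js i) else count_list js i)) [0..<length ps]) / fact (length ps)) (at (fst (ps ! j)))"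
      unfolding divide_inverse by (intro has_vector_derivative_mult_left jets_deriv_at[OF J j])
    moreover have "map (\<lambda>i. (if i = j then fst (ps ! j) else fst (ps ! i), snd (ps ! i),
           if i = j then Suc (count_list js i) else count_list js i)) [0..<length ps]
        = map (\<lambda>i. (fst (ps ! i), snd (ps ! i), count_list (j # js) i)) [0..<length ps]"
      by auto
    ultimately have "chaos_partial j (foldr chaos_partial js (chaos_of J)) ps =
        J (map (\<lambda>i. (fst (ps ! i), snd (ps ! i), count_list (j # js) i)) [0..<length ps]) / fact (length ps)"
      unfolding chaos_partial_def[of j] by (simp only: vector_derivative_at)
    then show ?thesis using True by simp
  next
    case False
    show ?thesis
    proof (cases "j < length ps")
      case True
      with False obtain i where "i \<in> set js" "\<not> i < length ps" by auto
      then have "foldr chaos_partial js (chaos_of J) (ps[j := q]) = 0" for q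
        unfolding Cons by auto
      then have "chaos_partial j (foldr chaos_partial js (chaos_of J)) ps = 0"
        by (simp add: chaos_partial_def[of j] vector_derivative_at[OF has_vector_derivative_const])
      moreover have "(\<forall>j\<in>set (j # js). j < length ps) = False" using False by simp
      ultimately show ?thesis by (simp del: ball_simps list.set)
    qed (simp add: chaos_partial_short)
  qed
qed

lemma chaos_smooth_chaos_of:
  fixes J :: "('d, 'k::real_normed_field) jet"
  assumes J: "J \<in> jets"
  shows "chaos_smooth (chaos_of J)"
  unfolding chaos_smooth_def
proof (intro allI conjI impI)
  fix js ps j
  assume j: "j < length (ps :: (real \<times> 'd) list)"
  show "(\<lambda>t. foldr chaos_partial js (chaos_of J) (ps[j := (t, snd (ps ! j))])) differentiable (at (fst (ps ! j)))"
  proof (cases "\<forall>j\<in>set js. j < length ps")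
    case True
    have "foldr chaos_partial js (chaos_of J) (ps[j := (t, snd (ps ! j))]) =
      J (map (\<lambda>i. (if i = j then t else fst (ps ! i), snd (ps ! i), count_list js i)) [0..<length ps]) / fact (length ps)" for t
      using True unfolding foldr_partial_chaos_of[OF J]
      by (auto intro!: arg_cong[where f = J] nth_equalityI simp: nth_list_update)
    then show ?thesis
      by (simp only: divide_inverse)
         (rule differentiableI_vector, rule has_vector_derivative_mult_left, rule jets_deriv_at[OF J j])
  next
    case False
    then have "(\<forall>j\<in>set js. j < length ps) = False" by simp
    then show ?thesis by (simp add: foldr_partial_chaos_of[OF J] del: ball_simps)
  qed
next
  fix js and "is" :: "'d list"
  show "continuous_on UNIV (\<lambda>s :: nat \<Rightarrow> real. foldr chaos_partial js (chaos_of J) (zip (map s [0..<length is]) is))"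
  proof (cases "\<forall>j\<in>set js. j < length is")
    case True
    have eq: "map (\<lambda>j. (fst (zip (map s [0..<length is]) is ! j), snd (zip (map s [0..<length is]) is ! j), count_list js j)) [0..<length is]
      = map (\<lambda>j. (s j, is ! j, count_list js j)) [0..<length is]" for s :: "nat \<Rightarrow> real"
      by auto
    have "continuous_on UNIV (\<lambda>s :: nat \<Rightarrow> real. J (map (\<lambda>j. (s j, is ! j, count_list js j)) [0..<length is]))"
      by (intro continuous_on_jets[OF J] continuous_on_product_coordinates)
    with True show ?thesis
      by (simp add: foldr_partial_chaos_of[OF J] eq continuous_on_divide)
  next
    case False
    then have "(\<forall>j\<in>set js. j < length is) = False" by simp
    then show ?thesis by (simp add: foldr_partial_chaos_of[OF J] del: ball_simps)
  qed
qed

lemma chaos_symmetric_chaos_of: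
  assumes J: "J \<in> jets"
  shows "chaos_symmetric (chaos_of J)"
  unfolding chaos_symmetric_def chaos_of_def
  by (metis (no_types, lifting) J jets_perm mset_eq_length mset_map)

lemma chaos_periodic_chaos_of:
  assumes J: "J \<in> jets"
  shows "chaos_periodic (chaos_of J)"
  unfolding chaos_periodic_def chaos_of_def
proof (intro allI impI)
  fix ps :: "(real \<times> 'a) list" and j assume j: "j < length ps"
  let ?f = "\<lambda>(s, i). (s, i, 0::nat)"
  let ?R = "map ?f (take j ps @ drop (Suc j) ps)"
  have 1: "J (map ?f (ps[j := x])) = J (?f x # ?R)" for x
    by (rule jets_perm[OF J]) (use j in \<open>simp add: upd_conv_take_nth_drop\<close>)
  have "J (map ?f (ps[j := (fst (ps ! j) + 1, snd (ps ! j))])) = J (map ?f (ps[j := ps ! j]))"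
    unfolding 1 using jets_periodic[OF J, of "fst (ps ! j)" "snd (ps ! j)" 0 ?R] by (simp add: case_prod_unfold)
  then show "J (map ?f (ps[j := (fst (ps ! j) + 1, snd (ps ! j))])) / fact (length (ps[j := (fst (ps ! j) + 1, snd (ps ! j))])) =
         J (map ?f ps) / fact (length ps)"
    by simp
qed

lemma count_list_expand:
  "j < length ms \<Longrightarrow> count_list (expand_orders ms) j = ms ! j"
proof -
  assume j: "j < length ms"
  have *: "count_list (concat (map (\<lambda>j. replicate (c j) j) xs)) j = (if j \<in> set xs then c j else 0)"
    if "distinct xs" for c and xs :: "nat list"
  proof -
    have r: "count_list (replicate n i) j = (if i = j then n else 0)" for n i
      by (induction n) auto
    show ?thesis using that by (induction xs) (auto simp: r)
  qed
  show ?thesis unfolding expand_orders_def by (subst *) (use j in auto)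
qed

lemma jet_of_chaos_of:
  fixes J :: "('d, 'k::real_normed_field) jet"
  assumes J: "J \<in> jets"
  shows "jet_of (chaos_of J) = J"
proof
  fix qs :: "(real \<times> 'd \<times> nat) list"
  have 1: "\<forall>j\<in>set (expand_orders (map order_of qs)). j < length qs"
    by (auto simp: expand_orders_def)
  have 2: "map (\<lambda>j. (fst (map (\<lambda>(s, i, m). (s, i)) qs ! j), snd (map (\<lambda>(s, i, m). (s, i)) qs ! j),
     count_list (expand_orders (map order_of qs)) j)) [0..<length qs] = qs"
    by (intro nth_equalityI) (auto simp: count_list_expand case_prod_unfold)
  show "jet_of (chaos_of J) qs = J qs"
    unfolding jet_of_def multi_partial_expand foldr_partial_chaos_of[OF J] using 1 2 by simp
qed

lemma chaos_of_jet_of: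
  fixes F :: "('d, 'k::real_normed_field) chaos"
  shows "chaos_of (jet_of F) = F"
proof
  fix ps :: "(real \<times> 'd) list"
  have e: "expand_orders (map order_of (map (\<lambda>(s, i). (s, i, 0)) ps)) = []"
    by (auto simp: expand_orders_def case_prod_unfold)
  have p: "map (\<lambda>(s, i, m). (s, i)) (map (\<lambda>(s, i). (s, i, 0)) ps) = ps"
    by (auto simp: case_prod_unfold intro: nth_equalityI)
  show "chaos_of (jet_of F) ps = F ps"
    unfolding chaos_of_def jet_of_def multi_partial_expand e p by simp
qed

lemma jet_of_zip:
  assumes "length s = n" "length is = n" "length ms = n"
  shows "jet_of F (zip s (zip is ms)) = fact n * multi_partial ms F (zip s is)"
proof -
  have "map order_of (zip s (zip is ms)) = ms" "map (\<lambda>(s, i, m). (s, i)) (zip s (zip is ms)) = zip s is"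
    using assms by (auto intro!: nth_equalityI)
  then show ?thesis using assms by (simp add: jet_of_def)
qed

lemma card_labels: "card {is :: 'd::finite list. length is = n} = CARD('d) ^ n"
  using card_lists_length_eq[of "UNIV :: 'd set" n] by simp

lemma finite_labels: "finite {is :: 'd::finite list. length is = n}"
  using finite_lists_length_eq[of "UNIV :: 'd set" n] by simp

lemma orders_set: "{ms. length ms = n \<and> set ms \<subseteq> {0..k}} = {ms. set ms \<subseteq> {0..k::nat} \<and> length ms = n}"
  by auto

text \<open>
  In degree \<open>n\<close> there are \<open>(k + 1)\<^sup>n\<close> multi-orders and \<open>d\<^sup>n\<close> tensor components, whose number is absorbed by
  enlarging \<open>C\<close>; the additional factor 2 leaves a geometric series in \<open>n\<close>.
\<close>

lemma CO_norm_le: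
  fixes F :: "('d::finite, 'k::real_normed_field) chaos"
  assumes bd: "jet_bounded k (2 * real (k + 1) * real CARD('d) * C) B (jet_of F)" and C: "C > 0"
  shows "CO_norm k C F \<le> ennreal (2 * B)"
proof -
  define D where "D = 2 * real (k + 1) * real CARD('d) * C"
  have D: "D > 0" using C by (simp add: D_def)
  have B: "B \<ge> 0" using jet_bounded_nonneg[OF bd] .
  have pt: "norm (multi_partial ms F (zip s is)) \<le> B / D ^ n"
    if "length s = n" "length is = n" "length ms = n" "set ms \<subseteq> {0..k}" for s "is" ms n
  proof -
    have "D ^ length (zip s (zip is ms)) * norm (jet_of F (zip s (zip is ms))) \<le> B * fact (length (zip s (zip is ms)))"
      using that by (intro jet_boundedD[OF bd[folded D_def]]) (auto dest!: set_zip_rightD simp: subset_iff)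
    then have "D ^ n * (fact n * norm (multi_partial ms F (zip s is))) \<le> B * fact n"
      using that by (simp add: jet_of_zip norm_mult)
    then have "(D ^ n * norm (multi_partial ms F (zip s is))) * fact n \<le> B * fact n"
      by (simp add: mult_ac)
    then have "D ^ n * norm (multi_partial ms F (zip s is)) \<le> B"
      by (rule mult_right_le_imp_le) simp
    then show ?thesis using D by (simp add: field_simps)
  qed
  have sup: "chaos_sup_norm n (multi_partial ms F) \<le> ennreal (CARD('d) ^ n * (B / D ^ n))"
    if "length ms = n" "set ms \<subseteq> {0..k}" for ms n
    unfolding chaos_sup_norm_def
  proof (rule SUP_least, rule ennreal_leI)
    fix s :: "real list" assume s: "s \<in> {s. length s = n}"
    have "sqrt (\<Sum>is\<in>{is. length is = n}. (norm (multi_partial ms F (zip s is)))\<^sup>2)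
       \<le> (\<Sum>is\<in>{is. length is = n}. norm (multi_partial ms F (zip s is)))"
      using L2_set_le_sum[of "{is. length is = n}" "\<lambda>is. norm (multi_partial ms F (zip s is))"] by (simp add: L2_set_def)
    also have "\<dots> \<le> (\<Sum>is\<in>{is :: 'd list. length is = n}. B / D ^ n)"
      using s that by (intro sum_mono pt) auto
    finally show "sqrt (\<Sum>is\<in>{is. length is = n}. (norm (multi_partial ms F (zip s is)))\<^sup>2) \<le> CARD('d) ^ n * (B / D ^ n)"
      by (simp add: card_labels)
  qed
  have "ennreal (C ^ n) * degree_norm k n F \<le> ennreal (B * (1 / 2) ^ n)" for n
  proof -
    have "degree_norm k n F \<le> (\<Sum>ms\<in>{ms. length ms = n \<and> set ms \<subseteq> {0..k}}. ennreal (CARD('d) ^ n * (B / D ^ n)))"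
      unfolding degree_norm_def by (intro sum_mono sup) auto
    also have "\<dots> = ennreal (real (k + 1) ^ n * (CARD('d) ^ n * (B / D ^ n)))"
    proof -
      have "card {ms. length ms = n \<and> set ms \<subseteq> {0..k}} = (k + 1) ^ n"
        unfolding orders_set by (subst card_lists_length_eq) auto
      moreover have "of_nat ((k + 1) ^ n) = ennreal (real (k + 1) ^ n)"
        by (metis ennreal_of_nat_eq_real_of_nat of_nat_power)
      moreover have "0 \<le> CARD('d) ^ n * (B / D ^ n)" using B D by simp
      ultimately show ?thesis
        by (simp only: sum_constant ennreal_mult'')
    qed
    finally have "ennreal (C ^ n) * degree_norm k n F \<le> ennreal (C ^ n) * ennreal (real (k + 1) ^ n * (CARD('d) ^ n * (B / D ^ n)))"
      by (rule mult_left_mono) simp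
    also have "\<dots> = ennreal (C ^ n * (real (k + 1) ^ n * (CARD('d) ^ n * (B / D ^ n))))"
      using C B D by (subst ennreal_mult) auto
    also have "C ^ n * (real (k + 1) ^ n * (CARD('d) ^ n * (B / D ^ n))) = B * (1 / 2) ^ n"
      using C by (simp add: D_def power_mult_distrib field_simps del: of_nat_Suc of_nat_add)
    finally show ?thesis .
  qed
  then have "CO_norm k C F \<le> (\<Sum>n. ennreal (B * (1 / 2) ^ n))"
    unfolding CO_norm_def by (intro suminf_le) auto
  also have "\<dots> = ennreal (\<Sum>n. B * (1 / 2) ^ n)"
    using B by (intro suminf_ennreal2) (auto intro!: summable_mult summable_geometric)
  also have "(\<Sum>n. B * (1 / 2) ^ n) = 2 * B"
    by (subst suminf_mult) (auto simp: suminf_geometric summable_geometric)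
  finally show ?thesis .
qed

text \<open>
  A single component of a single derivative is bounded by the Hilbert norm of the tensor, whose
  supremum is one of the non-negative terms of the Connes norm.
\<close>

lemma jet_bounded_CO_norm:
  fixes F :: "('d::finite, 'k::real_normed_field) chaos"
  assumes fin: "CO_norm k C F < \<infinity>" and C: "C > 0"
  shows "jet_bounded k C (enn2real (CO_norm k C F)) (jet_of F)"
  unfolding jet_bounded_def
proof (intro allI impI)
  fix qs :: "(real \<times> 'd \<times> nat) list"
  assume k: "\<forall>q\<in>set qs. order_of q \<le> k"
  define s "is" ms n where "s = map fst qs" and "is = map (\<lambda>q. fst (snd q)) qs" and "ms = map order_of qs" and "n = length qs"
  have len [simp]: "length s = n" "length is = n" "length ms = n" "length qs = n"
    by (simp_all add: s_def is_def ms_def n_def)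
  have qs: "qs = zip s (zip is ms)"
    by (intro nth_equalityI) (auto simp: s_def is_def ms_def prod_eq_iff)
  let ?x = "norm (multi_partial ms F (zip s is))"
  have "?x\<^sup>2 \<le> (\<Sum>is\<in>{is. length is = n}. (norm (multi_partial ms F (zip s is)))\<^sup>2)"
    by (rule member_le_sum[of "is" _ "\<lambda>is. (norm (multi_partial ms F (zip s is)))\<^sup>2"]) (auto simp: finite_labels)
  then have "?x \<le> sqrt (\<Sum>is\<in>{is. length is = n}. (norm (multi_partial ms F (zip s is)))\<^sup>2)"
    by (rule real_le_rsqrt)
  then have "ennreal ?x \<le> ennreal (sqrt (\<Sum>is\<in>{is. length is = n}. (norm (multi_partial ms F (zip s is)))\<^sup>2))"
    by (rule ennreal_leI)
  also have "\<dots> \<le> chaos_sup_norm n (multi_partial ms F)"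
    unfolding chaos_sup_norm_def by (rule SUP_upper) simp
  also have "\<dots> \<le> degree_norm k n F"
    unfolding degree_norm_def
  proof (rule member_le_sum[of ms _ "\<lambda>ms. chaos_sup_norm n (multi_partial ms F)"])
    have "set ms \<subseteq> {0..k}" using k unfolding ms_def by auto
    then show "ms \<in> {ms. length ms = n \<and> set ms \<subseteq> {0..k}}" by simp
    show "finite {ms. length ms = n \<and> set ms \<subseteq> {0..k}}"
      unfolding orders_set by (rule finite_lists_length_eq) simp
  qed simp
  finally have "ennreal (C ^ n) * ennreal ?x \<le> ennreal (C ^ n) * degree_norm k n F"
    by (rule mult_left_mono) simp
  also have "\<dots> \<le> CO_norm k C F"
    using sum_le_suminf[of "\<lambda>n. ennreal (C ^ n) * degree_norm k n F" "{n}"] by (simp add: CO_norm_def)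
  finally have "ennreal (C ^ n * ?x) \<le> CO_norm k C F"
    using C by (simp add: ennreal_mult)
  then have "C ^ n * ?x \<le> enn2real (CO_norm k C F)"
    using fin C by (metis enn2real_ennreal enn2real_mono infinity_ennreal_def mult_nonneg_nonneg norm_ge_zero zero_le_power less_imp_le)
  then show "C ^ length qs * norm (jet_of F qs) \<le> enn2real (CO_norm k C F) * fact (length qs)"
    unfolding qs by (subst jet_of_zip) (auto simp: norm_mult mult_ac)
qed

lemma CO_infD: "F \<in> CO_inf \<Longrightarrow> C > 0 \<Longrightarrow> CO_norm k C F < \<infinity>"
  unfolding CO_inf_def CO_def by auto

lemma jet_of_in_jets:
  fixes F :: "('d::finite, 'k::{real_normed_field, banach}) chaos"
  assumes "F \<in> CO_inf"
  shows "jet_of F \<in> jets"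
proof (rule jetsI)
  have "F \<in> CO 0 1" using assms unfolding CO_inf_def by auto
  then have *: "chaos_symmetric F" "chaos_periodic F" "chaos_smooth F" unfolding CO_def by auto
  show "jet_of F ps = jet_of F qs" if "mset ps = mset qs" for ps qs
    by (rule jet_of_mset) (use * that in auto)
  show "jet_of F ((s + 1, a, m) # qs) = jet_of F ((s, a, m) # qs)" for s a m qs
    by (rule jet_of_periodic) (use * in auto)
  show "((\<lambda>t. jet_of F ((t, a, m) # qs)) has_vector_derivative jet_of F ((s, a, Suc m) # qs)) (at s)" for s a m qs
    by (rule jet_of_deriv) (use * in auto)
  show "\<exists>B. jet_bounded k C B (jet_of F)" if "C > 0" for k C
    using jet_bounded_CO_norm[OF CO_infD[OF assms that] that] by blast
qed

lemma chaos_of_in_CO_inf: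
  fixes J :: "('d::finite, 'k::real_normed_field) jet"
  assumes J: "J \<in> jets"
  shows "chaos_of J \<in> CO_inf"
  unfolding CO_inf_def CO_def
proof (intro INT_I CollectI conjI chaos_symmetric_chaos_of[OF J] chaos_periodic_chaos_of[OF J] chaos_smooth_chaos_of[OF J])
  fix k :: nat and C :: real assume "C \<in> {0<..}"
  then have C: "C > 0" by simp
  then have "2 * real (k + 1) * real CARD('d) * C > 0" by simp
  then obtain B where "jet_bounded k (2 * real (k + 1) * real CARD('d) * C) B J"
    using jets_bounded[OF J] by blast
  then have "CO_norm k C (chaos_of J) \<le> ennreal (2 * B)"
    by (intro CO_norm_le C) (simp add: jet_of_chaos_of[OF J])
  then show "CO_norm k C (chaos_of J) < \<infinity>"
    by (simp add: order_le_less_trans)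
qed

lemma CO_inf_cases:
  fixes F :: "('d::finite, 'k::{real_normed_field, banach}) chaos"
  assumes "F \<in> CO_inf"
  obtains J where "J \<in> jets" "F = chaos_of J"
  using that[OF jet_of_in_jets[OF assms]] chaos_of_jet_of[of F] by simp

section \<open>Series of jets and continuous operators\<close>

definition jet_scale :: "'k::real_normed_field \<Rightarrow> ('l, 'k) jet \<Rightarrow> ('l, 'k) jet" where
  "jet_scale c J = (\<lambda>qs. c * J qs)"

definition jet_infsum :: "('i \<Rightarrow> ('l, 'k::real_normed_field) jet) \<Rightarrow> 'i set \<Rightarrow> ('l, 'k) jet" where
  "jet_infsum f A = (\<lambda>qs. \<Sum>\<^sub>\<infinity>x\<in>A. f x qs)"

lemma jet_bounded_add:
  assumes "jet_bounded k C B J" "jet_bounded k C B' J'" "C \<ge> 0"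
  shows "jet_bounded k C (B + B') (J + J')"
  unfolding jet_bounded_def
proof (intro allI impI)
  fix qs :: "(real \<times> 'a \<times> nat) list" assume *: "\<forall>q\<in>set qs. order_of q \<le> k"
  have "C ^ length qs * norm ((J + J') qs) \<le> C ^ length qs * (norm (J qs) + norm (J' qs))"
    using assms by (intro mult_left_mono) (auto intro: norm_triangle_ineq)
  also have "\<dots> \<le> B * fact (length qs) + B' * fact (length qs)"
    using jet_boundedD[OF assms(1), of qs] jet_boundedD[OF assms(2), of qs] * by (simp add: algebra_simps)
  finally show "C ^ length qs * norm ((J + J') qs) \<le> (B + B') * fact (length qs)"
    by (simp add: algebra_simps)
qed

lemma jet_bounded_scale:
  assumes "jet_bounded k C B J"
  shows "jet_bounded k C (norm c * B) (jet_scale c J)"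
  unfolding jet_bounded_def
proof (intro allI impI)
  fix qs :: "(real \<times> 'a \<times> nat) list" assume *: "\<forall>q\<in>set qs. order_of q \<le> k"
  have "norm c * (C ^ length qs * norm (J qs)) \<le> norm c * (B * fact (length qs))"
    using jet_boundedD[OF assms, of qs] * by (intro mult_left_mono) auto
  then show "C ^ length qs * norm (jet_scale c J qs) \<le> norm c * B * fact (length qs)"
    by (simp add: jet_scale_def norm_mult mult_ac)
qed

lemma jets_zero: "0 \<in> jets"
  unfolding jets_def jet_bounded_def
  by (auto intro!: exI[of _ 0] has_vector_derivative_const simp: zero_fun_def)

lemma jets_add:
  assumes "J \<in> jets" "J' \<in> jets"
  shows "J + J' \<in> jets"
proof (rule jetsI)
  show "(J + J') ps = (J + J') qs" if "mset ps = mset qs" for ps qs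
    using jets_perm[OF assms(1) that] jets_perm[OF assms(2) that] by simp
  show "((\<lambda>t. (J + J') ((t, a, m) # qs)) has_vector_derivative (J + J') ((s, a, Suc m) # qs)) (at s)" for s a m qs
    unfolding plus_fun_def by (intro has_vector_derivative_add jets_deriv assms)
  show "\<exists>B. jet_bounded k C B (J + J')" if C: "C > 0" for k C
  proof -
    obtain B where B: "jet_bounded k C B J" using jets_bounded[OF assms(1) C] by blast
    obtain B' where B': "jet_bounded k C B' J'" using jets_bounded[OF assms(2) C] by blast
    show ?thesis using jet_bounded_add[OF B B'] C by (intro exI) auto
  qed
qed (simp add: jets_periodic assms)

lemma jets_scale:
  fixes J :: "('l, 'k::real_normed_field) jet"
  assumes "J \<in> jets"
  shows "jet_scale c J \<in> jets"
proof (rule jetsI)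
  show "jet_scale c J ps = jet_scale c J qs" if "mset ps = mset qs" for ps qs
    using jets_perm[OF assms that] by (simp add: jet_scale_def)
  show "((\<lambda>t. jet_scale c J ((t, a, m) # qs)) has_vector_derivative jet_scale c J ((s, a, Suc m) # qs)) (at s)" for s a m qs
    unfolding jet_scale_def by (intro has_vector_derivative_mult_right jets_deriv assms)
  show "\<exists>B. jet_bounded k C B (jet_scale c J)" if "C > 0" for k C
    using jets_bounded[OF assms that] jet_bounded_scale by blast
qed (simp add: jets_periodic assms jet_scale_def)

lemma jets_sum: "(\<And>x. x \<in> X \<Longrightarrow> f x \<in> jets) \<Longrightarrow> sum f X \<in> jets"
  by (induction X rule: infinite_finite_induct) (auto intro: jets_add jets_zero)

lemma sum_fun_apply: "sum f X ps = (\<Sum>x\<in>X. f x ps)"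
  by (induction X rule: infinite_finite_induct) auto

text \<open>
  Absolute summability in the topology of all the bounds \<open>jet_bounded k C\<close>.
\<close>

definition jet_summable :: "('i \<Rightarrow> ('l, 'k::real_normed_field) jet) \<Rightarrow> 'i set \<Rightarrow> bool" where
  "jet_summable f A \<longleftrightarrow> (\<forall>x\<in>A. f x \<in> jets) \<and>
     (\<forall>k. \<forall>C>0. \<exists>g. g summable_on A \<and> (\<forall>x\<in>A. jet_bounded k C (g x) (f x)))"

lemma jet_summableD: "jet_summable f A \<Longrightarrow> x \<in> A \<Longrightarrow> f x \<in> jets"
  unfolding jet_summable_def by blast

lemma jet_summable_bounds:
  assumes "jet_summable f A" "C > 0"
  obtains g where "g summable_on A" "\<And>x. x \<in> A \<Longrightarrow> jet_bounded k C (g x) (f x)"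
  using assms unfolding jet_summable_def by blast

lemma jet_summable_subset:
  "jet_summable f A \<Longrightarrow> B \<subseteq> A \<Longrightarrow> jet_summable f B"
  unfolding jet_summable_def by (meson subset_iff summable_on_subset_banach)

lemma jet_summable_pointwise:
  fixes f :: "'i \<Rightarrow> ('l, 'k::{real_normed_field, banach}) jet"
  assumes "jet_summable f A"
  shows "(\<lambda>x. norm (f x qs)) summable_on A" "(\<lambda>x. f x qs) summable_on A"
proof -
  obtain g where g: "g summable_on A" "\<And>x. x \<in> A \<Longrightarrow> jet_bounded (max_order qs) 1 (g x) (f x)"
    using jet_summable_bounds[OF assms, of 1] by auto
  have "(\<lambda>x. g x * fact (length qs)) summable_on A"
    using g(1) by (rule summable_on_cmult_left)
  moreover have "norm (f x qs) \<le> g x * fact (length qs)" if "x \<in> A" for x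
    using g(2)[OF that] max_order_ge by (rule jet_bounded_norm)
  ultimately show "(\<lambda>x. norm (f x qs)) summable_on A"
    by (rule Infinite_Sum.abs_summable_on_comparison_test')
  then show "(\<lambda>x. f x qs) summable_on A" by (rule abs_summable_summable)
qed

lemma jet_bounded_infsum:
  fixes f :: "'i \<Rightarrow> ('l, 'k::{real_normed_field, banach}) jet"
  assumes f: "jet_summable f A" and g: "g summable_on A" "\<And>x. x \<in> A \<Longrightarrow> jet_bounded k C (g x) (f x)" and C: "C > 0"
  shows "jet_bounded k C (infsum g A) (jet_infsum f A)"
  unfolding jet_bounded_def
proof (intro allI impI)
  fix qs :: "(real \<times> 'l \<times> nat) list" assume *: "\<forall>q\<in>set qs. order_of q \<le> k"
  have "((\<lambda>x. of_real (C ^ length qs) * f x qs) has_sum of_real (C ^ length qs) * jet_infsum f A qs) A"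
    unfolding jet_infsum_def
    by (intro has_sum_cmult_right has_sum_infsum jet_summable_pointwise[OF f])
  moreover have "((\<lambda>x. g x * fact (length qs)) has_sum infsum g A * fact (length qs)) A"
    by (intro has_sum_cmult_left has_sum_infsum g)
  ultimately have "norm (of_real (C ^ length qs) * jet_infsum f A qs) \<le> infsum g A * fact (length qs)"
  proof (rule norm_infsum_le)
    fix x assume "x \<in> A"
    then show "norm (of_real (C ^ length qs) * f x qs) \<le> g x * fact (length qs)"
      using jet_boundedD[OF g(2), of x qs] * C by (simp add: norm_mult norm_power)
  qed
  then show "C ^ length qs * norm (jet_infsum f A qs) \<le> infsum g A * fact (length qs)"
    using C by (simp add: norm_mult norm_power)
qed

text \<open>
  The sum of the Taylor estimates of the terms is the Taylor estimate of the sum.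
\<close>

lemma jet_infsum_in_jets:
  fixes f :: "'i \<Rightarrow> ('l, 'k::{real_normed_field, banach}) jet"
  assumes f: "jet_summable f A"
  shows "jet_infsum f A \<in> jets"
proof (rule jetsI)
  note fx = jet_summableD[OF f]
  show "jet_infsum f A ps = jet_infsum f A qs" if "mset ps = mset qs" for ps qs
    unfolding jet_infsum_def by (intro infsum_cong jets_perm[OF fx] that)
  show "jet_infsum f A ((s + 1, a, m) # qs) = jet_infsum f A ((s, a, m) # qs)" for s a m qs
    unfolding jet_infsum_def by (intro infsum_cong jets_periodic[OF fx])
  show "\<exists>B. jet_bounded k C B (jet_infsum f A)" if "C > 0" for k C
    by (rule jet_summable_bounds[OF f that, of k]) (use jet_bounded_infsum[OF f _ _ that] in blast)
  fix s :: real and a :: 'l and m :: nat and qs :: "(real \<times> 'l \<times> nat) list"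
  \<comment> \<open>the remainder of the Taylor estimate involves a derivative of order \<open>m + 2\<close>\<close>
  define k where "k = max (m + 2) (max_order qs)"
  obtain g where g: "g summable_on A" "\<And>x. x \<in> A \<Longrightarrow> jet_bounded k 1 (g x) (f x)"
    using jet_summable_bounds[OF f, of 1] by auto
  let ?n = "fact (length qs + 1) :: real"
  show "((\<lambda>t. jet_infsum f A ((t, a, m) # qs)) has_vector_derivative jet_infsum f A ((s, a, Suc m) # qs)) (at s)"
  proof (rule has_vector_derivative_quadratic[where M = "infsum g A * ?n"])
    fix t
    have S: "((\<lambda>x. f x qs) has_sum jet_infsum f A qs) A" for qs
      unfolding jet_infsum_def by (intro has_sum_infsum jet_summable_pointwise[OF f])
    have "((\<lambda>x. f x ((t, a, m) # qs) + - f x ((s, a, m) # qs) + of_real (s - t) * f x ((s, a, Suc m) # qs))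
      has_sum jet_infsum f A ((t, a, m) # qs) + - jet_infsum f A ((s, a, m) # qs)
        + of_real (s - t) * jet_infsum f A ((s, a, Suc m) # qs)) A"
      by (intro has_sum_add has_sum_cmult_right has_sum_uminusI S)
    moreover have "((\<lambda>x. g x * (?n * (t - s)\<^sup>2)) has_sum infsum g A * (?n * (t - s)\<^sup>2)) A"
      by (intro has_sum_cmult_left has_sum_infsum g)
    ultimately have "norm (jet_infsum f A ((t, a, m) # qs) + - jet_infsum f A ((s, a, m) # qs)
        + of_real (s - t) * jet_infsum f A ((s, a, Suc m) # qs)) \<le> infsum g A * (?n * (t - s)\<^sup>2)"
    proof (rule norm_infsum_le)
      fix x assume x: "x \<in> A"
      have "norm (f x ((u, a, Suc (Suc m)) # qs)) \<le> g x * ?n" for u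
      proof -
        have "order_of q \<le> k" if "q \<in> set ((u, a, Suc (Suc m)) # qs)" for q
          using that max_order_ge[of q qs] by (auto simp: k_def le_max_iff_disj)
        from jet_bounded_norm[OF g(2)[OF x], of "(u, a, Suc (Suc m)) # qs", OF this] show ?thesis by simp
      qed
      from jets_quadratic[OF fx[OF x] this, of t s]
      show "norm (f x ((t, a, m) # qs) + - f x ((s, a, m) # qs) + of_real (s - t) * f x ((s, a, Suc m) # qs)) \<le> g x * (?n * (t - s)\<^sup>2)"
        by (simp add: scaleR_conv_of_real algebra_simps)
    qed
    then show "norm (jet_infsum f A ((t, a, m) # qs) - jet_infsum f A ((s, a, m) # qs) - (t - s) *\<^sub>R jet_infsum f A ((s, a, Suc m) # qs)) \<le>
         infsum g A * ?n * (t - s)\<^sup>2"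
      by (simp add: scaleR_conv_of_real algebra_simps)
  qed
qed

lemma jet_infsum_finite_split:
  fixes f :: "'i \<Rightarrow> ('l, 'k::{real_normed_field, banach}) jet"
  assumes f: "jet_summable f A" and X: "finite X" "X \<subseteq> A"
  shows "jet_infsum f A = sum f X + jet_infsum f (A - X)"
proof
  fix qs
  have "infsum (\<lambda>x. f x qs) (X \<union> (A - X)) = infsum (\<lambda>x. f x qs) X + infsum (\<lambda>x. f x qs) (A - X)"
    by (rule infsum_Un_disjoint)
       (use X jet_summable_pointwise(2)[OF jet_summable_subset[OF f]] in auto)
  moreover have "X \<union> (A - X) = A" using X by auto
  ultimately show "jet_infsum f A qs = (sum f X + jet_infsum f (A - X)) qs"
    using X by (simp add: jet_infsum_def sum_fun_apply)
qed

lemma infsum_tail_tendsto: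
  fixes g :: "'i \<Rightarrow> real"
  assumes g: "g summable_on A"
  shows "((\<lambda>X. infsum g (A - X)) \<longlongrightarrow> 0) (finite_subsets_at_top A)"
proof -
  have "((\<lambda>X. infsum g A - sum g X) \<longlongrightarrow> infsum g A - infsum g A) (finite_subsets_at_top A)"
    by (intro tendsto_diff tendsto_const infsum_tendsto g)
  moreover have "\<forall>\<^sub>F X in finite_subsets_at_top A. infsum g A - sum g X = infsum g (A - X)"
  proof (rule eventually_finite_subsets_at_top_weakI)
    fix X assume X: "finite X" "X \<subseteq> A"
    have "infsum g (X \<union> (A - X)) = infsum g X + infsum g (A - X)"
      by (rule infsum_Un_disjoint) (use X summable_on_subset_banach[OF g] in auto)
    moreover have "X \<union> (A - X) = A" using X by auto
    ultimately show "infsum g A - sum g X = infsum g (A - X)" using X by simp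
  qed
  ultimately show ?thesis by (simp add: tendsto_cong)
qed

text \<open>
  Continuous linear operators between spaces of jets.
\<close>

definition jet_op :: "(('l, 'k::real_normed_field) jet \<Rightarrow> ('m, 'k) jet) \<Rightarrow> bool" where
  "jet_op U \<longleftrightarrow> (\<forall>J\<in>jets. U J \<in> jets) \<and> (\<forall>J\<in>jets. \<forall>J'\<in>jets. U (J + J') = U J + U J') \<and>
     (\<forall>J\<in>jets. \<forall>c. U (jet_scale c J) = jet_scale c (U J)) \<and>
     (\<forall>k. \<forall>C>0. \<exists>k'. \<exists>C'>0. \<exists>K\<ge>0. \<forall>J\<in>jets. \<forall>B. jet_bounded k' C' B J \<longrightarrow> jet_bounded k C (K * B) (U J))"

lemma jet_op_jets: "jet_op U \<Longrightarrow> J \<in> jets \<Longrightarrow> U J \<in> jets"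
  and jet_op_add: "jet_op U \<Longrightarrow> J \<in> jets \<Longrightarrow> J' \<in> jets \<Longrightarrow> U (J + J') = U J + U J'"
  and jet_op_scale: "jet_op U \<Longrightarrow> J \<in> jets \<Longrightarrow> U (jet_scale c J) = jet_scale c (U J)"
  unfolding jet_op_def by blast+

lemma jet_op_bound:
  assumes "jet_op U" "C > 0"
  obtains k' C' K where "C' > 0" "K \<ge> 0" "\<And>J B. J \<in> jets \<Longrightarrow> jet_bounded k' C' B J \<Longrightarrow> jet_bounded k C (K * B) (U J)"
  using assms unfolding jet_op_def by blast

lemma jet_op_zero: "jet_op U \<Longrightarrow> U 0 = 0"
  using jet_op_scale[of U 0 0] jets_zero by (simp add: jet_scale_def zero_fun_def)

lemma jet_op_sum:
  assumes "jet_op U" "\<And>x. x \<in> X \<Longrightarrow> f x \<in> jets"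
  shows "U (sum f X) = (\<Sum>x\<in>X. U (f x))"
  using assms(2)
  by (induction X rule: infinite_finite_induct)
     (auto simp: jet_op_zero[OF assms(1)] jet_op_add[OF assms(1)] jets_sum)

lemma jet_summable_op:
  assumes U: "jet_op U" and f: "jet_summable f A"
  shows "jet_summable (\<lambda>x. U (f x)) A"
  unfolding jet_summable_def
proof (intro conjI ballI allI impI)
  show "U (f x) \<in> jets" if "x \<in> A" for x
    using U jet_summableD[OF f that] by (rule jet_op_jets)
next
  fix k :: nat and C :: real assume C: "C > 0"
  obtain k' C' K where K: "C' > 0" "K \<ge> 0"
    "\<And>J B. J \<in> jets \<Longrightarrow> jet_bounded k' C' B J \<Longrightarrow> jet_bounded k C (K * B) (U J)"
    by (rule jet_op_bound[OF U C, of k]) (rule that)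
  obtain g
    where "g summable_on A" "\<And>x. x \<in> A \<Longrightarrow> jet_bounded k' C' (g x) (f x)"
    by (rule jet_summable_bounds[OF f K(1), of k']) (rule that)
  then show "\<exists>g. g summable_on A \<and> (\<forall>x\<in>A. jet_bounded k C (g x) (U (f x)))"
    using K jet_summableD[OF f] by (intro exI[of _ "\<lambda>x. K * g x"]) (auto intro: summable_on_cmult_right)
qed

text \<open>
  The operator is exact on finite partial sums, and the bound for the tail of the series tends to 0.
\<close>

theorem jet_op_infsum:
  fixes f :: "'i \<Rightarrow> ('l, 'k::{real_normed_field, banach}) jet"
    and U :: "('l, 'k) jet \<Rightarrow> ('m, 'k) jet"
  assumes U: "jet_op U" and f: "jet_summable f A"
  shows "U (jet_infsum f A) = jet_infsum (\<lambda>x. U (f x)) A"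
proof
  fix qs :: "(real \<times> 'm \<times> nat) list"
  obtain k' C' K where K: "C' > 0" "K \<ge> 0"
    "\<And>J B. J \<in> jets \<Longrightarrow> jet_bounded k' C' B J \<Longrightarrow> jet_bounded (max_order qs) 1 (K * B) (U J)"
    by (rule jet_op_bound[OF U zero_less_one, of "max_order qs"]) (rule that)
  obtain g
    where g: "g summable_on A" "\<And>x. x \<in> A \<Longrightarrow> jet_bounded k' C' (g x) (f x)"
    by (rule jet_summable_bounds[OF f K(1), of k']) (rule that)
  have "((\<lambda>X. U (jet_infsum f A) qs - (\<Sum>x\<in>X. U (f x) qs)) \<longlongrightarrow> 0) (finite_subsets_at_top A)"
  proof (rule Lim_null_comparison)
    have "((\<lambda>X. K * infsum g (A - X) * fact (length qs)) \<longlongrightarrow> K * 0 * fact (length qs)) (finite_subsets_at_top A)"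
      by (intro tendsto_mult tendsto_const infsum_tail_tendsto g)
    then show "((\<lambda>X. K * infsum g (A - X) * fact (length qs)) \<longlongrightarrow> 0) (finite_subsets_at_top A)" by simp
    show "\<forall>\<^sub>F X in finite_subsets_at_top A.
        norm (U (jet_infsum f A) qs - (\<Sum>x\<in>X. U (f x) qs)) \<le> K * infsum g (A - X) * fact (length qs)"
    proof (rule eventually_finite_subsets_at_top_weakI)
      fix X assume X: "finite X" "X \<subseteq> A"
      have jX: "sum f X \<in> jets" using X jet_summableD[OF f] by (auto intro: jets_sum)
      have f': "jet_summable f (A - X)" using f by (rule jet_summable_subset) auto
      have "U (jet_infsum f A) = (\<Sum>x\<in>X. U (f x)) + U (jet_infsum f (A - X))"
        unfolding jet_infsum_finite_split[OF f X] jet_op_add[OF U jX jet_infsum_in_jets[OF f']]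
        using X jet_summableD[OF f] by (subst jet_op_sum[OF U]) auto
      then have "U (jet_infsum f A) qs - (\<Sum>x\<in>X. U (f x) qs) = U (jet_infsum f (A - X)) qs"
        by (simp add: sum_fun_apply)
      moreover have "jet_bounded k' C' (infsum g (A - X)) (jet_infsum f (A - X))"
        using g by (intro jet_bounded_infsum f' K(1)) (auto intro: summable_on_subset_banach)
      ultimately show "norm (U (jet_infsum f A) qs - (\<Sum>x\<in>X. U (f x) qs)) \<le> K * infsum g (A - X) * fact (length qs)"
        using jet_bounded_norm[OF K(3)[OF jet_infsum_in_jets[OF f']] max_order_ge] by simp
    qed
  qed
  from tendsto_diff[OF tendsto_const[of "U (jet_infsum f A) qs"] this]
  have "((\<lambda>x. U (f x) qs) has_sum U (jet_infsum f A) qs) A"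
    by (simp add: has_sum_def)
  then show "U (jet_infsum f A) qs = jet_infsum (\<lambda>x. U (f x)) A qs"
    by (simp add: jet_infsum_def infsumI)
qed

lemma jet_op_comp:
  assumes U: "jet_op U" and V: "jet_op V"
  shows "jet_op (\<lambda>J. U (V J))"
  unfolding jet_op_def
proof (intro conjI ballI allI impI)
  fix k :: nat and C :: real assume C: "C > 0"
  obtain k' C' K where K: "C' > 0" "K \<ge> 0"
    "\<And>J B. J \<in> jets \<Longrightarrow> jet_bounded k' C' B J \<Longrightarrow> jet_bounded k C (K * B) (U J)"
    by (rule jet_op_bound[OF U C, of k]) (rule that)
  obtain k'' C'' K' where K': "C'' > 0" "K' \<ge> 0"
    "\<And>J B. J \<in> jets \<Longrightarrow> jet_bounded k'' C'' B J \<Longrightarrow> jet_bounded k' C' (K' * B) (V J)"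
    by (rule jet_op_bound[OF V K(1), of k']) (rule that)
  have "jet_bounded k C (K * K' * B) (U (V J))" if "J \<in> jets" "jet_bounded k'' C'' B J" for J B
    using K(3)[OF jet_op_jets[OF V] K'(3)] that by (simp add: mult.assoc)
  then show "\<exists>k'. \<exists>C'>0. \<exists>K\<ge>0. \<forall>J\<in>jets. \<forall>B. jet_bounded k' C' B J \<longrightarrow> jet_bounded k C (K * B) (U (V J))"
    using K(1,2) K'(1,2)
    by - (rule exI[of _ k''], rule exI[of _ C''], rule conjI, assumption, rule exI[of _ "K * K'"], auto)
qed (use jet_op_jets[OF U] jet_op_jets[OF V] jet_op_add[OF U] jet_op_add[OF V] jet_op_scale[OF U] jet_op_scale[OF V] in simp_all)

lemma jet_op_id: "jet_op (\<lambda>J. J)"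
  unfolding jet_op_def
proof (intro conjI ballI allI impI)
  fix k :: nat and C :: real assume C: "C > 0"
  then show "\<exists>k'. \<exists>C'>0. \<exists>K\<ge>0. \<forall>J\<in>jets. \<forall>B. jet_bounded k' C' B J \<longrightarrow> jet_bounded k C (K * B) J"
    by - (rule exI[of _ k], rule exI[of _ C], rule conjI, assumption, rule exI[of _ 1], auto)
qed simp_all

lemma jet_op_funpow:
  fixes U :: "('l, 'k::real_normed_field) jet \<Rightarrow> ('l, 'k) jet"
  shows "jet_op U \<Longrightarrow> jet_op (U ^^ n)"
proof (induction n)
  case 0
  then show ?case using jet_op_id unfolding funpow.simps(1) id_def by simp
next
  case (Suc n)
  then show ?case using jet_op_comp[of U "U ^^ n"] by (simp add: o_def)
qed

section \<open>Families of operators\<close>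

text \<open>
  The operators share one bound up to factors that are summable over the family. This is what makes
  sums, products and powers of such families converge unconditionally.
\<close>

definition jet_op_family :: "('i \<Rightarrow> ('l, 'k::real_normed_field) jet \<Rightarrow> ('m, 'k) jet) \<Rightarrow> 'i set \<Rightarrow> bool" where
  "jet_op_family U A \<longleftrightarrow> (\<forall>x\<in>A. jet_op (U x)) \<and>
     (\<forall>k. \<forall>C>0. \<exists>k'. \<exists>C'>0. \<exists>g. g summable_on A \<and> (\<forall>x\<in>A. g x \<ge> 0) \<and>
        (\<forall>x\<in>A. \<forall>J\<in>jets. \<forall>B. jet_bounded k' C' B J \<longrightarrow> jet_bounded k C (g x * B) (U x J)))"

lemma jet_op_familyD: "jet_op_family U A \<Longrightarrow> x \<in> A \<Longrightarrow> jet_op (U x)"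
  unfolding jet_op_family_def by blast

lemma jet_op_family_bound:
  assumes "jet_op_family U A" "C > 0"
  obtains k' C' g where "C' > 0" "g summable_on A" "\<And>x. x \<in> A \<Longrightarrow> g x \<ge> 0"
    "\<And>x J B. x \<in> A \<Longrightarrow> J \<in> jets \<Longrightarrow> jet_bounded k' C' B J \<Longrightarrow> jet_bounded k C (g x * B) (U x J)"
proof -
  from assms(1) have "\<forall>k. \<forall>C>0. \<exists>k'. \<exists>C'>0. \<exists>g. g summable_on A \<and> (\<forall>x\<in>A. g x \<ge> 0) \<and>
        (\<forall>x\<in>A. \<forall>J\<in>jets. \<forall>B. jet_bounded k' C' B J \<longrightarrow> jet_bounded k C (g x * B) (U x J))"
    unfolding jet_op_family_def by (rule conjunct2)
  from this[rule_format, OF assms(2), of k] show thesis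
  proof (elim exE conjE)
    fix k' C' g
    assume "0 < C'" "g summable_on A" and g: "\<forall>x\<in>A. 0 \<le> g x"
      and U: "\<forall>x\<in>A. \<forall>J\<in>jets. \<forall>B. jet_bounded k' C' B J \<longrightarrow> jet_bounded k C (g x * B) (U x J)"
    then show thesis by (intro that[of C' g k']) (simp_all only: U[rule_format] g[rule_format])
  qed
qed

lemma jet_op_family_summable:
  assumes U: "jet_op_family U A" and J: "J \<in> jets"
  shows "jet_summable (\<lambda>x. U x J) A"
  unfolding jet_summable_def
proof (intro conjI ballI allI impI)
  show "U x J \<in> jets" if "x \<in> A" for x using jet_op_familyD[OF U that] J by (rule jet_op_jets)
next
  fix k :: nat and C :: real assume C: "C > 0"
  obtain k' C' g where g: "C' > 0" "g summable_on A"
    "\<And>x J B. x \<in> A \<Longrightarrow> J \<in> jets \<Longrightarrow> jet_bounded k' C' B J \<Longrightarrow> jet_bounded k C (g x * B) (U x J)"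
    by (rule jet_op_family_bound[OF U C, of k]) (rule that)
  obtain B where "jet_bounded k' C' B J" using jets_bounded[OF J g(1)] by blast
  with g J show "\<exists>g. g summable_on A \<and> (\<forall>x\<in>A. jet_bounded k C (g x) (U x J))"
    by (intro exI[of _ "\<lambda>x. g x * B"]) (auto intro: summable_on_cmult_left)
qed

lemma jet_op_infsum_family:
  fixes U :: "'i \<Rightarrow> ('l, 'k::{real_normed_field, banach}) jet \<Rightarrow> ('m, 'k) jet"
  assumes U: "jet_op_family U A"
  shows "jet_op (\<lambda>J. jet_infsum (\<lambda>x. U x J) A)"
  unfolding jet_op_def
proof (intro conjI ballI allI impI)
  note S = jet_op_family_summable[OF U]
  show "jet_infsum (\<lambda>x. U x J) A \<in> jets" if "J \<in> jets" for J
    by (rule jet_infsum_in_jets[OF S[OF that]])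
  show "jet_infsum (\<lambda>x. U x (J + J')) A = jet_infsum (\<lambda>x. U x J) A + jet_infsum (\<lambda>x. U x J') A"
    if "J \<in> jets" "J' \<in> jets" for J J'
  proof
    fix qs
    have "jet_infsum (\<lambda>x. U x (J + J')) A qs = (\<Sum>\<^sub>\<infinity>x\<in>A. U x J qs + U x J' qs)"
      unfolding jet_infsum_def
      by (intro infsum_cong) (simp add: jet_op_add[OF jet_op_familyD[OF U]] that)
    also have "\<dots> = jet_infsum (\<lambda>x. U x J) A qs + jet_infsum (\<lambda>x. U x J') A qs"
      unfolding jet_infsum_def by (intro infsum_add jet_summable_pointwise S that)
    finally show "jet_infsum (\<lambda>x. U x (J + J')) A qs = (jet_infsum (\<lambda>x. U x J) A + jet_infsum (\<lambda>x. U x J') A) qs"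
      by simp
  qed
  show "jet_infsum (\<lambda>x. U x (jet_scale c J)) A = jet_scale c (jet_infsum (\<lambda>x. U x J) A)" if "J \<in> jets" for J c
  proof
    fix qs
    have "jet_infsum (\<lambda>x. U x (jet_scale c J)) A qs = (\<Sum>\<^sub>\<infinity>x\<in>A. c * U x J qs)"
      unfolding jet_infsum_def
      by (intro infsum_cong) (simp add: jet_op_scale[OF jet_op_familyD[OF U]] that, simp add: jet_scale_def)
    also have "\<dots> = c * (\<Sum>\<^sub>\<infinity>x\<in>A. U x J qs)"
      by (intro infsum_cmult_right jet_summable_pointwise S that)
    finally show "jet_infsum (\<lambda>x. U x (jet_scale c J)) A qs = jet_scale c (jet_infsum (\<lambda>x. U x J) A) qs"
      by (simp add: jet_infsum_def jet_scale_def)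
  qed
  fix k :: nat and C :: real assume C: "C > 0"
  obtain k' C' g where g: "C' > 0" "g summable_on A" "\<And>x. x \<in> A \<Longrightarrow> g x \<ge> 0"
    "\<And>x J B. x \<in> A \<Longrightarrow> J \<in> jets \<Longrightarrow> jet_bounded k' C' B J \<Longrightarrow> jet_bounded k C (g x * B) (U x J)"
    by (rule jet_op_family_bound[OF U C, of k]) (rule that)
  have "jet_bounded k C (infsum g A * B) (jet_infsum (\<lambda>x. U x J) A)" if "J \<in> jets" "jet_bounded k' C' B J" for J B
    using jet_bounded_infsum[OF S[OF that(1)] summable_on_cmult_left[OF g(2)] g(4)[OF _ that] C]
    by (simp add: infsum_cmult_left g(2))
  then show "\<exists>k'. \<exists>C'>0. \<exists>K\<ge>0. \<forall>J\<in>jets. \<forall>B. jet_bounded k' C' B J \<longrightarrow> jet_bounded k C (K * B) (jet_infsum (\<lambda>x. U x J) A)"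
    using g(1) infsum_nonneg[of A g] g(3)
    by - (rule exI[of _ k'], rule exI[of _ C'], rule conjI, assumption, rule exI[of _ "infsum g A"], auto)
qed

lemma summable_on_Times_mult:
  fixes g h :: "_ \<Rightarrow> real"
  assumes "g summable_on A" "h summable_on B" "\<And>x. x \<in> A \<Longrightarrow> g x \<ge> 0" "\<And>y. y \<in> B \<Longrightarrow> h y \<ge> 0"
  shows "(\<lambda>(x, y). g x * h y) summable_on A \<times> B"
proof (rule summable_on_SigmaI[where g = "\<lambda>x. g x * infsum h B"])
  show "((\<lambda>y. case (x, y) of (x, y) \<Rightarrow> g x * h y) has_sum g x * infsum h B) B" for x
    by (auto intro!: has_sum_cmult_right has_sum_infsum assms)
qed (use assms in \<open>auto intro: summable_on_cmult_left\<close>)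

lemma jet_op_family_Times:
  assumes U: "jet_op_family U A" and V: "jet_op_family V B"
  shows "jet_op_family (\<lambda>(x, y) J. U x (V y J)) (A \<times> B)"
  unfolding jet_op_family_def
proof (intro conjI allI impI)
  show "\<forall>z\<in>A \<times> B. jet_op (case z of (x, y) \<Rightarrow> \<lambda>J. U x (V y J))"
    using jet_op_comp[OF jet_op_familyD[OF U] jet_op_familyD[OF V]] by auto
next
  fix k :: nat and C :: real assume C: "C > 0"
  obtain k' C' g where g: "C' > 0" "g summable_on A" "\<And>x. x \<in> A \<Longrightarrow> g x \<ge> 0"
    "\<And>x J B. x \<in> A \<Longrightarrow> J \<in> jets \<Longrightarrow> jet_bounded k' C' B J \<Longrightarrow> jet_bounded k C (g x * B) (U x J)"
    by (rule jet_op_family_bound[OF U C, of k]) (rule that)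
  obtain k'' C'' h where h: "C'' > 0" "h summable_on B" "\<And>x. x \<in> B \<Longrightarrow> h x \<ge> 0"
    "\<And>x J B'. x \<in> B \<Longrightarrow> J \<in> jets \<Longrightarrow> jet_bounded k'' C'' B' J \<Longrightarrow> jet_bounded k' C' (h x * B') (V x J)"
    by (rule jet_op_family_bound[OF V g(1), of k']) (rule that)
  have "jet_bounded k C (g x * h y * B') (U x (V y J))"
    if "x \<in> A" "y \<in> B" "J \<in> jets" "jet_bounded k'' C'' B' J" for x y J B'
    using g(4)[OF that(1) jet_op_jets[OF jet_op_familyD[OF V]] h(4)] that by (simp add: mult.assoc)
  then show "\<exists>k'. \<exists>C'>0. \<exists>g. g summable_on A \<times> B \<and> (\<forall>x\<in>A \<times> B. 0 \<le> g x) \<and>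
      (\<forall>x\<in>A \<times> B. \<forall>J\<in>jets. \<forall>B. jet_bounded k' C' B J \<longrightarrow> jet_bounded k C (g x * B) ((case x of (x, y) \<Rightarrow> \<lambda>J. U x (V y J)) J))"
    using h(1,3) g(3) summable_on_Times_mult[OF g(2) h(2) g(3) h(3)]
    by - (rule exI[of _ k''], rule exI[of _ C''], rule conjI, assumption, rule exI[of _ "\<lambda>(x, y). g x * h y"], auto)
qed

lemma jet_summable_op_family:
  assumes U: "jet_op_family U A" and f: "jet_summable f B"
  shows "jet_summable (\<lambda>(x, y). U x (f y)) (A \<times> B)"
  unfolding jet_summable_def
proof (intro conjI ballI allI impI)
  show "(case z of (x, y) \<Rightarrow> U x (f y)) \<in> jets" if "z \<in> A \<times> B" for z
    using that jet_op_jets[OF jet_op_familyD[OF U] jet_summableD[OF f]] by auto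
  fix k :: nat and C :: real assume C: "C > 0"
  obtain k' C' h where h: "C' > 0" "h summable_on A" "\<And>x. x \<in> A \<Longrightarrow> h x \<ge> 0"
    "\<And>x J B. x \<in> A \<Longrightarrow> J \<in> jets \<Longrightarrow> jet_bounded k' C' B J \<Longrightarrow> jet_bounded k C (h x * B) (U x J)"
    by (rule jet_op_family_bound[OF U C, of k]) (rule that)
  obtain g where g: "g summable_on B" "\<And>y. y \<in> B \<Longrightarrow> jet_bounded k' C' (g y) (f y)"
    by (rule jet_summable_bounds[OF f h(1), of k']) (rule that)
  have "(\<lambda>(x, y). h x * g y) summable_on A \<times> B"
    by (rule summable_on_Times_mult[OF h(2) g(1) h(3)]) (use jet_bounded_nonneg[OF g(2)] in auto)
  then show "\<exists>g. g summable_on A \<times> B \<and> (\<forall>z\<in>A \<times> B. jet_bounded k C (g z) (case z of (x, y) \<Rightarrow> U x (f y)))"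
    using h(4)[OF _ jet_summableD[OF f] g(2)] by (intro exI[of _ "\<lambda>(x, y). h x * g y"]) auto
qed

lemma jet_infsum_op_family:
  fixes f :: "'j \<Rightarrow> ('l, 'k::{real_normed_field, banach}) jet" and U :: "'i \<Rightarrow> ('l, 'k) jet \<Rightarrow> ('m, 'k) jet"
  assumes U: "jet_op_family U A" and f: "jet_summable f B"
  shows "jet_infsum (\<lambda>(x, y). U x (f y)) (A \<times> B) = jet_infsum (\<lambda>x. U x (jet_infsum f B)) A"
proof
  fix qs
  have "(\<lambda>(x, y). U x (f y) qs) summable_on A \<times> B"
    using jet_summable_pointwise(2)[OF jet_summable_op_family[OF U f], of qs] by (simp add: case_prod_unfold)
  then have "(\<Sum>\<^sub>\<infinity>(x, y)\<in>A \<times> B. U x (f y) qs) = (\<Sum>\<^sub>\<infinity>x\<in>A. \<Sum>\<^sub>\<infinity>y\<in>B. U x (f y) qs)"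
    by (rule infsum_Sigma'_banach[symmetric])
  also have "\<dots> = (\<Sum>\<^sub>\<infinity>x\<in>A. U x (jet_infsum f B) qs)"
    using jet_op_infsum[OF jet_op_familyD[OF U] f] by (intro infsum_cong) (simp add: jet_infsum_def)
  finally show "jet_infsum (\<lambda>(x, y). U x (f y)) (A \<times> B) qs = jet_infsum (\<lambda>x. U x (jet_infsum f B)) A qs"
    by (simp add: jet_infsum_def case_prod_unfold)
qed

lemmas jet_infsum_Times = jet_infsum_op_family[OF _ jet_op_family_summable]

lemma jet_op_family_reindex:
  assumes h: "bij_betw h A B" and U: "jet_op_family (\<lambda>x. U (h x)) A"
  shows "jet_op_family U B"
  unfolding jet_op_family_def
proof (intro conjI allI impI ballI)
  have B: "B = h ` A" using h by (simp add: bij_betw_def)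
  show "jet_op (U x)" if "x \<in> B" for x using jet_op_familyD[OF U] that by (auto simp: B)
  fix k :: nat and C :: real assume C: "C > 0"
  obtain k' C' g where g: "C' > 0" "g summable_on A" "\<And>x. x \<in> A \<Longrightarrow> g x \<ge> 0"
    "\<And>x J B. x \<in> A \<Longrightarrow> J \<in> jets \<Longrightarrow> jet_bounded k' C' B J \<Longrightarrow> jet_bounded k C (g x * B) (U (h x) J)"
    by (rule jet_op_family_bound[OF U C, of k]) (rule that)
  have inv: "inv_into A h x \<in> A" "h (inv_into A h x) = x" if "x \<in> B" for x
    using that by (auto simp: B inv_into_into f_inv_into_f)
  have "(\<lambda>x. g (inv_into A h x)) summable_on B"
    using g(2) bij_betw_inv_into[OF h] by (simp add: summable_on_reindex_bij_betw)
  then show "\<exists>k'. \<exists>C'>0. \<exists>g. g summable_on B \<and> (\<forall>x\<in>B. 0 \<le> g x) \<and>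
      (\<forall>x\<in>B. \<forall>J\<in>jets. \<forall>B. jet_bounded k' C' B J \<longrightarrow> jet_bounded k C (g x * B) (U x J))"
    using g(1) g(3)[OF inv(1)] g(4)[OF inv(1)] inv
    by - (rule exI[of _ k'], rule exI[of _ C'], rule conjI, assumption, rule exI[of _ "\<lambda>x. g (inv_into A h x)"], auto)
qed

lemma jet_infsum_reindex:
  assumes "bij_betw h A B"
  shows "jet_infsum (\<lambda>x. f (h x)) A = jet_infsum f B"
  unfolding jet_infsum_def using infsum_reindex_bij_betw[OF assms] by (intro ext) fast

lemma bij_betw_Cons_lists:
  "bij_betw (\<lambda>(x, xs). x # xs) (UNIV \<times> {xs. length xs = r}) {xs. length xs = Suc r}"
  by (rule bij_betwI[where g = "\<lambda>xs. (hd xs, tl xs)"]) (auto simp: length_Suc_conv)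

lemma jet_op_family_lists:
  assumes U: "jet_op_family U UNIV"
  shows "jet_op_family (\<lambda>xs. foldr U xs) {xs. length xs = r}"
proof (induction r)
  case 0
  have "{xs :: 'a list. length xs = 0} = {[]}" by auto
  then show ?case
    unfolding jet_op_family_def
  proof (intro conjI allI impI)
    fix k :: nat and C :: real assume "C > 0"
    then show "\<exists>k'. \<exists>C'>0. \<exists>g. g summable_on {xs :: 'a list. length xs = 0} \<and> (\<forall>x\<in>{xs :: 'a list. length xs = 0}. 0 \<le> g x) \<and>
      (\<forall>x\<in>{xs :: 'a list. length xs = 0}. \<forall>J\<in>jets. \<forall>B. jet_bounded k' C' B J \<longrightarrow> jet_bounded k C (g x * B) (foldr U x J))"
      by - (rule exI[of _ k], rule exI[of _ C], rule conjI, assumption, rule exI[of _ "\<lambda>_. 1"], auto)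
  qed (use jet_op_id in \<open>simp add: id_def\<close>)
next
  case (Suc r)
  show ?case
    by (rule jet_op_family_reindex[OF bij_betw_Cons_lists])
       (use jet_op_family_Times[OF U Suc] in \<open>simp add: case_prod_unfold o_def\<close>)
qed

text \<open>
  Expanding the \<open>r\<close>-th power of a sum of operators gives the sum over all words of length \<open>r\<close>. This links
  the sum over multi-indices in the definition of \<open>P\<^sup>r\<close> with the powers of a single operator.
\<close>

lemma jet_infsum_lists:
  fixes U :: "'i \<Rightarrow> ('l, 'k::{real_normed_field, banach}) jet \<Rightarrow> ('l, 'k) jet"
  assumes U: "jet_op_family U UNIV" and J: "J \<in> jets"
  shows "jet_infsum (\<lambda>xs. foldr U xs J) {xs. length xs = r} = ((\<lambda>J. jet_infsum (\<lambda>x. U x J) UNIV) ^^ r) J"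
proof (induction r)
  case 0
  have "{xs :: 'i list. length xs = 0} = {[]}" by auto
  then show ?case by (simp add: jet_infsum_def)
next
  case (Suc r)
  have "jet_infsum (\<lambda>xs. foldr U xs J) {xs. length xs = Suc r}
      = jet_infsum (\<lambda>(x, xs). U x (foldr U xs J)) (UNIV \<times> {xs. length xs = r})"
    unfolding jet_infsum_reindex[OF bij_betw_Cons_lists, symmetric] by (simp add: case_prod_unfold)
  also have "\<dots> = jet_infsum (\<lambda>x. U x (jet_infsum (\<lambda>xs. foldr U xs J) {xs. length xs = r})) UNIV"
    by (rule jet_infsum_Times[OF U jet_op_family_lists[OF U] J])
  finally show ?case by (simp add: Suc)
qed

text \<open>
  Both sides are the same sum over pairs.
\<close>

lemma jet_infsum_commute:
  fixes U :: "'i \<Rightarrow> ('l, 'k::{real_normed_field, banach}) jet \<Rightarrow> ('l, 'k) jet"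
  assumes U: "jet_op_family U A" and V: "jet_op_family V B" and J: "J \<in> jets"
    and comm: "\<And>x y. x \<in> A \<Longrightarrow> y \<in> B \<Longrightarrow> U x (V y J) = V y (U x J)"
  shows "jet_infsum (\<lambda>x. U x (jet_infsum (\<lambda>y. V y J) B)) A = jet_infsum (\<lambda>y. V y (jet_infsum (\<lambda>x. U x J) A)) B"
proof -
  have swap: "bij_betw (\<lambda>(y, x). (x, y)) (B \<times> A) (A \<times> B)"
    by (rule bij_betwI[where g = "\<lambda>(x, y). (y, x)"]) auto
  have "jet_infsum (\<lambda>(x, y). U x (V y J)) (A \<times> B) = jet_infsum (\<lambda>(y, x). U x (V y J)) (B \<times> A)"
    unfolding jet_infsum_reindex[OF swap, symmetric] by (simp add: case_prod_unfold)
  also have "\<dots> = jet_infsum (\<lambda>(y, x). V y (U x J)) (B \<times> A)"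
    unfolding jet_infsum_def using comm by (auto intro!: infsum_cong)
  finally show ?thesis by (simp add: jet_infsum_Times[OF U V J] jet_infsum_Times[OF V U J])
qed

section \<open>Tensor products and relabelling\<close>

definition lefts :: "(real \<times> ('l + 'm) \<times> nat) list \<Rightarrow> (real \<times> 'l \<times> nat) list" where
  "lefts qs = map (\<lambda>(s, x, m). (s, projl x, m)) (filter (\<lambda>(s, x, m). isl x) qs)"

definition rights :: "(real \<times> ('l + 'm) \<times> nat) list \<Rightarrow> (real \<times> 'm \<times> nat) list" where
  "rights qs = map (\<lambda>(s, x, m). (s, projr x, m)) (filter (\<lambda>(s, x, m). \<not> isl x) qs)"

lemma lefts_simps [simp]:
  "lefts [] = []" "lefts ((s, Inl a, m) # qs) = (s, a, m) # lefts qs" "lefts ((s, Inr b, m) # qs) = lefts qs"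
  by (simp_all add: lefts_def)

lemma rights_simps [simp]:
  "rights [] = []" "rights ((s, Inl a, m) # qs) = rights qs" "rights ((s, Inr b, m) # qs) = (s, b, m) # rights qs"
  by (simp_all add: rights_def)

lemma mset_lefts: "mset ps = mset qs \<Longrightarrow> mset (lefts ps) = mset (lefts qs)"
  and mset_rights: "mset ps = mset qs \<Longrightarrow> mset (rights ps) = mset (rights qs)"
  by (simp_all add: lefts_def rights_def)

lemma length_lefts_rights: "length (lefts qs) + length (rights qs) = length qs"
  unfolding lefts_def rights_def by (simp add: sum_length_filter_compl case_prod_unfold)

lemma lefts_order: "q \<in> set (lefts qs) \<Longrightarrow> \<forall>q\<in>set qs. order_of q \<le> k \<Longrightarrow> order_of q \<le> k"
  by (force simp: lefts_def)

lemma rights_order: "q \<in> set (rights qs) \<Longrightarrow> \<forall>q\<in>set qs. order_of q \<le> k \<Longrightarrow> order_of q \<le> k"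
  by (force simp: rights_def)

text \<open>
  The two groups of points are kept apart by their labels; symmetrization is deferred to the merging of the
  labels by \<open>push\<close>.
\<close>

definition tensor :: "('l, 'k::times) jet \<Rightarrow> ('m, 'k) jet \<Rightarrow> ('l + 'm, 'k) jet" where
  "tensor J J' qs = J (lefts qs) * J' (rights qs)"

text \<open>
  The factorial growth is compatible with products because \<open>p! q! \<le> (p + q)!\<close>.
\<close>

lemma jet_bounded_tensor:
  fixes J :: "('l, 'k::real_normed_field) jet" and J' :: "('m, 'k) jet"
  assumes J: "jet_bounded k C B J" and J': "jet_bounded k C B' J'" and C: "C > 0"
  shows "jet_bounded k C (B * B') (tensor J J')"
  unfolding jet_bounded_def
proof (intro allI impI)
  fix qs :: "(real \<times> ('l + 'm) \<times> nat) list"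
  assume qs: "\<forall>q\<in>set qs. order_of q \<le> k"
  let ?p = "length (lefts qs)" and ?q = "length (rights qs)"
  have "C ^ ?p * norm (J (lefts qs)) \<le> B * fact ?p"
    using lefts_order[OF _ qs] by (rule jet_boundedD[OF J])
  moreover have "C ^ ?q * norm (J' (rights qs)) \<le> B' * fact ?q"
    using rights_order[OF _ qs] by (rule jet_boundedD[OF J'])
  ultimately have "(C ^ ?p * norm (J (lefts qs))) * (C ^ ?q * norm (J' (rights qs))) \<le> (B * fact ?p) * (B' * fact ?q)"
    by (rule mult_mono) (use C jet_bounded_nonneg[OF J] in auto)
  also have "\<dots> = (B * B') * (fact ?p * fact ?q)" by simp
  also have "\<dots> \<le> (B * B') * fact (?p + ?q)"
  proof (rule mult_left_mono)
    have "fact ?p * fact ?q \<le> (fact (?p + ?q) :: nat)"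
      using fact_fact_dvd_fact[of ?p ?q, where 'a = nat] by (rule dvd_imp_le) simp
    then show "fact ?p * fact ?q \<le> (fact (?p + ?q) :: real)"
      by (metis of_nat_fact of_nat_le_iff of_nat_mult)
  qed (use jet_bounded_nonneg[OF J] jet_bounded_nonneg[OF J'] in simp)
  finally have "C ^ (?p + ?q) * norm (tensor J J' qs) \<le> (B * B') * fact (?p + ?q)"
    by (simp add: tensor_def norm_mult power_add mult_ac)
  then show "C ^ length qs * norm (tensor J J' qs) \<le> (B * B') * fact (length qs)"
    by (simp add: length_lefts_rights)
qed

lemma tensor_in_jets:
  fixes J :: "('l, 'k::real_normed_field) jet" and J' :: "('m, 'k) jet"
  assumes J: "J \<in> jets" and J': "J' \<in> jets"
  shows "tensor J J' \<in> jets"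
proof (rule jetsI)
  show "tensor J J' ps = tensor J J' qs" if "mset ps = mset qs" for ps qs
    using jets_perm[OF J mset_lefts[OF that]] jets_perm[OF J' mset_rights[OF that]] by (simp add: tensor_def)
  show "tensor J J' ((s + 1, x, m) # qs) = tensor J J' ((s, x, m) # qs)" for s x m qs
    by (cases x) (simp_all add: tensor_def jets_periodic[OF J] jets_periodic[OF J'])
  show "((\<lambda>t. tensor J J' ((t, x, m) # qs)) has_vector_derivative tensor J J' ((s, x, Suc m) # qs)) (at s)" for s x m qs
    by (cases x)
       (auto simp: tensor_def intro!: has_vector_derivative_mult_left has_vector_derivative_mult_right
          jets_deriv[OF J] jets_deriv[OF J'])
  show "\<exists>B. jet_bounded k C B (tensor J J')" if C: "C > 0" for k C
  proof -
    obtain B where "jet_bounded k C B J" using jets_bounded[OF J C] by blast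
    moreover obtain B' where "jet_bounded k C B' J'" using jets_bounded[OF J' C] by blast
    ultimately show ?thesis using jet_bounded_tensor C by blast
  qed
qed

text \<open>
  The push-forward sums over all liftings of the labels along \<open>f\<close>, independently at every point. For a map
  that identifies the two copies of a label, a lifting is a distribution of the points over two groups.
\<close>

fun push :: "('l::finite \<Rightarrow> 'm) \<Rightarrow> ('l, 'k::comm_monoid_add) jet \<Rightarrow> ('m, 'k) jet" where
  "push f J [] = J []"
| "push f J ((s, b, m) # qs) = (\<Sum>a\<in>f -` {b}. push f (\<lambda>qs'. J ((s, a, m) # qs')) qs)"

lemma push_sum:
  fixes J :: "'i \<Rightarrow> ('l::finite, 'k::comm_monoid_add) jet"
  shows "push f (\<lambda>qs. \<Sum>x\<in>X. J x qs) qs = (\<Sum>x\<in>X. push f (J x) qs)"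
proof (induction qs arbitrary: J)
  case (Cons q qs)
  obtain s b m where q: "q = (s, b, m)" by (cases q)
  show ?case by (simp add: q Cons) (rule sum.swap)
qed simp

lemma push_add:
  fixes J J' :: "('l::finite, 'k::comm_monoid_add) jet"
  shows "push f (\<lambda>qs. J qs + J' qs) qs = push f J qs + push f J' qs"
proof (induction qs arbitrary: J J')
  case (Cons q qs)
  obtain s b m where q: "q = (s, b, m)" by (cases q)
  show ?case by (simp add: q Cons sum.distrib)
qed simp

lemma push_mult:
  fixes J :: "('l::finite, 'k::semiring_0) jet"
  shows "push f (\<lambda>qs. c * J qs) qs = c * push f J qs"
proof (induction qs arbitrary: J)
  case (Cons q qs)
  obtain s b m where q: "q = (s, b, m)" by (cases q)
  show ?case by (simp add: q Cons sum_distrib_left)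
qed simp

text \<open>
  Exchanging the first two points exchanges two summations; this suffices because any point can be moved
  to the head of the list by such exchanges.
\<close>

lemma push_perm:
  fixes J :: "('l::finite, 'k::comm_monoid_add) jet"
  assumes "\<And>ps qs. mset ps = mset qs \<Longrightarrow> J ps = J qs"
  shows "mset ps = mset qs \<Longrightarrow> push f J ps = push f J qs"
proof -
  have move: "push f J (us @ q # vs) = push f J (q # us @ vs)"
    if "\<And>ps qs. mset ps = mset qs \<Longrightarrow> J ps = J qs" for J :: "('l, 'k) jet" and us q vs
    using that
  proof (induction us arbitrary: J)
    case Nil
    show ?case by simp
  next
    case (Cons p us)
    obtain s b m where q: "q = (s, b, m)" by (cases q)
    obtain s' b' m' where p: "p = (s', b', m')" by (cases p)
    have "push f J ((p # us) @ q # vs) = (\<Sum>a'\<in>f -` {b'}. push f (\<lambda>qs'. J ((s', a', m') # qs')) (q # us @ vs))"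
      unfolding p append_Cons push.simps by (intro sum.cong refl Cons.IH Cons.prems) simp
    also have "\<dots> = (\<Sum>a'\<in>f -` {b'}. \<Sum>a\<in>f -` {b}. push f (\<lambda>qs'. J ((s', a', m') # (s, a, m) # qs')) (us @ vs))"
      by (simp add: q)
    also have "\<dots> = (\<Sum>a'\<in>f -` {b'}. \<Sum>a\<in>f -` {b}. push f (\<lambda>qs'. J ((s, a, m) # (s', a', m') # qs')) (us @ vs))"
      by (intro sum.cong refl arg_cong[where f = "\<lambda>J. push f J (us @ vs)"] ext Cons.prems) simp
    also have "\<dots> = push f J (q # (p # us) @ vs)"
      by (simp add: p q) (rule sum.swap)
    finally show ?case .
  qed
  show "mset ps = mset qs \<Longrightarrow> push f J ps = push f J qs"
    using assms
  proof (induction ps arbitrary: qs J)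
    case Nil
    from Nil(1) show ?case by simp
  next
    case (Cons p ps)
    from Cons.prems(1) have "p \<in> set qs" by (metis list.set_intros(1) mset_eq_setD)
    then obtain us vs where qs: "qs = us @ p # vs" by (metis split_list)
    from Cons.prems(1) have mset: "mset ps = mset (us @ vs)" by (simp add: qs)
    obtain s b m where p: "p = (s, b, m)" by (cases p)
    have "push f J (p # ps) = push f J (p # us @ vs)"
      unfolding p push.simps by (intro sum.cong refl Cons.IH mset Cons.prems(2)) simp
    also have "\<dots> = push f J qs" unfolding qs by (rule move[OF Cons.prems(2), symmetric])
    finally show ?case .
  qed
qed

lemma push_norm_le:
  fixes J :: "('l::finite, 'k::real_normed_vector) jet"
  assumes "\<And>qs'. map order_of qs' = map order_of qs \<Longrightarrow> norm (J qs') \<le> M" and M: "M \<ge> 0"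
  shows "norm (push f J qs) \<le> real CARD('l) ^ length qs * M"
  using assms(1)
proof (induction qs arbitrary: J)
  case (Cons q qs)
  obtain s b m where q: "q = (s, b, m)" by (cases q)
  have "norm (push f J (q # qs)) \<le> (\<Sum>a\<in>f -` {b}. norm (push f (\<lambda>qs'. J ((s, a, m) # qs')) qs))"
    unfolding q push.simps by (rule norm_sum)
  also have "\<dots> \<le> (\<Sum>a\<in>f -` {b}. real CARD('l) ^ length qs * M)"
    using Cons.prems by (intro sum_mono Cons.IH) (auto simp: q)
  also have "\<dots> \<le> (\<Sum>a\<in>(UNIV :: 'l set). real CARD('l) ^ length qs * M)"
    using M by (intro sum_mono2) auto
  finally show ?case by simp
qed simp

lemma has_vector_derivative_push:
  fixes F :: "real \<Rightarrow> ('l::finite, 'k::real_normed_vector) jet"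
  assumes "\<And>qs. ((\<lambda>t. F t qs) has_vector_derivative F' qs) (at s)"
  shows "((\<lambda>t. push f (F t) qs) has_vector_derivative push f F' qs) (at s)"
  using assms
proof (induction qs arbitrary: F F')
  case (Cons q qs)
  obtain s b m where q: "q = (s, b, m)" by (cases q)
  show ?case unfolding q push.simps by (intro has_vector_derivative_sum Cons.IH Cons.prems)
qed simp

text \<open>
  A list of length \<open>n\<close> has at most \<open>L\<^sup>n\<close> liftings, where \<open>L\<close> is the number of labels.
\<close>

lemma jet_bounded_push:
  fixes J :: "('l::finite, 'k::real_normed_vector) jet" and f :: "'l \<Rightarrow> 'b"
  assumes J: "jet_bounded k (real CARD('l) * C) B J" and C: "C > 0"
  shows "jet_bounded k C B (push f J)"
  unfolding jet_bounded_def
proof (intro allI impI)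
  fix qs :: "(real \<times> 'b \<times> nat) list"
  assume qs: "\<forall>q\<in>set qs. order_of q \<le> k"
  let ?n = "length qs"
  have "norm (push f J qs) \<le> real CARD('l) ^ ?n * (B * fact ?n / (real CARD('l) * C) ^ ?n)"
  proof (rule push_norm_le)
    fix qs' :: "(real \<times> 'l \<times> nat) list" assume eq: "map order_of qs' = map order_of qs"
    then have "length qs' = ?n" by (rule map_eq_imp_length_eq)
    moreover have "order_of q \<le> k" if "q \<in> set qs'" for q
    proof -
      have "order_of q \<in> order_of ` set qs" using that eq by (metis image_eqI image_set)
      then show ?thesis using qs by auto
    qed
    ultimately have "(real CARD('l) * C) ^ ?n * norm (J qs') \<le> B * fact ?n"
      using jet_boundedD[OF J, of qs'] by simp
    then show "norm (J qs') \<le> B * fact ?n / (real CARD('l) * C) ^ ?n"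
      using C by (simp add: field_simps)
  qed (use C jet_bounded_nonneg[OF J] in simp)
  then show "C ^ ?n * norm (push f J qs) \<le> B * fact ?n"
    using C by (simp add: field_simps power_mult_distrib)
qed

lemma push_in_jets:
  fixes J :: "('l::finite, 'k::real_normed_field) jet"
  assumes J: "J \<in> jets"
  shows "push f J \<in> jets"
proof (rule jetsI)
  show "push f J ps = push f J qs" if "mset ps = mset qs" for ps qs
    using jets_perm[OF J] that by (rule push_perm)
  show "push f J ((s + 1, a, m) # qs) = push f J ((s, a, m) # qs)" for s a m qs
    by (simp add: jets_periodic[OF J])
  show "((\<lambda>t. push f J ((t, a, m) # qs)) has_vector_derivative push f J ((s, a, Suc m) # qs)) (at s)" for s a m qs
    unfolding push.simps by (intro has_vector_derivative_sum has_vector_derivative_push jets_deriv J)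
  show "\<exists>B. jet_bounded k C B (push f J)" if C: "C > 0" for k C
  proof -
    have "real CARD('l) * C > 0" using C by simp
    then obtain B where B: "jet_bounded k (real CARD('l) * C) B J" using jets_bounded[OF J] by blast
    show ?thesis using jet_bounded_push[OF B C] by blast
  qed
qed

lemma jet_op_push: "jet_op (push f :: ('l::finite, 'k::real_normed_field) jet \<Rightarrow> ('m, 'k) jet)"
  unfolding jet_op_def
proof (intro conjI ballI allI impI)
  fix k :: nat and C :: real assume C: "C > 0"
  then have "real CARD('l) * C > 0" by simp
  then show "\<exists>k'. \<exists>C'>0. \<exists>K\<ge>0. \<forall>J\<in>jets. \<forall>B. jet_bounded k' C' B J \<longrightarrow>
     jet_bounded k C (K * B) (push f J :: ('m, 'k) jet)" using jet_bounded_push[OF _ C]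
    by - (rule exI[of _ k], rule exI[of _ "real CARD('l) * C"], rule conjI, assumption, rule exI[of _ 1], auto)
qed (auto simp: push_in_jets plus_fun_def push_add jet_scale_def push_mult)

text \<open>
  Lifting along a composition means lifting along the two maps in turn.
\<close>

lemma push_push:
  fixes J :: "('l::finite, 'k::comm_monoid_add) jet" and f :: "'l \<Rightarrow> 'm::finite"
  shows "push g (push f J) = push (g \<circ> f) J"
proof
  show "push g (push f J) qs = push (g \<circ> f) J qs" for qs
  proof (induction qs arbitrary: J)
    case (Cons q qs)
    obtain s c m where q: "q = (s, c, m)" by (cases q)
    have "push g (push f J) (q # qs) = (\<Sum>b\<in>g -` {c}. \<Sum>a\<in>f -` {b}. push (g \<circ> f) (\<lambda>qs'. J ((s, a, m) # qs')) qs)"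
      by (simp add: q push_sum Cons o_def)
    also have "\<dots> = (\<Sum>a\<in>(\<Union>b\<in>g -` {c}. f -` {b}). push (g \<circ> f) (\<lambda>qs'. J ((s, a, m) # qs')) qs)"
      by (rule sum.UNION_disjoint[symmetric]) auto
    also have "(\<Union>b\<in>g -` {c}. f -` {b}) = (g \<circ> f) -` {c}" by auto
    finally show ?case by (simp only: q push.simps)
  qed simp
qed

lemma tensor_Inl: "tensor (\<lambda>qs'. J ((s, a, m) # qs')) J' = (\<lambda>qs'. tensor J J' ((s, Inl a, m) # qs'))"
  and tensor_Inr: "tensor J (\<lambda>qs'. J' ((s, b, m) # qs')) = (\<lambda>qs'. tensor J J' ((s, Inr b, m) # qs'))"
  by (auto simp: tensor_def)

lemma tensor_push_left:
  fixes J :: "('l::finite, 'k::comm_semiring_0) jet" and J' :: "('n::finite, 'k) jet" and f :: "'l \<Rightarrow> 'b"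
  shows "tensor (push f J) J' = push (map_sum f id) (tensor J J')"
proof
  show "tensor (push f J) J' qs = push (map_sum f id) (tensor J J') qs" for qs
  proof (induction qs arbitrary: J J')
    case Nil
    then show ?case by (simp add: tensor_def)
  next
    case (Cons q qs)
    obtain s x m where q: "q = (s, x, m)" by (cases q)
    show ?case
    proof (cases x)
      case (Inl b)
      have *: "map_sum f id -` {Inl b :: 'b + 'n} = Inl ` (f -` {b})"
        by (auto simp: map_sum_def image_iff split: sum.splits)
      have "tensor (push f J) J' (q # qs) = (\<Sum>a\<in>f -` {b}. tensor (push f (\<lambda>qs'. J ((s, a, m) # qs'))) J' qs)"
        by (simp add: q Inl tensor_def sum_distrib_right)
      then show ?thesis
        unfolding Cons tensor_Inl tensor_Inr q Inl push.simps * by (simp add: sum.reindex)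
    next
      case (Inr c)
      have *: "map_sum f id -` {Inr c :: 'b + 'n} = {Inr c}"
        by (auto simp: map_sum_def image_iff split: sum.splits)
      have "tensor (push f J) J' (q # qs) = tensor (push f J) (\<lambda>qs'. J' ((s, c, m) # qs')) qs"
        by (simp add: q Inr tensor_def)
      also have "\<dots> = push (map_sum f id) (tensor J (\<lambda>qs'. J' ((s, c, m) # qs'))) qs" by (rule Cons)
      finally show ?thesis
        unfolding tensor_Inr q Inr push.simps * by simp
    qed
  qed
qed

fun sum_swap :: "'a + 'b \<Rightarrow> 'b + 'a" where
  "sum_swap (Inl a) = Inr a"
| "sum_swap (Inr b) = Inl b"

lemma sum_swap_vimage_1: "sum_swap -` {Inl b} = {Inr b}"
proof -
  have "sum_swap x = Inl b \<longleftrightarrow> x = Inr b" for x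
    by (cases x rule: sum_swap.cases) auto
  then show ?thesis by auto
qed

lemma sum_swap_vimage_2: "sum_swap -` {Inr a} = {Inl a}"
proof -
  have "sum_swap x = Inr a \<longleftrightarrow> x = Inl a" for x
    by (cases x rule: sum_swap.cases) auto
  then show ?thesis by auto
qed

lemmas sum_swap_vimage = sum_swap_vimage_1 sum_swap_vimage_2

lemma tensor_swap:
  fixes F :: "('a::finite, 'k::comm_semiring_1) jet" and G :: "('b::finite, 'k) jet"
  shows "push sum_swap (tensor F G) = tensor G F"
proof
  show "push sum_swap (tensor F G) qs = tensor G F qs" for qs
  proof (induction qs arbitrary: F G)
    case Nil
    then show ?case by (simp add: tensor_def mult.commute)
  next
    case (Cons q qs)
    obtain s x m where q: "q = (s, x, m)" by (cases q)
    show ?case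
    proof (cases x)
      case (Inl b)
      then show ?thesis using Cons[of F "\<lambda>qs. G ((s, b, m) # qs)"] by (simp add: q sum_swap_vimage tensor_def)
    next
      case (Inr a)
      then show ?thesis using Cons[of "\<lambda>qs. F ((s, a, m) # qs)" G] by (simp add: q sum_swap_vimage tensor_def)
    qed
  qed
qed

text \<open>
  Follows from the case of the left factor by exchanging the factors.
\<close>

lemma tensor_push_right:
  fixes J :: "('l::finite, 'k::comm_semiring_1) jet" and J' :: "('n::finite, 'k) jet" and f :: "'n \<Rightarrow> 'b::finite"
  shows "tensor J (push f J') = push (map_sum id f) (tensor J J')"
proof -
  have comm: "sum_swap \<circ> map_sum f id = (map_sum id f \<circ> sum_swap :: 'n + 'l \<Rightarrow> 'l + 'b)"
  proof
    show "(sum_swap \<circ> map_sum f id) x = (map_sum id f \<circ> sum_swap) x" for x :: "'n + 'l"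
      by (cases x) auto
  qed
  have "tensor J (push f J') = push sum_swap (push (map_sum f id) (tensor J' J))"
    unfolding tensor_push_left[symmetric] tensor_swap ..
  then show ?thesis unfolding push_push comm unfolding push_push[symmetric] tensor_swap .
qed

fun sum_assoc :: "('a + 'b) + 'c \<Rightarrow> 'a + ('b + 'c)" where
  "sum_assoc (Inl (Inl a)) = Inl a"
| "sum_assoc (Inl (Inr b)) = Inr (Inl b)"
| "sum_assoc (Inr c) = Inr (Inr c)"

lemma sum_assoc_vimage_1: "sum_assoc -` {Inl a} = {Inl (Inl a)}"
proof -
  have "sum_assoc x = Inl a \<longleftrightarrow> x = Inl (Inl a)" for x
    by (cases x rule: sum_assoc.cases) auto
  then show ?thesis by auto
qed

lemma sum_assoc_vimage_2: "sum_assoc -` {Inr (Inl b)} = {Inl (Inr b)}"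
proof -
  have "sum_assoc x = Inr (Inl b) \<longleftrightarrow> x = Inl (Inr b)" for x
    by (cases x rule: sum_assoc.cases) auto
  then show ?thesis by auto
qed

lemma sum_assoc_vimage_3: "sum_assoc -` {Inr (Inr c)} = {Inr c}"
proof -
  have "sum_assoc x = Inr (Inr c) \<longleftrightarrow> x = Inr c" for x
    by (cases x rule: sum_assoc.cases) auto
  then show ?thesis by auto
qed

lemmas sum_assoc_vimage = sum_assoc_vimage_1 sum_assoc_vimage_2 sum_assoc_vimage_3

lemma tensor_assoc:
  fixes F :: "('a::finite, 'k::comm_semiring_1) jet" and G :: "('b::finite, 'k) jet" and H :: "('c::finite, 'k) jet"
  shows "push sum_assoc (tensor (tensor F G) H) = tensor F (tensor G H)"
proof
  show "push sum_assoc (tensor (tensor F G) H) qs = tensor F (tensor G H) qs" for qs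
  proof (induction qs arbitrary: F G H)
    case Nil
    then show ?case by (simp add: tensor_def mult.assoc)
  next
    case (Cons q qs)
    obtain s x m where q: "q = (s, x, m)" by (cases q)
    consider a where "x = Inl a" | b where "x = Inr (Inl b)" | c where "x = Inr (Inr c)"
      by (metis sumE)
    then show ?case
    proof cases
      case (1 a)
      then show ?thesis using Cons[of "\<lambda>qs. F ((s, a, m) # qs)" G H] by (simp add: q sum_assoc_vimage tensor_def)
    next
      case (2 b)
      then show ?thesis using Cons[of F "\<lambda>qs. G ((s, b, m) # qs)" H] by (simp add: q sum_assoc_vimage tensor_def)
    next
      case (3 c)
      then show ?thesis using Cons[of F G "\<lambda>qs. H ((s, c, m) # qs)"] by (simp add: q sum_assoc_vimage tensor_def)
    qed
  qed
qed

section \<open>Fourier coefficients\<close>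

text \<open>
  The scalar factor of the basis vector \<open>fourier_basis i k\<close>.
\<close>

definition mode :: "int \<Rightarrow> real \<Rightarrow> real" where
  "mode k s = (if k = 0 then 1 else sqrt 2) *
      (if k \<ge> 0 then cos (2 * of_int k * pi * s) else sin (2 * of_int k * pi * s)) / sqrt (fourier_weight k)"

definition mode_deriv :: "int \<Rightarrow> real \<Rightarrow> real" where
  "mode_deriv k s = (2 * of_int k * pi) * ((if k = 0 then 1 else sqrt 2) *
      (if k \<ge> 0 then - sin (2 * of_int k * pi * s) else cos (2 * of_int k * pi * s)) / sqrt (fourier_weight k))"

lemma fourier_weight_ge_1: "fourier_weight k \<ge> 1"
  by (simp add: fourier_weight_def)

lemma fourier_weight_pos: "fourier_weight k > 0"
  using fourier_weight_ge_1[of k] by linarith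

lemma mode_has_derivative: "(mode k has_real_derivative mode_deriv k s) (at s)"
  unfolding mode_def[abs_def] mode_deriv_def
  by (cases "k \<ge> 0") (auto intro!: derivative_eq_intros simp: divide_simps fourier_weight_pos less_imp_neq[OF fourier_weight_pos, symmetric])

text \<open>
  The modes are eigenfunctions of \<open>1 - \<partial>\<^sup>2\<close> with eigenvalue \<open>\<lambda>k\<^sup>2 + 1\<close>. This one equation evaluates the
  inner product of \<open>H\<close> against a basis vector and drives the decay of the coefficients.
\<close>

lemma mode_deriv_has_derivative: "(mode_deriv k has_real_derivative (1 - fourier_weight k) * mode k s) (at s)"
proof -
  define y A where "y = 2 * of_int k * pi" and "A = (if k = 0 then 1 else sqrt 2) / sqrt (fourier_weight k)"
  have "((\<lambda>s. y * (A * - sin (y * s))) has_real_derivative - (y\<^sup>2) * (A * cos (y * s))) (at s)"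
    "((\<lambda>s. y * (A * cos (y * s))) has_real_derivative - (y\<^sup>2) * (A * sin (y * s))) (at s)"
    by (auto intro!: derivative_eq_intros simp: power2_eq_square)
  moreover have "1 - fourier_weight k = - (y\<^sup>2)" by (simp add: fourier_weight_def y_def power_mult_distrib)
  ultimately show ?thesis
    unfolding mode_def mode_deriv_def[abs_def] by (cases "k \<ge> 0") (simp_all add: y_def A_def)
qed

lemma cos_sin_2pi_int: "cos (2 * of_int k * pi) = 1" "sin (2 * of_int k * pi) = 0"
  using cos_int_2pin[of k] sin_int_2pin[of k] by (simp_all only: mult_ac)

lemma mode_periodic: "mode k 1 = mode k 0" "mode_deriv k 1 = mode_deriv k 0"
  by (auto simp: mode_def mode_deriv_def cos_sin_2pi_int)

lemma mode_bound: "\<bar>mode k s\<bar> \<le> 3 / 2"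
proof -
  have "\<bar>mode k s\<bar> \<le> sqrt 2 * 1 / sqrt (fourier_weight k)"
  proof -
    have "\<bar>if k \<ge> 0 then cos (2 * of_int k * pi * s) else sin (2 * of_int k * pi * s)\<bar> \<le> 1"
      by simp
    then have "\<bar>if k = 0 then 1 else sqrt 2\<bar> * \<bar>if k \<ge> 0 then cos (2 * of_int k * pi * s) else sin (2 * of_int k * pi * s)\<bar> \<le> sqrt 2 * 1"
      by (intro mult_mono) auto
    then show ?thesis
      unfolding mode_def abs_divide abs_mult using fourier_weight_pos[of k]
      by (simp add: divide_right_mono)
  qed
  also have "\<dots> \<le> sqrt 2 * 1 / 1"
    using fourier_weight_ge_1[of k] by - (rule divide_left_mono, auto)
  also have "\<dots> \<le> 3 / 2"
  proof -
    have "sqrt 2 \<le> 3 / 2" by (rule real_le_lsqrt) (simp_all add: power2_eq_square)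
    then show ?thesis by simp
  qed
  finally show ?thesis .
qed

lemma continuous_on_mode: "continuous_on S (mode k)"
  by (rule DERIV_continuous_on) (rule has_field_derivative_at_within[OF mode_has_derivative])

lemma fourier_basis_mode: "fourier_basis i k s = mode k s *\<^sub>R axis i 1"
  by (simp add: fourier_basis_def mode_def)

text \<open>
  Up to normalization a Fourier coefficient; the weight appears because the inner product of \<open>H\<close> with a basis
  vector is \<open>\<lambda>k\<^sup>2 + 1\<close> times the \<open>L\<^sup>2\<close> product with it.
\<close>

definition coef :: "int \<Rightarrow> (real \<Rightarrow> 'k::euclidean_space) \<Rightarrow> 'k" where
  "coef k f = fourier_weight k *\<^sub>R integral {0..1} (\<lambda>s. mode k s *\<^sub>R f s)"

lemma mode_integrable:
  fixes f :: "real \<Rightarrow> 'k::euclidean_space"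
  assumes "continuous_on {0..1} f"
  shows "(\<lambda>s. mode k s *\<^sub>R f s) integrable_on {0..1}"
  by (intro integrable_continuous_real continuous_intros continuous_on_mode assms)

lemma coef_add:
  assumes "continuous_on {0..1} f" "continuous_on {0..1} g"
  shows "coef k (\<lambda>s. f s + g s) = coef k f + coef k g"
  using assms by (simp add: coef_def scaleR_add_right integral_add mode_integrable)

lemma coef_diff:
  assumes "continuous_on {0..1} f" "continuous_on {0..1} g"
  shows "coef k (\<lambda>s. f s - g s) = coef k f - coef k g"
  using assms by (simp add: coef_def scaleR_diff_right integral_diff mode_integrable)

lemma coef_linear:
  assumes "bounded_linear L" "continuous_on {0..1} f"
  shows "coef k (\<lambda>s. L (f s)) = L (coef k f)"
proof -
  interpret L: bounded_linear L by fact
  have "integral {0..1} (\<lambda>s. mode k s *\<^sub>R L (f s)) = L (integral {0..1} (\<lambda>s. mode k s *\<^sub>R f s))"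
    using integral_linear[OF mode_integrable[OF assms(2)] assms(1)] by (simp add: o_def L.scaleR)
  then show ?thesis by (simp add: coef_def L.scaleR)
qed

lemma coef_mult:
  fixes f :: "real \<Rightarrow> 'k::{real_normed_field, euclidean_space}"
  assumes "continuous_on {0..1} f"
  shows "coef k (\<lambda>s. c * f s) = c * coef k f" "coef k (\<lambda>s. f s * c) = coef k f * c"
  using coef_linear[OF bounded_linear_mult_right assms] coef_linear[OF bounded_linear_mult_left assms] by auto

lemma coef_scaleR:
  assumes "continuous_on {0..1} f"
  shows "coef k (\<lambda>s. c *\<^sub>R f s) = c *\<^sub>R coef k f"
  by (rule coef_linear[OF bounded_linear_scaleR_right assms])

lemma coef_sum:
  assumes "finite X" "\<And>x. x \<in> X \<Longrightarrow> continuous_on {0..1} (f x)"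
  shows "coef k (\<lambda>s. \<Sum>x\<in>X. f x s) = (\<Sum>x\<in>X. coef k (f x))"
  using assms
proof (induction X)
  case empty
  then show ?case by (simp add: coef_def)
next
  case (insert x X)
  then show ?case by (simp add: coef_add continuous_on_sum)
qed

lemma coef_norm_le:
  assumes "continuous_on {0..1} f" "\<And>s. norm (f s) \<le> M"
  shows "norm (coef k f) \<le> fourier_weight k * (3 / 2 * M)"
proof -
  have "norm (integral {0..1} (\<lambda>s. mode k s *\<^sub>R f s)) \<le> (3 / 2 * M) * (1 - 0)"
  proof (rule integral_bound)
    show "continuous_on {0..1} (\<lambda>s. mode k s *\<^sub>R f s)"
      by (intro continuous_intros continuous_on_mode assms)
    have "M \<ge> 0" using assms(2)[of 0] norm_ge_zero order_trans by blast
    then show "norm (mode k s *\<^sub>R f s) \<le> 3 / 2 * M" for s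
      unfolding norm_scaleR using mode_bound[of k s] assms(2)[of s] by (intro mult_mono) auto
  qed simp
  then show ?thesis using fourier_weight_pos[of k] by (simp add: coef_def)
qed

text \<open>
  The function \<open>mode k * f' - mode_deriv k * f\<close> has the same value at 0 and 1, so its derivative has
  integral 0.
\<close>

lemma coef_by_parts:
  fixes f :: "real \<Rightarrow> 'k::euclidean_space"
  assumes f: "\<And>s. (f has_vector_derivative f' s) (at s)" and f': "\<And>s. (f' has_vector_derivative f'' s) (at s)"
    and cont: "continuous_on {0..1} f''" and per: "f 1 = f 0" "f' 1 = f' 0"
  shows "coef k (\<lambda>s. f s - f'' s) = fourier_weight k *\<^sub>R coef k f"
proof -
  let ?w = "fourier_weight k"
  let ?g = "\<lambda>s. mode k s *\<^sub>R f' s - mode_deriv k s *\<^sub>R f s"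
  have "((\<lambda>s. mode k s *\<^sub>R f'' s - (1 - ?w) *\<^sub>R (mode k s *\<^sub>R f s)) has_integral ?g 1 - ?g 0) {0..1}"
  proof (rule fundamental_theorem_of_calculus)
    fix s :: real
    have "(?g has_vector_derivative (mode k s *\<^sub>R f'' s + mode_deriv k s *\<^sub>R f' s)
        - (mode_deriv k s *\<^sub>R f' s + ((1 - ?w) * mode k s) *\<^sub>R f s)) (at s)"
      by (intro has_vector_derivative_diff has_vector_derivative_scaleR f f' mode_has_derivative mode_deriv_has_derivative)
    then have "(?g has_vector_derivative mode k s *\<^sub>R f'' s - (1 - ?w) *\<^sub>R (mode k s *\<^sub>R f s)) (at s)"
      by simp
    then show "(?g has_vector_derivative mode k s *\<^sub>R f'' s - (1 - ?w) *\<^sub>R (mode k s *\<^sub>R f s)) (at s within {0..1})"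
      by (rule has_vector_derivative_at_within)
  qed simp
  then have I: "integral {0..1} (\<lambda>s. mode k s *\<^sub>R f'' s - (1 - ?w) *\<^sub>R (mode k s *\<^sub>R f s)) = 0"
    using per by (simp add: mode_periodic integral_unique)
  have cf: "continuous_on {0..1} f"
    by (rule continuous_at_imp_continuous_on) (auto intro: has_vector_derivative_continuous f)
  have "integral {0..1} (\<lambda>s. mode k s *\<^sub>R f'' s - (1 - ?w) *\<^sub>R (mode k s *\<^sub>R f s)) =
     integral {0..1} (\<lambda>s. mode k s *\<^sub>R f'' s) - (1 - ?w) *\<^sub>R integral {0..1} (\<lambda>s. mode k s *\<^sub>R f s)"
    by (subst integral_diff[OF mode_integrable[OF cont] integrable_cmul[OF mode_integrable[OF cf]]])
      (simp only: integral_cmul)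
  then have "integral {0..1} (\<lambda>s. mode k s *\<^sub>R f'' s) = (1 - ?w) *\<^sub>R integral {0..1} (\<lambda>s. mode k s *\<^sub>R f s)"
    using I by simp
  then have "coef k f'' = (1 - ?w) *\<^sub>R coef k f" by (simp add: coef_def mult.commute)
  then show ?thesis by (simp add: coef_diff[OF cf cont] algebra_simps)
qed

lemma coef_swap:
  fixes f :: "real \<Rightarrow> real \<Rightarrow> 'k::euclidean_space"
  assumes "continuous_on UNIV (\<lambda>z. f (fst z) (snd z))"
  shows "coef k (\<lambda>s. coef l (\<lambda>t. f s t)) = coef l (\<lambda>t. coef k (\<lambda>s. f s t))"
proof -
  have m: "continuous_on UNIV (\<lambda>z :: real \<times> real. mode j (g z))" if "continuous_on UNIV g" for j and g :: "real \<times> real \<Rightarrow> real"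
    using continuous_on_compose2[OF continuous_on_mode[of UNIV j] that] by auto
  have "continuous_on UNIV (\<lambda>z. mode k (fst z) *\<^sub>R mode l (snd z) *\<^sub>R f (fst z) (snd z))"
    by (intro continuous_on_scaleR m assms continuous_intros)
  then have "continuous_on (cbox (0, 0) (1, 1)) (\<lambda>(s, t). mode k s *\<^sub>R mode l t *\<^sub>R f s t)"
    using continuous_on_subset[OF _ subset_UNIV] by (fastforce simp: case_prod_unfold)
  note swap = integral_swap_continuous[OF this]
  have e1: "integral {0..1} (\<lambda>t. mode k s *\<^sub>R mode l t *\<^sub>R f s t) = mode k s *\<^sub>R integral {0..1} (\<lambda>t. mode l t *\<^sub>R f s t)" for s
    by (rule integral_cmul)
  have e2: "integral {0..1} (\<lambda>s. mode k s *\<^sub>R mode l t *\<^sub>R f s t) = mode l t *\<^sub>R integral {0..1} (\<lambda>s. mode k s *\<^sub>R f s t)" for t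
    by (subst scaleR_left_commute) (rule integral_cmul)
  from swap
  have *: "integral {0..1} (\<lambda>s. mode k s *\<^sub>R integral {0..1} (\<lambda>t. mode l t *\<^sub>R f s t)) =
        integral {0..1} (\<lambda>t. mode l t *\<^sub>R integral {0..1} (\<lambda>s. mode k s *\<^sub>R f s t))"
    unfolding e1[symmetric] e2[symmetric] by simp
  have nest: "coef k (\<lambda>s. coef l (g s)) = (fourier_weight k * fourier_weight l) *\<^sub>R integral {0..1} (\<lambda>s. mode k s *\<^sub>R integral {0..1} (\<lambda>t. mode l t *\<^sub>R g s t))"
    for k l and g :: "real \<Rightarrow> real \<Rightarrow> 'k"
    unfolding coef_def by (subst scaleR_left_commute, subst integral_cmul, subst scaleR_scaleR, rule refl)
  show ?thesis
    unfolding nest[of k l f] nest[of l k "\<lambda>t s. f s t"] * by (simp add: mult.commute)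
qed

text \<open>
  Continuity and the interchange are proved together, since the induction step for the interchange needs
  the continuity of each summand.
\<close>

lemma coef_push:
  fixes F :: "real \<Rightarrow> ('l::finite, 'k::euclidean_space) jet"
  assumes "\<And>qs. continuous_on {0..1} (\<lambda>s. F s qs)"
  shows "continuous_on {0..1} (\<lambda>s. push f (F s) qs) \<and> coef k (\<lambda>s. push f (F s) qs) = push f (\<lambda>qs. coef k (\<lambda>s. F s qs)) qs"
  using assms
proof (induction qs arbitrary: F)
  case (Cons q qs)
  obtain t b m where q: "q = (t, b, m)" by (cases q)
  have IH: "continuous_on {0..1} (\<lambda>s. push f (\<lambda>qs'. F s ((t, a, m) # qs')) qs)"
    "coef k (\<lambda>s. push f (\<lambda>qs'. F s ((t, a, m) # qs')) qs) = push f (\<lambda>qs'. coef k (\<lambda>s. F s ((t, a, m) # qs'))) qs" for a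
    using Cons.IH[of "\<lambda>s qs'. F s ((t, a, m) # qs')"] Cons.prems by auto
  show ?case by (simp add: q coef_sum IH continuous_on_sum)
qed simp

section \<open>Annihilation operators on jets\<close>

text \<open>
  The annihilation operator for \<open>fourier_basis a k\<close>, for jets: by symmetry every slot contributes the same
  integral, and the number of slots is absorbed by the factor \<open>n!\<close>.
\<close>

definition lower :: "'l \<Rightarrow> int \<Rightarrow> ('l, 'k::euclidean_space) jet \<Rightarrow> ('l, 'k) jet" where
  "lower a k J qs = coef k (\<lambda>s. J ((s, a, 0) # qs))"

text \<open>
  Integrating by parts twice replaces \<open>J\<close> by \<open>(1 - \<partial>\<^sup>2)\<^sup>2 J\<close>, which involves four times the bound \<open>M\<close>, and gains two
  factors \<open>\<lambda>k\<^sup>2 + 1\<close>, one of which cancels the weight in \<open>coef\<close>.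
\<close>

lemma lower_bound:
  fixes J :: "('l, 'k::euclidean_space) jet"
  assumes J: "J \<in> jets" and M: "\<And>s m. m \<le> 4 \<Longrightarrow> norm (J ((s, a, m) # qs)) \<le> M"
  shows "norm (lower a k J qs) \<le> 6 / fourier_weight k * M"
proof -
  let ?w = "fourier_weight k"
  let ?f = "\<lambda>m s. J ((s, a, m) # qs)"
  have c: "continuous_on {0..1} (?f m)" for m by (rule continuous_on_jets_head[OF J])
  have per: "?f m 1 = ?f m 0" for m using jets_periodic[OF J, of 0] by simp
  have p: "coef k (\<lambda>s. ?f m s - ?f (Suc (Suc m)) s) = ?w *\<^sub>R coef k (?f m)" for m
    by (rule coef_by_parts[OF jets_deriv[OF J] jets_deriv[OF J] c per per])
  have p0: "?w *\<^sub>R coef k (?f 0) = coef k (?f 0) - coef k (?f 2)"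
    using p[of 0] unfolding coef_diff[OF c c] numeral_2_eq_2 by (rule sym)
  have p2: "?w *\<^sub>R coef k (?f 2) = coef k (?f 2) - coef k (?f 4)"
    using p[of 2] unfolding coef_diff[OF c c] by simp
  have "?w *\<^sub>R ?w *\<^sub>R coef k (?f 0) = (coef k (?f 0) - coef k (?f 2)) - (coef k (?f 2) - coef k (?f 4))"
    by (simp only: p0 p2 scaleR_diff_right)
  also have "\<dots> = coef k (\<lambda>s. (?f 0 s - ?f 2 s) - (?f 2 s - ?f 4 s))"
    by (simp add: coef_diff c continuous_on_diff)
  also have "norm \<dots> \<le> ?w * (3 / 2 * (4 * M))"
  proof (rule coef_norm_le)
    show "continuous_on {0..1} (\<lambda>s. (?f 0 s - ?f 2 s) - (?f 2 s - ?f 4 s))"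
      by (intro continuous_on_diff c)
    show "norm ((?f 0 s - ?f 2 s) - (?f 2 s - ?f 4 s)) \<le> 4 * M" for s
      using M[of 0 s] M[of 2 s] M[of 4 s] norm_triangle_ineq4[of "?f 0 s - ?f 2 s" "?f 2 s - ?f 4 s"]
        norm_triangle_ineq4[of "?f 0 s" "?f 2 s"] norm_triangle_ineq4[of "?f 2 s" "?f 4 s"] by linarith
  qed
  finally have "?w * (?w * norm (coef k (?f 0))) \<le> ?w * (6 * M)"
    using fourier_weight_pos[of k] by simp
  then have "?w * norm (coef k (?f 0)) \<le> 6 * M"
    using fourier_weight_pos[of k] by simp
  then show ?thesis
    using fourier_weight_pos[of k] by (simp add: lower_def field_simps)
qed

text \<open>
  The additional point costs a factor \<open>n + 1 \<le> 2\<^sup>n\<close> in the factorial, hence the constant \<open>2 C\<close>.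
\<close>

lemma lower_jet_bounded:
  fixes J :: "('l, 'k::euclidean_space) jet"
  assumes J: "J \<in> jets" and bd: "jet_bounded (max k 4) (2 * C) B J" and C: "C > 0"
  shows "jet_bounded k C (3 / (C * fourier_weight l) * B) (lower a l J)"
  unfolding jet_bounded_def
proof (intro allI impI)
  fix qs :: "(real \<times> 'l \<times> nat) list"
  assume qs: "\<forall>q\<in>set qs. order_of q \<le> k"
  let ?n = "length qs"
  have B: "B \<ge> 0" using jet_bounded_nonneg[OF bd] .
  have "norm (lower a l J qs) \<le> 6 / fourier_weight l * (B * fact (Suc ?n) / (2 * C) ^ Suc ?n)"
  proof (rule lower_bound[OF J])
    fix s :: real and m :: nat assume m: "m \<le> 4"
    have "(2 * C) ^ length ((s, a, m) # qs) * norm (J ((s, a, m) # qs)) \<le> B * fact (length ((s, a, m) # qs))"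
      using qs m by (intro jet_boundedD[OF bd]) (auto simp: le_max_iff_disj)
    then show "norm (J ((s, a, m) # qs)) \<le> B * fact (Suc ?n) / (2 * C) ^ Suc ?n"
      using C by (simp add: field_simps)
  qed
  then have "C ^ ?n * norm (lower a l J qs) \<le> C ^ ?n * (6 / fourier_weight l * (B * fact (Suc ?n) / (2 * C) ^ Suc ?n))"
    using C by (intro mult_left_mono) auto
  also have "\<dots> = 3 / (C * fourier_weight l) * B * fact ?n * (real (Suc ?n) / 2 ^ ?n)"
    using C fourier_weight_pos[of l] by (simp add: power_mult_distrib field_simps)
  also have "\<dots> \<le> 3 / (C * fourier_weight l) * B * fact ?n * 1"
  proof (intro mult_left_mono)
    have "real (Suc ?n) \<le> 2 ^ ?n"
      by (metis Suc_leI less_exp of_nat_le_iff of_nat_numeral of_nat_power)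
    then show "real (Suc ?n) / 2 ^ ?n \<le> 1" by simp
  qed (use C B fourier_weight_pos[of l] in simp)
  finally show "C ^ ?n * norm (lower a l J qs) \<le> 3 / (C * fourier_weight l) * B * fact ?n" by simp
qed

lemma lower_in_jets:
  fixes J :: "('l, 'k::euclidean_space) jet"
  assumes J: "J \<in> jets"
  shows "lower a k J \<in> jets"
proof (rule jetsI)
  show "lower a k J ps = lower a k J qs" if "mset ps = mset qs" for ps qs
    using jets_perm[OF J, of "(s, a, 0) # ps" "(s, a, 0) # qs" for s] that by (simp add: lower_def)
  show "lower a k J ((s + 1, b, m) # qs) = lower a k J ((s, b, m) # qs)" for s b m qs
    unfolding lower_def jets_swap[OF J, of "(_, a, 0)"] jets_periodic[OF J] ..
  show "\<exists>B. jet_bounded l C B (lower a k J)" if C: "C > 0" for l C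
  proof -
    have "2 * C > 0" using C by simp
    then obtain B where "jet_bounded (max l 4) (2 * C) B J" using jets_bounded[OF J] by blast
    from lower_jet_bounded[OF J this C] show ?thesis by blast
  qed
  fix s :: real and b :: 'l and m :: nat and qs :: "(real \<times> 'l \<times> nat) list"
  obtain M where M: "\<And>ps. length ps = length qs + 2 \<Longrightarrow> \<forall>q\<in>set ps. order_of q \<le> max (m + 2) (max_order qs) \<Longrightarrow> norm (J ps) \<le> M"
    using jets_uniform_bound[OF J, of "length qs + 2" "max (m + 2) (max_order qs)"] by blast
  have c: "continuous_on {0..1} (\<lambda>u. J ((u, a, 0) # ps))" for ps by (rule continuous_on_jets_head[OF J])
  show "((\<lambda>t. lower a k J ((t, b, m) # qs)) has_vector_derivative lower a k J ((s, b, Suc m) # qs)) (at s)"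
  proof (rule has_vector_derivative_quadratic[where M = "fourier_weight k * (3 / 2 * M)"])
    fix t
    let ?E = "\<lambda>u. J ((u, a, 0) # (t, b, m) # qs) - J ((u, a, 0) # (s, b, m) # qs) - (t - s) *\<^sub>R J ((u, a, 0) # (s, b, Suc m) # qs)"
    have "norm (?E u) \<le> M * (t - s)\<^sup>2" for u
      unfolding jets_swap[OF J, of "(u, a, 0)"]
    proof (rule jets_quadratic[OF J])
      show "norm (J ((v, b, Suc (Suc m)) # (u, a, 0) # qs)) \<le> M" for v
        using max_order_ge[of _ qs] by (intro M) (auto simp: le_max_iff_disj)
    qed
    then have "norm (coef k ?E) \<le> fourier_weight k * (3 / 2 * (M * (t - s)\<^sup>2))"
      by (intro coef_norm_le continuous_intros c)
    moreover have "coef k ?E = lower a k J ((t, b, m) # qs) - lower a k J ((s, b, m) # qs) - (t - s) *\<^sub>R lower a k J ((s, b, Suc m) # qs)"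
      by (simp add: lower_def coef_diff coef_scaleR c continuous_on_diff continuous_on_scaleR continuous_on_const)
    ultimately show "norm (lower a k J ((t, b, m) # qs) - lower a k J ((s, b, m) # qs) - (t - s) *\<^sub>R lower a k J ((s, b, Suc m) # qs))
        \<le> fourier_weight k * (3 / 2 * M) * (t - s)\<^sup>2"
      by (simp add: mult.assoc)
  qed
qed

lemma jet_op_lower:
  fixes a :: 'l
  shows "jet_op (lower a l :: ('l, 'k::{real_normed_field, euclidean_space}) jet \<Rightarrow> ('l, 'k) jet)"
  unfolding jet_op_def
proof (intro conjI ballI allI impI)
  fix k :: nat and C :: real assume C: "C > 0"
  then have C2: "2 * C > 0" by simp
  have "0 \<le> 3 / (C * fourier_weight l)" using C fourier_weight_pos[of l] by simp
  with C2 lower_jet_bounded[OF _ _ C]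
  show "\<exists>k'. \<exists>C'>0. \<exists>K\<ge>0. \<forall>J\<in>jets. \<forall>B. jet_bounded k' C' B J \<longrightarrow> jet_bounded k C (K * B) (lower a l J :: ('l, 'k) jet)"
    by - (rule exI[of _ "max k 4"], rule exI[of _ "2 * C"], rule conjI, assumption, rule exI[of _ "3 / (C * fourier_weight l)"], auto)
next
  fix J J' :: "('l, 'k) jet" and c assume "J \<in> jets" "J' \<in> jets"
  then show "lower a l (J + J') = lower a l J + lower a l J'"
    by (intro ext) (simp add: lower_def coef_add continuous_on_jets_head)
next
  fix J :: "('l, 'k) jet" and c assume "J \<in> jets"
  then show "lower a l (jet_scale c J) = jet_scale c (lower a l J)"
    by (intro ext) (simp add: lower_def jet_scale_def coef_mult continuous_on_jets_head)
qed (rule lower_in_jets)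

text \<open>
  Fubini's theorem for the two inserted points.
\<close>

lemma lower_commute:
  fixes J :: "('l, 'k::euclidean_space) jet"
  assumes J: "J \<in> jets"
  shows "lower a k (lower b l J) = lower b l (lower a k J)"
proof
  fix qs
  have "coef k (\<lambda>s. coef l (\<lambda>t. J ((t, b, 0) # (s, a, 0) # qs))) = coef l (\<lambda>t. coef k (\<lambda>s. J ((t, b, 0) # (s, a, 0) # qs)))"
    by (intro coef_swap continuous_on_jets_head2[OF J] continuous_intros)
  then show "lower a k (lower b l J) qs = lower b l (lower a k J) qs"
    unfolding lower_def jets_swap[OF J, of "(_, a, 0)"] .
qed

text \<open>
  The inserted point is lifted like every other point. For the map that merges two groups of points this is
  the Leibniz rule for the annihilation operators.
\<close>

lemma lower_push:
  fixes J :: "('l::finite, 'k::euclidean_space) jet"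
  assumes J: "J \<in> jets"
  shows "lower b k (push f J) qs = (\<Sum>a\<in>f -` {b}. push f (lower a k J) qs)"
proof -
  have c: "continuous_on {0..1} (\<lambda>s. J ((s, a, 0) # ps))" for a ps by (rule continuous_on_jets_head[OF J])
  have *: "continuous_on {0..1} (\<lambda>s. push f (\<lambda>qs'. J ((s, a, 0) # qs')) qs)"
    "coef k (\<lambda>s. push f (\<lambda>qs'. J ((s, a, 0) # qs')) qs) = push f (lower a k J) qs" for a
    using coef_push[of "\<lambda>s qs'. J ((s, a, 0) # qs')" f qs k] c by (simp_all add: lower_def[abs_def])
  show ?thesis by (simp add: lower_def[of b] coef_sum *)
qed

lemma lower_tensor_Inl:
  fixes J :: "('l, 'k::{real_normed_field, euclidean_space}) jet"
  assumes J: "J \<in> jets"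
  shows "lower (Inl a) k (tensor J J') = tensor (lower a k J) J'"
  by (intro ext) (simp add: lower_def tensor_def coef_mult continuous_on_jets_head[OF J])

lemma lower_tensor_Inr:
  fixes J :: "('l, 'k::{real_normed_field, euclidean_space}) jet" and J' :: "('m, 'k) jet"
  assumes J': "J' \<in> jets"
  shows "lower (Inr b) k (tensor J J') = tensor J (lower b k J')"
  by (intro ext) (simp add: lower_def tensor_def coef_mult continuous_on_jets_head[OF J'])

section \<open>Contractions\<close>

lemma jet_scale_simps [simp]:
  "jet_scale 0 J = 0" "jet_scale 1 J = J" "jet_scale c (jet_scale c' J) = jet_scale (c * c') J"
  "jet_scale c (J + J') = jet_scale c J + jet_scale c J'" "jet_scale c 0 = 0"
  by (auto simp: jet_scale_def zero_fun_def plus_fun_def algebra_simps)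

lemma jet_op_scaled:
  fixes U :: "('l, 'k::real_normed_field) jet \<Rightarrow> ('m, 'k) jet"
  shows "jet_op U \<Longrightarrow> jet_op (\<lambda>J. jet_scale c (U J))"
proof (rule jet_op_comp[of "jet_scale c" U])
  show "jet_op (jet_scale c :: ('m, 'k) jet \<Rightarrow> ('m, 'k) jet)"
    unfolding jet_op_def
  proof (intro conjI ballI allI impI)
    fix k :: nat and C :: real assume "C > 0"
    then show "\<exists>k'. \<exists>C'>0. \<exists>K\<ge>0. \<forall>J\<in>jets. \<forall>B. jet_bounded k' C' B J \<longrightarrow> jet_bounded k C (K * B) (jet_scale c J :: ('m, 'k) jet)"
      using jet_bounded_scale[of k C]
      by - (rule exI[of _ k], rule exI[of _ C], rule conjI, assumption, rule exI[of _ "norm c"], auto)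
  qed (auto simp: jets_scale mult.commute)
qed

text \<open>
  Comparison with the inverse squares on the two halves of the integers.
\<close>

lemma summable_on_fourier_weight: "(\<lambda>k. 1 / fourier_weight k) summable_on UNIV"
proof -
  have w: "fourier_weight k \<ge> (of_int k)\<^sup>2" for k
  proof -
    have "1 * (of_int k)\<^sup>2 \<le> (4 * pi\<^sup>2) * (of_int k :: real)\<^sup>2"
      using pi_ge_two power_mono[of 2 pi 2] by (intro mult_right_mono) auto
    then show ?thesis by (simp add: fourier_weight_def)
  qed
  have "summable (\<lambda>n. norm (1 / fourier_weight (int n)))"
  proof (rule summable_comparison_test)
    show "summable (\<lambda>n. inverse ((real n)\<^sup>2))" by (rule inverse_power_summable) simp
    show "\<exists>N. \<forall>n\<ge>N. norm (norm (1 / fourier_weight (int n))) \<le> inverse ((real n)\<^sup>2)"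
    proof (intro exI[of _ 1] allI impI)
      fix n :: nat assume "1 \<le> n"
      then show "norm (norm (1 / fourier_weight (int n))) \<le> inverse ((real n)\<^sup>2)"
        using w[of "int n"] fourier_weight_pos[of "int n"] by (simp add: field_simps)
    qed
  qed
  then have nat: "(\<lambda>n. 1 / fourier_weight (int n)) summable_on UNIV"
    by (rule norm_summable_imp_summable_on)
  have "(\<lambda>k. 1 / fourier_weight k) summable_on range int"
    using nat by (subst summable_on_reindex) (auto simp: o_def)
  moreover have "(\<lambda>k. 1 / fourier_weight k) summable_on range (\<lambda>n. - int n)"
    using nat by (subst summable_on_reindex) (auto simp: o_def inj_on_def fourier_weight_def)
  ultimately have "(\<lambda>k. 1 / fourier_weight k) summable_on (range int \<union> range (\<lambda>n. - int n))"
    by (rule summable_on_union)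
  moreover have "range int \<union> range (\<lambda>n. - int n) = UNIV"
    by (auto simp: image_iff) (metis int_cases2)
  ultimately show ?thesis by simp
qed

text \<open>
  One term of the bidifferential operator, labels \<open>a\<close> and \<open>b\<close> being contracted with weight \<open>M a b\<close>.
\<close>

fun pair_op :: "('l \<Rightarrow> 'l \<Rightarrow> real) \<Rightarrow> 'l \<times> 'l \<times> int \<Rightarrow> ('l, 'k::{real_normed_field, euclidean_space}) jet \<Rightarrow> ('l, 'k) jet" where
  "pair_op M (a, b, k) J = jet_scale (of_real (fourier_weight k * M a b)) (lower a k (lower b k J))"

text \<open>
  The operator \<open>\<Pi>\<close> for an arbitrary matrix of weights. The factors that are coupled are encoded in the matrix alone.
\<close>

definition contr :: "('l \<Rightarrow> 'l \<Rightarrow> real) \<Rightarrow> ('l, 'k::{real_normed_field, euclidean_space}) jet \<Rightarrow> ('l, 'k) jet" where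
  "contr M J = jet_infsum (\<lambda>x. pair_op M x J) UNIV"

lemma jet_op_pair:
  fixes M :: "'l \<Rightarrow> 'l \<Rightarrow> real"
  shows "jet_op (pair_op M x :: ('l, 'k::{real_normed_field, euclidean_space}) jet \<Rightarrow> ('l, 'k) jet)"
proof -
  obtain a b k where x: "x = (a, b, k)" by (cases x)
  have "(pair_op M x :: ('l, 'k) jet \<Rightarrow> ('l, 'k) jet) = (\<lambda>J. jet_scale (of_real (fourier_weight k * M a b)) (lower a k (lower b k J)))"
    by (simp add: x fun_eq_iff)
  then show ?thesis
    by (simp only:) (rule jet_op_scaled[OF jet_op_comp[OF jet_op_lower jet_op_lower]])
qed

text \<open>
  Each of the two annihilation operators is of size \<open>1 / (\<lambda>k\<^sup>2 + 1)\<close>, so together with the weight the term is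
  of size \<open>1 / (\<lambda>k\<^sup>2 + 1)\<close> and the family is summable over \<open>k\<close>.
\<close>

lemma jet_op_family_pair:
  fixes M :: "'l::finite \<Rightarrow> 'l \<Rightarrow> real"
  shows "jet_op_family (pair_op M :: _ \<Rightarrow> ('l, 'k::{real_normed_field, euclidean_space}) jet \<Rightarrow> ('l, 'k) jet) UNIV"
  unfolding jet_op_family_def
proof (intro conjI ballI allI impI)
  show "jet_op (pair_op M x :: ('l, 'k) jet \<Rightarrow> ('l, 'k) jet)" for x by (rule jet_op_pair)
next
  fix k :: nat and C :: real assume C: "C > 0"
  \<comment> \<open>one bound for all weights, so that the bounds of the operators only depend on \<open>l\<close>\<close>
  define m where "m = (\<Sum>a\<in>UNIV. \<Sum>b\<in>UNIV. \<bar>M a b\<bar>)"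
  have m: "\<bar>M a b\<bar> \<le> m" for a b
  proof -
    have "\<bar>M a b\<bar> \<le> (\<Sum>b\<in>UNIV. \<bar>M a b\<bar>)" by (rule member_le_sum) auto
    also have "\<dots> \<le> m" unfolding m_def by (rule member_le_sum[of a UNIV "\<lambda>a. \<Sum>b\<in>UNIV. \<bar>M a b\<bar>"]) (auto intro: sum_nonneg)
    finally show ?thesis .
  qed
  then have m0: "m \<ge> 0" using abs_ge_zero order_trans by blast
  define D where "D = m * (9 / (2 * C\<^sup>2))"
  have D: "D \<ge> 0" using C m0 by (simp add: D_def)
  have "jet_bounded k C (case x of (a, b, l) \<Rightarrow> 1 * (1 * (D * (1 / fourier_weight l))) * B) (pair_op M x J)"
    if J: "J \<in> jets" and bd: "jet_bounded (max k 4) (4 * C) B J" for x and J :: "('l, 'k) jet" and B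
  proof -
    obtain a b l where x: "x = (a, b, l)" by (cases x)
    let ?w = "fourier_weight l"
    have "jet_bounded (max (max k 4) 4) (2 * (2 * C)) B J" using bd by (simp add: mult.assoc[symmetric])
    from lower_jet_bounded[OF J this] C
    have "jet_bounded (max k 4) (2 * C) (3 / (2 * C * ?w) * B) (lower b l J)" by simp
    from lower_jet_bounded[OF lower_in_jets[OF J] this C]
    have "jet_bounded k C (3 / (C * ?w) * (3 / (2 * C * ?w) * B)) (lower a l (lower b l J))" .
    from jet_bounded_scale[OF this, of "of_real (?w * M a b)"]
    have 1: "jet_bounded k C (norm (of_real (?w * M a b) :: 'k) * (3 / (C * ?w) * (3 / (2 * C * ?w) * B))) (pair_op M x J)"
      by (simp add: x)
    have "norm (of_real (?w * M a b) :: 'k) * (3 / (C * ?w) * (3 / (2 * C * ?w) * B)) = \<bar>M a b\<bar> * (9 / (2 * C\<^sup>2) * (1 / ?w) * B)"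
      using C fourier_weight_pos[of l] by (simp add: abs_mult field_simps power2_eq_square norm_mult)
    also have "\<dots> \<le> m * (9 / (2 * C\<^sup>2) * (1 / ?w) * B)"
      using C fourier_weight_pos[of l] jet_bounded_nonneg[OF bd] m by (intro mult_right_mono) auto
    also have "\<dots> = (case x of (a, b, l) \<Rightarrow> 1 * (1 * (D * (1 / fourier_weight l))) * B)"
      by (simp add: x D_def mult_ac)
    finally show ?thesis using 1 C by (intro jet_bounded_mono[OF 1]) auto
  qed
  moreover have "(\<lambda>(a, b, l). 1 * (1 * (D * (1 / fourier_weight l)))) summable_on (UNIV :: ('l \<times> 'l \<times> int) set)"
  proof -
    have s: "(\<lambda>l. D * (1 / fourier_weight l)) summable_on UNIV"
      by (intro summable_on_cmult_right summable_on_fourier_weight)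
    have nn: "D * (1 / fourier_weight l) \<ge> 0" for l using D fourier_weight_pos[of l] by simp
    have "(\<lambda>(b :: 'l, l). 1 * (D * (1 / fourier_weight l))) summable_on UNIV \<times> UNIV"
      by (rule summable_on_Times_mult[OF _ s]) (use nn in auto)
    then have "(\<lambda>(a :: 'l, y). 1 * (\<lambda>(b :: 'l, l). 1 * (D * (1 / fourier_weight l))) y) summable_on UNIV \<times> (UNIV \<times> UNIV)"
      by (rule summable_on_Times_mult[rotated]) (use nn in auto)
    then show ?thesis by (simp add: case_prod_unfold)
  qed
  moreover have "(case x of (a, b, l) \<Rightarrow> 1 * (1 * (D * (1 / fourier_weight l)))) \<ge> 0" for x :: "'l \<times> 'l \<times> int"
    using D fourier_weight_pos by (auto split: prod.splits simp: less_imp_le)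
  moreover have "4 * C > 0" using C by simp
  ultimately show "\<exists>k'. \<exists>C'>0. \<exists>g. g summable_on (UNIV :: ('l \<times> 'l \<times> int) set) \<and> (\<forall>x\<in>UNIV. 0 \<le> g x) \<and>
      (\<forall>x\<in>UNIV. \<forall>J\<in>jets. \<forall>B. jet_bounded k' C' B J \<longrightarrow> jet_bounded k C (g x * B) (pair_op M x J :: ('l, 'k) jet))"
    by - (rule exI[of _ "max k 4"], rule exI[of _ "4 * C"], rule conjI, assumption,
        rule exI[of _ "\<lambda>(a, b, l). 1 * (1 * (D * (1 / fourier_weight l)))"], auto)
qed

lemma jet_op_contr: "jet_op (contr M :: ('l::finite, 'k::{real_normed_field, euclidean_space}) jet \<Rightarrow> ('l, 'k) jet)"
  unfolding contr_def[abs_def] by (rule jet_op_infsum_family[OF jet_op_family_pair])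

lemma pair_op_commute:
  assumes J: "J \<in> jets"
  shows "pair_op M x (pair_op M' y J) = pair_op M' y (pair_op M x J)"
proof -
  obtain a b k where x: "x = (a, b, k)" by (cases x)
  obtain c d l where y: "y = (c, d, l)" by (cases y)
  have "lower a k (lower b k (lower c l (lower d l J))) = lower c l (lower d l (lower a k (lower b k J)))"
    using J by (simp add: lower_commute[of _ b k c l] lower_commute[of _ b k d l] lower_commute[of _ a k c l] lower_commute[of _ a k d l] lower_in_jets)
  then show ?thesis
    using J by (simp add: x y jet_op_scale[OF jet_op_lower] lower_in_jets mult.commute)
qed

lemma contr_commute:
  fixes J :: "('l::finite, 'k::{real_normed_field, euclidean_space}) jet"
  assumes J: "J \<in> jets"
  shows "contr M (contr M' J) = contr M' (contr M J)"
  unfolding contr_def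
  by (rule jet_infsum_commute[OF jet_op_family_pair jet_op_family_pair J pair_op_commute[OF J]])

text \<open>
  The contraction of a single pair of labels. The matrix enters the contraction linearly through these.
\<close>

definition pair_contr :: "'l \<Rightarrow> 'l \<Rightarrow> ('l, 'k::{real_normed_field, euclidean_space}) jet \<Rightarrow> ('l, 'k) jet" where
  "pair_contr a b J = jet_infsum (\<lambda>k. jet_scale (of_real (fourier_weight k)) (lower a k (lower b k J))) UNIV"

lemma jet_summable_pair_contr:
  fixes J :: "('l::finite, 'k::{real_normed_field, euclidean_space}) jet"
  assumes J: "J \<in> jets"
  shows "jet_summable (\<lambda>k. jet_scale (of_real (fourier_weight k)) (lower a k (lower b k J))) UNIV"
proof -
  have "jet_summable (\<lambda>x. pair_op (\<lambda>_ _. 1) x J) UNIV"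
    by (rule jet_op_family_summable[OF jet_op_family_pair J])
  then have S: "jet_summable (\<lambda>x. pair_op (\<lambda>_ _. 1) x J) (range (\<lambda>k. (a, b, k)))"
    by (rule jet_summable_subset) auto
  show ?thesis
    unfolding jet_summable_def
  proof (intro conjI ballI allI impI)
    show "jet_scale (of_real (fourier_weight k)) (lower a k (lower b k J)) \<in> jets" for k
      by (intro jets_scale lower_in_jets J)
    fix k :: nat and C :: real assume "C > 0"
    then obtain g where g: "g summable_on range (\<lambda>k. (a, b, k))"
      "\<And>x. x \<in> range (\<lambda>k. (a, b, k)) \<Longrightarrow> jet_bounded k C (g x) (pair_op (\<lambda>_ _. 1) x J)"
      by (rule jet_summable_bounds[OF S]) (rule that)
    have "(\<lambda>l. g (a, b, l)) summable_on UNIV"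
      using g(1) by (subst (asm) summable_on_reindex) (auto simp: inj_on_def o_def)
    moreover have "jet_bounded k C (g (a, b, l)) (jet_scale (of_real (fourier_weight l)) (lower a l (lower b l J)))" for l
      using g(2)[of "(a, b, l)"] by simp
    ultimately show "\<exists>g. g summable_on UNIV \<and>
       (\<forall>x\<in>UNIV. jet_bounded k C (g x) (jet_scale (of_real (fourier_weight x)) (lower a x (lower b x J))))"
      by blast
  qed
qed

lemma contr_expand:
  fixes J :: "('l::finite, 'k::{real_normed_field, euclidean_space}) jet"
  assumes J: "J \<in> jets"
  shows "contr M J qs = (\<Sum>a\<in>UNIV. \<Sum>b\<in>UNIV. of_real (M a b) * pair_contr a b J qs)"
proof -
  let ?f = "\<lambda>x. pair_op M x J qs"
  have s: "?f summable_on A" for A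
    by (rule jet_summable_pointwise(2)[OF jet_summable_subset[OF jet_op_family_summable[OF jet_op_family_pair J] subset_UNIV]])
  have s2: "(\<lambda>y. ?f (a, y)) summable_on A" for a A
    using s[of "(\<lambda>y. (a, y)) ` A"] by (subst (asm) summable_on_reindex) (auto simp: inj_on_def o_def)
  have "contr M J qs = infsum ?f (UNIV \<times> UNIV)" by (simp add: contr_def jet_infsum_def)
  also have "\<dots> = (\<Sum>a\<in>UNIV. \<Sum>\<^sub>\<infinity>y. ?f (a, y))"
    by (subst infsum_Sigma_banach[symmetric, OF s]) simp
  also have "\<dots> = (\<Sum>a\<in>UNIV. \<Sum>b\<in>UNIV. \<Sum>\<^sub>\<infinity>k. ?f (a, b, k))"
  proof (rule sum.cong[OF refl])
    fix a
    have "(\<Sum>\<^sub>\<infinity>y\<in>UNIV \<times> UNIV. ?f (a, y)) = (\<Sum>b\<in>UNIV. \<Sum>\<^sub>\<infinity>k. ?f (a, b, k))"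
      by (subst infsum_Sigma_banach[symmetric, OF s2]) simp
    then show "(\<Sum>\<^sub>\<infinity>y. ?f (a, y)) = (\<Sum>b\<in>UNIV. \<Sum>\<^sub>\<infinity>k. ?f (a, b, k))" by simp
  qed
  also have "\<dots> = (\<Sum>a\<in>UNIV. \<Sum>b\<in>UNIV. of_real (M a b) * pair_contr a b J qs)"
  proof (intro sum.cong refl)
    fix a b
    have "(\<Sum>\<^sub>\<infinity>k. ?f (a, b, k)) = (\<Sum>\<^sub>\<infinity>k. of_real (M a b) * jet_scale (of_real (fourier_weight k)) (lower a k (lower b k J)) qs)"
      by (intro infsum_cong) (simp add: jet_scale_def mult_ac)
    also have "\<dots> = of_real (M a b) * pair_contr a b J qs"
      unfolding pair_contr_def jet_infsum_def
      by (intro infsum_cmult_right jet_summable_pointwise(2) jet_summable_pair_contr J)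
    finally show "(\<Sum>\<^sub>\<infinity>k. ?f (a, b, k)) = of_real (M a b) * pair_contr a b J qs" .
  qed
  finally show ?thesis .
qed

lemma contr_add:
  fixes J :: "('l::finite, 'k::{real_normed_field, euclidean_space}) jet"
  assumes J: "J \<in> jets"
  shows "contr (\<lambda>a b. M a b + M' a b) J = contr M J + contr M' J"
  by (intro ext) (simp add: contr_expand[OF J] sum.distrib algebra_simps)

lemma contr_minus:
  fixes J :: "('l::finite, 'k::{real_normed_field, euclidean_space}) jet"
  assumes J: "J \<in> jets"
  shows "contr (\<lambda>a b. - M a b) J = - contr M J"
  by (intro ext) (simp add: contr_expand[OF J] sum_negf)

lemma pair_contr_sym:
  fixes J :: "('l::finite, 'k::{real_normed_field, euclidean_space}) jet"
  assumes J: "J \<in> jets"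
  shows "pair_contr a b J = pair_contr b a J"
  unfolding pair_contr_def lower_commute[OF J, of a _ b] ..

lemma contr_transpose:
  fixes J :: "('l::finite, 'k::{real_normed_field, euclidean_space}) jet"
  assumes J: "J \<in> jets"
  shows "contr (\<lambda>a b. M b a) J = contr M J"
proof
  fix qs
  have "contr (\<lambda>a b. M b a) J qs = (\<Sum>b\<in>UNIV. \<Sum>a\<in>UNIV. of_real (M b a) * pair_contr a b J qs)"
    unfolding contr_expand[OF J] by (rule sum.swap)
  also have "\<dots> = contr M J qs"
    unfolding contr_expand[OF J] by (intro sum.cong refl) (simp add: pair_contr_sym[OF J, of a b for a b])
  finally show "contr (\<lambda>a b. M b a) J qs = contr M J qs" .
qed

lemma has_sum_finite_sum:
  fixes f :: "'i \<Rightarrow> 'j \<Rightarrow> 'k::topological_comm_monoid_add"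
  assumes "finite X" "\<And>x. x \<in> X \<Longrightarrow> (f x has_sum S x) A"
  shows "((\<lambda>k. \<Sum>x\<in>X. f x k) has_sum (\<Sum>x\<in>X. S x)) A"
  using assms by (induction X) (auto intro: has_sum_add)

lemma pair_contr_push:
  fixes J :: "('l::finite, 'k::{real_normed_field, euclidean_space}) jet"
  assumes J: "J \<in> jets"
  shows "pair_contr b b' (push f J) qs = (\<Sum>a\<in>f -` {b}. \<Sum>a'\<in>f -` {b'}. push f (pair_contr a a' J) qs)"
proof -
  have l: "lower b k (push f J) = (\<Sum>a\<in>f -` {b}. push f (lower a k J))" if "J \<in> jets" for b k and J :: "('l, 'k) jet"
    using lower_push[OF that] by (intro ext) (simp add: sum_fun_apply)
  have "lower b k (lower b' k (push f J)) = (\<Sum>a'\<in>f -` {b'}. \<Sum>a\<in>f -` {b}. push f (lower a k (lower a' k J)))" for k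
    by (simp add: l J jet_op_sum[OF jet_op_lower] push_in_jets lower_in_jets)
  then have eq: "lower b k (lower b' k (push f J)) = (\<Sum>a\<in>f -` {b}. \<Sum>a'\<in>f -` {b'}. push f (lower a k (lower a' k J)))" for k
    by (simp add: sum.swap[of _ "f -` {b}"])
  let ?g = "\<lambda>a a' k. push f (jet_scale (of_real (fourier_weight k)) (lower a k (lower a' k J)))"
  have S: "jet_summable (?g a a') UNIV" for a a'
    by (rule jet_summable_op[OF jet_op_push jet_summable_pair_contr[OF J]])
  have P: "push f (pair_contr a a' J) qs = (\<Sum>\<^sub>\<infinity>k. ?g a a' k qs)" for a a'
    unfolding pair_contr_def jet_op_infsum[OF jet_op_push jet_summable_pair_contr[OF J]] by (simp add: jet_infsum_def)
  have "pair_contr b b' (push f J) qs = (\<Sum>\<^sub>\<infinity>k. \<Sum>a\<in>f -` {b}. \<Sum>a'\<in>f -` {b'}. ?g a a' k qs)"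
    unfolding pair_contr_def jet_infsum_def eq
    by (intro infsum_cong) (simp add: jet_scale_def sum_fun_apply sum_distrib_left push_mult)
  also have "\<dots> = (\<Sum>a\<in>f -` {b}. \<Sum>a'\<in>f -` {b'}. \<Sum>\<^sub>\<infinity>k. ?g a a' k qs)"
    by (intro infsumI has_sum_finite_sum has_sum_infsum jet_summable_pointwise(2)[OF S]) auto
  finally show ?thesis by (simp add: P)
qed

text \<open>
  A contraction of merged points is the sum of the contractions of all pairs of points that lie over them.
\<close>

lemma contr_push:
  fixes J :: "('l::finite, 'k::{real_normed_field, euclidean_space}) jet" and f :: "'l \<Rightarrow> 'm::finite"
  assumes J: "J \<in> jets"
  shows "contr M (push f J) = push f (contr (\<lambda>a b. M (f a) (f b)) J)"
proof
  fix qs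
  \<comment> \<open>the fibres of \<open>f\<close> partition the labels\<close>
  have fib: "(\<Sum>b\<in>UNIV. \<Sum>a\<in>f -` {b}. g b a) = (\<Sum>a\<in>UNIV. g (f a) a)" for g :: "'m \<Rightarrow> 'l \<Rightarrow> 'k"
  proof -
    have "(\<Sum>a\<in>(\<Union>b\<in>UNIV. f -` {b}). g (f a) a) = (\<Sum>b\<in>UNIV. \<Sum>a\<in>f -` {b}. g (f a) a)"
      by (rule sum.UNION_disjoint) auto
    moreover have "(\<Union>b\<in>UNIV. f -` {b}) = UNIV" by auto
    ultimately show ?thesis by simp
  qed
  let ?p = "\<lambda>a a'. push f (pair_contr a a' J) qs"
  have "contr M (push f J) qs = (\<Sum>b\<in>UNIV. \<Sum>b'\<in>UNIV. of_real (M b b') * (\<Sum>a\<in>f -` {b}. \<Sum>a'\<in>f -` {b'}. ?p a a'))"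
    by (simp add: contr_expand[OF push_in_jets[OF J]] pair_contr_push[OF J])
  also have "\<dots> = (\<Sum>b\<in>UNIV. \<Sum>a\<in>f -` {b}. \<Sum>b'\<in>UNIV. \<Sum>a'\<in>f -` {b'}. of_real (M b b') * ?p a a')"
    by (simp add: sum_distrib_left) (intro sum.cong refl sum.swap)
  also have "\<dots> = (\<Sum>a\<in>UNIV. \<Sum>a'\<in>UNIV. of_real (M (f a) (f a')) * ?p a a')"
    unfolding fib ..
  also have "\<dots> = push f (\<lambda>qs. \<Sum>a\<in>UNIV. \<Sum>a'\<in>UNIV. of_real (M (f a) (f a')) * pair_contr a a' J qs) qs"
    by (simp add: push_sum push_mult)
  finally show "contr M (push f J) qs = push f (contr (\<lambda>a b. M (f a) (f b)) J) qs"
    by (simp add: contr_expand[OF J, abs_def])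
qed

lemma contr_funpow_push:
  fixes J :: "('l::finite, 'k::{real_normed_field, euclidean_space}) jet" and f :: "'l \<Rightarrow> 'm::finite"
  assumes J: "J \<in> jets"
  shows "(contr M ^^ r) (push f J) = push f ((contr (\<lambda>a b. M (f a) (f b)) ^^ r) J)"
  by (induction r) (simp_all add: contr_push jet_op_jets[OF jet_op_funpow[OF jet_op_contr] J])

text \<open>
  A contraction inside the first factor of a tensor product.
\<close>

fun ext_left :: "('l \<Rightarrow> 'l \<Rightarrow> real) \<Rightarrow> 'l + 'm \<Rightarrow> 'l + 'm \<Rightarrow> real" where
  "ext_left M (Inl a) (Inl b) = M a b"
| "ext_left M _ _ = 0"

fun ext_right :: "('m \<Rightarrow> 'm \<Rightarrow> real) \<Rightarrow> 'l + 'm \<Rightarrow> 'l + 'm \<Rightarrow> real" where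
  "ext_right M (Inr a) (Inr b) = M a b"
| "ext_right M _ _ = 0"

lemma sum_UNIV_sum:
  fixes g :: "'l::finite + 'm::finite \<Rightarrow> 'k::comm_monoid_add"
  shows "sum g UNIV = (\<Sum>a\<in>UNIV. g (Inl a)) + (\<Sum>b\<in>UNIV. g (Inr b))"
  using sum.Plus[of UNIV UNIV g] by (simp add: UNIV_Plus_UNIV o_def)

lemma contr_tensor_left:
  fixes J :: "('l::finite, 'k::{real_normed_field, euclidean_space}) jet" and J' :: "('m::finite, 'k) jet"
  assumes J: "J \<in> jets" and J': "J' \<in> jets"
  shows "contr (ext_left M) (tensor J J') = tensor (contr M J) J'"
proof
  fix qs
  have "pair_contr (Inl a) (Inl b) (tensor J J') qs = pair_contr a b J (lefts qs) * J' (rights qs)" for a b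
    unfolding pair_contr_def jet_infsum_def
    using infsum_cmult_left[OF jet_summable_pointwise(2)[OF jet_summable_pair_contr[OF J, of a b]], of "lefts qs" "J' (rights qs)"]
    by (simp add: lower_tensor_Inl J lower_in_jets jet_scale_def tensor_def mult.assoc)
  then show "contr (ext_left M) (tensor J J') qs = tensor (contr M J) J' qs"
    by (simp add: contr_expand tensor_in_jets J J' sum_UNIV_sum tensor_def sum_distrib_right mult.assoc)
qed

lemma contr_tensor_right:
  fixes J :: "('l::finite, 'k::{real_normed_field, euclidean_space}) jet" and J' :: "('m::finite, 'k) jet"
  assumes J: "J \<in> jets" and J': "J' \<in> jets"
  shows "contr (ext_right M) (tensor J J') = tensor J (contr M J')"
proof
  fix qs
  have "pair_contr (Inr a) (Inr b) (tensor J J') qs = J (lefts qs) * pair_contr a b J' (rights qs)" for a b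
    unfolding pair_contr_def jet_infsum_def
    using infsum_cmult_right[OF jet_summable_pointwise(2)[OF jet_summable_pair_contr[OF J', of a b]], of "J (lefts qs)" "rights qs"]
    by (simp add: lower_tensor_Inr J' lower_in_jets jet_scale_def tensor_def mult_ac)
  then show "contr (ext_right M) (tensor J J') qs = tensor J (contr M J') qs"
    by (simp add: contr_expand tensor_in_jets J J' sum_UNIV_sum tensor_def sum_distrib_left mult_ac)
qed

lemma contr_funpow_tensor_left:
  fixes J :: "('l::finite, 'k::{real_normed_field, euclidean_space}) jet" and J' :: "('m::finite, 'k) jet"
  assumes J: "J \<in> jets" and J': "J' \<in> jets"
  shows "tensor ((contr M ^^ r) J) J' = (contr (ext_left M) ^^ r) (tensor J J')"
  by (induction r) (simp_all add: contr_tensor_left J' jet_op_jets[OF jet_op_funpow[OF jet_op_contr] J] flip: contr_tensor_left)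

lemma contr_funpow_tensor_right:
  fixes J :: "('l::finite, 'k::{real_normed_field, euclidean_space}) jet" and J' :: "('m::finite, 'k) jet"
  assumes J: "J \<in> jets" and J': "J' \<in> jets"
  shows "tensor J ((contr M ^^ r) J') = (contr (ext_right M) ^^ r) (tensor J J')"
  by (induction r) (simp_all add: J jet_op_jets[OF jet_op_funpow[OF jet_op_contr] J'] flip: contr_tensor_right)

text \<open>
  The contractions for \<open>M\<close> and \<open>M'\<close> commute and add up to the one for \<open>M + M'\<close>, so this is the binomial theorem,
  by the usual induction with Pascal's rule.
\<close>

lemma contr_binomial:
  fixes J :: "('l::finite, 'k::{real_normed_field, euclidean_space}) jet"
  assumes J: "J \<in> jets"
  shows "(contr (\<lambda>a b. M a b + M' a b) ^^ N) J qs =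
    (\<Sum>r\<le>N. of_nat (N choose r) * (contr M ^^ r) ((contr M' ^^ (N - r)) J) qs)"
proof -
  note cj = jet_op_jets[OF jet_op_funpow[OF jet_op_contr]]
  define x where "x N r = (contr M ^^ r) ((contr M' ^^ (N - r)) J)" for N r
  have xj: "x N r \<in> jets" for N r unfolding x_def by (intro cj J)
  have x1: "contr M (x N r) = x (Suc N) (Suc r)" for N r by (simp add: x_def)
  have comm: "contr M' ((contr M ^^ r) J) = (contr M ^^ r) (contr M' J)" if "J \<in> jets" for r and J :: "('l, 'k) jet"
    by (induction r) (simp_all add: contr_commute[of _ M' M] cj that)
  have x2: "contr M' (x N r) = x (Suc N) r" if "r \<le> N" for N r
    using that by (simp add: x_def comm cj J Suc_diff_le)
  have "(contr (\<lambda>a b. M a b + M' a b) ^^ N) J = (\<Sum>r\<le>N. jet_scale (of_nat (N choose r)) (x N r))"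
  proof (induction N)
    case 0
    then show ?case by (simp add: x_def)
  next
    case (Suc N)
    have "(contr (\<lambda>a b. M a b + M' a b) ^^ Suc N) J = (\<Sum>r\<le>N. jet_scale (of_nat (N choose r)) (contr (\<lambda>a b. M a b + M' a b) (x N r)))"
      by (simp add: Suc jet_op_sum[OF jet_op_contr] jet_op_scale[OF jet_op_contr] jets_scale xj)
    also have "\<dots> = (\<Sum>r\<le>N. jet_scale (of_nat (N choose r)) (x (Suc N) (Suc r))) + (\<Sum>r\<le>N. jet_scale (of_nat (N choose r)) (x (Suc N) r))"
      by (simp add: contr_add xj x1 x2 sum.distrib)
    also have "(\<Sum>r\<le>N. jet_scale (of_nat (N choose r)) (x (Suc N) r)) =
        x (Suc N) 0 + (\<Sum>r\<le>N. jet_scale (of_nat (N choose Suc r)) (x (Suc N) (Suc r)))"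
    proof -
      have "(\<Sum>r\<le>N. jet_scale (of_nat (N choose r)) (x (Suc N) r)) = (\<Sum>r\<le>Suc N. jet_scale (of_nat (N choose r)) (x (Suc N) r))"
        by (simp add: binomial_eq_0)
      also have "\<dots> = x (Suc N) 0 + (\<Sum>r\<le>N. jet_scale (of_nat (N choose Suc r)) (x (Suc N) (Suc r)))"
        by (subst sum.atMost_Suc_shift) simp
      finally show ?thesis .
    qed
    also have "(\<Sum>r\<le>N. jet_scale (of_nat (N choose r)) (x (Suc N) (Suc r))) + (x (Suc N) 0 + (\<Sum>r\<le>N. jet_scale (of_nat (N choose Suc r)) (x (Suc N) (Suc r))))
        = x (Suc N) 0 + (\<Sum>r\<le>N. jet_scale (of_nat (Suc N choose Suc r)) (x (Suc N) (Suc r)))"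
      by (simp add: jet_scale_def sum.distrib plus_fun_def sum_fun_apply algebra_simps)
    also have "\<dots> = (\<Sum>r\<le>Suc N. jet_scale (of_nat (Suc N choose r)) (x (Suc N) r))"
      by (subst sum.atMost_Suc_shift) simp
    finally show ?case .
  qed
  then show ?thesis by (simp add: x_def sum_fun_apply jet_scale_def)
qed

section \<open>The star-product of jets\<close>

text \<open>
  A contraction between the two factors of a tensor product.
\<close>

fun cross :: "('l \<Rightarrow> 'm \<Rightarrow> real) \<Rightarrow> 'l + 'm \<Rightarrow> 'l + 'm \<Rightarrow> real" where
  "cross M (Inl a) (Inr b) = M a b"
| "cross M _ _ = 0"

abbreviation merge :: "'l + 'l \<Rightarrow> 'l" where "merge \<equiv> case_sum id id"

definition star_jet :: "('l \<Rightarrow> 'l \<Rightarrow> real) \<Rightarrow> nat \<Rightarrow> ('l::finite, 'k::{real_normed_field, euclidean_space}) jet \<Rightarrow> ('l, 'k) jet \<Rightarrow> ('l, 'k) jet" where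
  "star_jet M r J J' = push merge ((contr (cross M) ^^ r) (tensor J J'))"

lemma star_jet_in_jets: "J \<in> jets \<Longrightarrow> J' \<in> jets \<Longrightarrow> star_jet M r J J' \<in> jets"
  unfolding star_jet_def by (intro push_in_jets jet_op_jets[OF jet_op_funpow[OF jet_op_contr]] tensor_in_jets)

text \<open>
  Every merging is moved to the front. What remains are contractions of the three-fold tensor product: the
  inner ones between the first two factors, the outer ones between these and the third.
\<close>

lemma star_jet_left:
  assumes F: "F \<in> jets" and G: "G \<in> jets" and H: "H \<in> jets"
  shows "star_jet M r (star_jet M a F G) H = push (merge \<circ> map_sum merge id)
     ((contr (\<lambda>x y. cross M (map_sum merge id x) (map_sum merge id y)) ^^ r)
       ((contr (ext_left (cross M)) ^^ a) (tensor (tensor F G) H)))"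
  unfolding star_jet_def tensor_push_left
  by (subst contr_funpow_push)
     (simp_all add: push_push contr_funpow_tensor_left tensor_in_jets F G H jet_op_jets[OF jet_op_funpow[OF jet_op_contr]])

lemma star_jet_right:
  assumes F: "F \<in> jets" and G: "G \<in> jets" and H: "H \<in> jets"
  shows "star_jet M r F (star_jet M a G H) = push (merge \<circ> map_sum id merge)
     ((contr (\<lambda>x y. cross M (map_sum id merge x) (map_sum id merge y)) ^^ r)
       ((contr (ext_right (cross M)) ^^ a) (tensor F (tensor G H))))"
  unfolding star_jet_def tensor_push_right
  by (subst contr_funpow_push)
     (simp_all add: push_push contr_funpow_tensor_right tensor_in_jets F G H jet_op_jets[OF jet_op_funpow[OF jet_op_contr]])

text \<open>
  On either side the weights of the inner and the outer contractions add up to the same matrix, which couples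
  every pair of the three factors in increasing order. The two bracketings only differ by the relabelling
  \<open>sum_assoc\<close>.
\<close>

theorem star_jet_assoc:
  fixes F :: "('l::finite, 'k::{real_normed_field, euclidean_space}) jet"
  assumes F: "F \<in> jets" and G: "G \<in> jets" and H: "H \<in> jets"
  shows "(\<Sum>r\<le>N. of_nat (N choose r) * star_jet M r F (star_jet M (N - r) G H) qs) =
         (\<Sum>r\<le>N. of_nat (N choose r) * star_jet M r (star_jet M (N - r) F G) H qs)"
proof -
  let ?R = "\<lambda>x y. cross M (map_sum id merge x) (map_sum id merge y) + ext_right (cross M) x y"
  let ?L = "\<lambda>x y. cross M (map_sum merge id x) (map_sum merge id y) + ext_left (cross M) x y"
  \<comment> \<open>both sides couple a label of an earlier factor to a label of a later one\<close>
  have L: "?R (sum_assoc x) (sum_assoc y) = ?L x y" for x y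
    by (cases x rule: sum_assoc.cases; cases y rule: sum_assoc.cases) auto
  have assoc: "(merge \<circ> map_sum id merge) \<circ> sum_assoc = (merge \<circ> map_sum merge id :: ('l + 'l) + 'l \<Rightarrow> 'l)"
  proof
    show "((merge \<circ> map_sum id merge) \<circ> sum_assoc) x = (merge \<circ> map_sum merge id) x" for x :: "('l + 'l) + 'l"
      by (cases x rule: sum_assoc.cases) auto
  qed
  have "(\<Sum>r\<le>N. of_nat (N choose r) * star_jet M r F (star_jet M (N - r) G H) qs)
      = push (merge \<circ> map_sum id merge) ((contr ?R ^^ N) (tensor F (tensor G H))) qs"
    unfolding star_jet_right[OF F G H]
    by (simp add: contr_binomial[OF tensor_in_jets[OF F tensor_in_jets[OF G H]], abs_def] push_sum push_mult)
  also have "\<dots> = push (merge \<circ> map_sum id merge) (push sum_assoc ((contr ?L ^^ N) (tensor (tensor F G) H))) qs"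
    unfolding tensor_assoc[symmetric] contr_funpow_push[OF tensor_in_jets[OF tensor_in_jets[OF F G] H]] L ..
  also have "\<dots> = push (merge \<circ> map_sum merge id) ((contr ?L ^^ N) (tensor (tensor F G) H)) qs"
    unfolding push_push assoc ..
  also have "\<dots> = (\<Sum>r\<le>N. of_nat (N choose r) * star_jet M r (star_jet M (N - r) F G) H qs)"
    unfolding star_jet_left[OF F G H]
    by (simp add: contr_binomial[OF tensor_in_jets[OF tensor_in_jets[OF F G] H], abs_def] push_sum push_mult)
  finally show ?thesis .
qed

text \<open>
  Exchanging the factors turns the matrix of weights into minus its transpose because \<open>M\<close> is antisymmetric,
  and a contraction is unchanged under transposition because annihilation operators commute.
\<close>

lemma star_jet_antisymmetric:
  fixes F :: "('l::finite, 'k::{real_normed_field, euclidean_space}) jet"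
  assumes F: "F \<in> jets" and G: "G \<in> jets" and M: "\<And>a b. M a b = - M b a"
  shows "star_jet M 1 G F = - star_jet M 1 F G"
proof -
  have m: "merge \<circ> sum_swap = (merge :: 'l + 'l \<Rightarrow> 'l)"
  proof
    show "(merge \<circ> sum_swap) x = merge x" for x :: "'l + 'l" by (cases x) auto
  qed
  have c: "cross M (sum_swap x) (sum_swap y) = - cross M y x" for x y :: "'l + 'l"
    by (cases x; cases y; simp; rule M)
  have "star_jet M 1 G F = push merge (push sum_swap (contr (\<lambda>x y. - cross M y x) (tensor F G)))"
    unfolding star_jet_def tensor_swap[of F G, symmetric]
    by (simp add: contr_push tensor_in_jets F G c)
  also have "\<dots> = push merge (- contr (cross M) (tensor F G))"
    unfolding push_push m contr_minus[OF tensor_in_jets[OF F G]] contr_transpose[OF tensor_in_jets[OF F G], of "cross M"] ..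
  also have "- contr (cross M) (tensor F G) = (\<lambda>qs. - 1 * contr (cross M) (tensor F G) qs)" by auto
  finally have h: "star_jet M 1 G F = push merge (\<lambda>qs. - 1 * contr (cross M) (tensor F G) qs)" .
  show ?thesis
  proof
    show "star_jet M 1 G F qs = (- star_jet M 1 F G) qs" for qs
      unfolding h push_mult by (simp add: star_jet_def)
  qed
qed

section \<open>The Wick product of chaoses\<close>

fun splits :: "'a list \<Rightarrow> ('a list \<times> 'a list) list" where
  "splits [] = [([], [])]"
| "splits (x # xs) = map (\<lambda>(us, vs). (x # us, vs)) (splits xs) @ map (\<lambda>(us, vs). (us, x # vs)) (splits xs)"

lemma splits_map: "splits (map g xs) = map (\<lambda>(us, vs). (map g us, map g vs)) (splits xs)"
  by (induction xs) (auto simp: case_prod_unfold)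

lemma splits_mset: "(us, vs) \<in> set (splits xs) \<Longrightarrow> mset (us @ vs) = mset xs"
  by (induction xs arbitrary: us vs) auto

lemma sum_list_splits_length:
  fixes f :: "nat \<Rightarrow> 'k::comm_semiring_1"
  shows "(\<Sum>(us, vs)\<leftarrow>splits xs. f (length us)) = (\<Sum>n\<le>length xs. of_nat (length xs choose n) * f n)"
proof (induction xs arbitrary: f)
  case (Cons x xs)
  let ?N = "length xs"
  have "(\<Sum>(us, vs)\<leftarrow>splits (x # xs). f (length us)) = (\<Sum>n\<le>?N. of_nat (?N choose n) * f (Suc n)) + (\<Sum>n\<le>?N. of_nat (?N choose n) * f n)"
    using Cons[of f] Cons[of "\<lambda>n. f (Suc n)"] by (simp add: case_prod_unfold o_def)
  also have "(\<Sum>n\<le>?N. of_nat (?N choose n) * f n) = (\<Sum>n\<le>Suc ?N. of_nat (?N choose n) * f n)"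
    by (simp add: binomial_eq_0)
  also have "\<dots> = f 0 + (\<Sum>n\<le>?N. of_nat (?N choose Suc n) * f (Suc n))"
    by (subst sum.atMost_Suc_shift) simp
  also have "(\<Sum>n\<le>?N. of_nat (?N choose n) * f (Suc n)) + (f 0 + (\<Sum>n\<le>?N. of_nat (?N choose Suc n) * f (Suc n)))
     = f 0 + (\<Sum>n\<le>?N. of_nat (Suc ?N choose Suc n) * f (Suc n))"
    by (simp add: sum.distrib algebra_simps)
  also have "\<dots> = (\<Sum>n\<le>Suc ?N. of_nat (Suc ?N choose n) * f n)"
    by (subst sum.atMost_Suc_shift) simp
  finally show ?case by simp
qed simp

lemma push_merge_tensor:
  fixes J J' :: "('l::finite, 'k::comm_semiring_1) jet"
  shows "push merge (tensor J J') qs = (\<Sum>(us, vs)\<leftarrow>splits qs. J us * J' vs)"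
proof (induction qs arbitrary: J J')
  case Nil
  then show ?case by (simp add: tensor_def)
next
  case (Cons q qs)
  obtain s b m where q: "q = (s, b, m)" by (cases q)
  have "merge x = b \<longleftrightarrow> x = Inl b \<or> x = Inr b" for x :: "'l + 'l" by (cases x) auto
  then have v: "merge -` {b} = {Inl b, Inr b}" by auto
  have "push merge (tensor J J') (q # qs) = push merge (tensor (\<lambda>qs'. J (q # qs')) J') qs + push merge (tensor J (\<lambda>qs'. J' (q # qs'))) qs"
    unfolding q tensor_Inl tensor_Inr push.simps v by simp
  then show ?case by (simp only: Cons) (simp add: case_prod_unfold o_def)
qed

lemma sum_list_sum_swap:
  "(\<Sum>x\<in>A. \<Sum>y\<leftarrow>ys. f x y) = (\<Sum>y\<leftarrow>ys. \<Sum>x\<in>A. (f x y :: 'k::comm_monoid_add))"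
  by (induction ys) (auto simp: sum.distrib)

text \<open>
  Averaging over all permutations does not change the left-hand side. For a fixed split with a first part of
  size \<open>n\<close>, a permutation puts this part in front, so after averaging the split only matters through \<open>n\<close>; there
  are \<open>N choose n\<close> such splits.
\<close>

lemma fact_times_push_merge_tensor:
  fixes J J' :: "('l::finite, 'k::real_normed_field) jet"
  assumes J: "J \<in> jets" and J': "J' \<in> jets"
  shows "fact (length qs) * push merge (tensor J J') qs = (\<Sum>n\<le>length qs. of_nat (length qs choose n) *
    (\<Sum>\<sigma>\<in>{\<sigma>. \<sigma> permutes {..<length qs}}. J (take n (permute_list \<sigma> qs)) * J' (drop n (permute_list \<sigma> qs))))"
proof -
  let ?N = "length qs" and ?P = "{\<sigma>. \<sigma> permutes {..<length qs}}"
  define W where "W n = (\<Sum>\<sigma>\<in>?P. J (take n (permute_list \<sigma> qs)) * J' (drop n (permute_list \<sigma> qs)))" for n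
  have plist: "permute_list \<sigma> qs = map (\<lambda>i. qs ! \<sigma> i) [0..<?N]" for \<sigma> by (simp add: permute_list_def)
  have "fact ?N * push merge (tensor J J') qs = (\<Sum>\<sigma>\<in>?P. push merge (tensor J J') qs)"
    by (simp add: card_permutations)
  also have "\<dots> = (\<Sum>\<sigma>\<in>?P. push merge (tensor J J') (permute_list \<sigma> qs))"
    by (intro sum.cong refl jets_perm[OF push_in_jets[OF tensor_in_jets[OF J J']]]) simp
  also have "\<dots> = (\<Sum>\<sigma>\<in>?P. \<Sum>(us, vs)\<leftarrow>splits [0..<?N]. J (map (\<lambda>i. qs ! \<sigma> i) us) * J' (map (\<lambda>i. qs ! \<sigma> i) vs))"
    unfolding push_merge_tensor plist splits_map by (simp add: case_prod_unfold o_def)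
  also have "\<dots> = (\<Sum>(us, vs)\<leftarrow>splits [0..<?N]. \<Sum>\<sigma>\<in>?P. J (map (\<lambda>i. qs ! \<sigma> i) us) * J' (map (\<lambda>i. qs ! \<sigma> i) vs))"
    unfolding case_prod_unfold by (rule sum_list_sum_swap)
  also have "\<dots> = (\<Sum>(us, vs)\<leftarrow>splits [0..<?N]. W (length us))"
  proof (intro arg_cong[where f = sum_list] map_cong refl, clarify)
    fix us vs assume "(us, vs) \<in> set (splits [0..<?N])"
    then have "mset (us @ vs) = mset [0..<?N]" by (rule splits_mset)
    \<comment> \<open>\<open>\<tau>\<close> is chosen on indices, hence independently of the permutation \<open>\<sigma>\<close> of the points\<close>
    then obtain \<tau> where \<tau>: "\<tau> permutes {..<length [0..<?N]}" "permute_list \<tau> [0..<?N] = us @ vs"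
      using mset_eq_permutation by blast
    then have \<tau>': "\<tau> permutes {..<?N}" by simp
    have "permute_list \<tau> [0..<?N] = map \<tau> [0..<?N]"
      using permutes_in_image[OF \<tau>'] by (intro nth_equalityI) (auto simp: permute_list_def)
    then have \<tau>_eq: "us @ vs = map \<tau> [0..<?N]" using \<tau>(2) by simp
    have "permute_list (\<sigma> \<circ> \<tau>) qs = map (\<lambda>i. qs ! \<sigma> i) (us @ vs)" for \<sigma>
      unfolding \<tau>_eq plist by simp
    then have *: "map (\<lambda>i. qs ! \<sigma> i) us = take (length us) (permute_list (\<sigma> \<circ> \<tau>) qs)"
      "map (\<lambda>i. qs ! \<sigma> i) vs = drop (length us) (permute_list (\<sigma> \<circ> \<tau>) qs)" for \<sigma>
      by simp_all
    show "(\<Sum>\<sigma>\<in>?P. J (map (\<lambda>i. qs ! \<sigma> i) us) * J' (map (\<lambda>i. qs ! \<sigma> i) vs)) = W (length us)"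
      unfolding W_def * by (rule sum_permutations_compose_right[OF \<tau>', symmetric])
  qed
  also have "\<dots> = (\<Sum>n\<le>?N. of_nat (?N choose n) * W n)"
    using sum_list_splits_length[of W "[0..<?N]"] by simp
  finally show ?thesis by (simp add: W_def)
qed

text \<open>
  The factor \<open>N choose n\<close> of the preceding lemma is the quotient of the factorials that distinguish jets from
  chaoses.
\<close>

lemma wick_chaos_of:
  fixes J J' :: "('l::finite, 'k::real_normed_field) jet"
  assumes J: "J \<in> jets" and J': "J' \<in> jets"
  shows "wick (chaos_of J) (chaos_of J') = chaos_of (push merge (tensor J J'))"
proof
  fix ps :: "(real \<times> 'l) list"
  let ?z = "\<lambda>(s, i). (s, i, 0::nat)"
  let ?N = "length ps" and ?P = "{\<sigma>. \<sigma> permutes {..<length ps}}"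
  let ?W = "\<lambda>n. \<Sum>\<sigma>\<in>?P. J (take n (permute_list \<sigma> (map ?z ps))) * J' (drop n (permute_list \<sigma> (map ?z ps)))"
  have "sym_tensor n (?N - n) (chaos_of J) (chaos_of J') ps = of_nat (?N choose n) * ?W n / (fact ?N * fact ?N)" if n: "n \<le> ?N" for n
  proof -
    have "chaos_of J (take n (permute_list \<sigma> ps)) * chaos_of J' (drop n (permute_list \<sigma> ps)) =
       J (take n (permute_list \<sigma> (map ?z ps))) * J' (drop n (permute_list \<sigma> (map ?z ps))) / (fact n * fact (?N - n))"
      if "\<sigma> \<in> ?P" for \<sigma>
      using that n by (simp add: chaos_of_def permute_list_map take_map drop_map min_absorb2)
    then have "sym_tensor n (?N - n) (chaos_of J) (chaos_of J') ps = (\<Sum>\<sigma>\<in>?P. J (take n (permute_list \<sigma> (map ?z ps))) * J' (drop n (permute_list \<sigma> (map ?z ps))) / (fact n * fact (?N - n))) / fact ?N"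
      using n by (simp add: sym_tensor_def)
    also have "\<dots> = ?W n / (fact n * fact (?N - n)) / fact ?N" by (simp only: sum_divide_distrib)
    also have "\<dots> = (fact ?N / (fact n * fact (?N - n))) * ?W n / (fact ?N * fact ?N)" by (simp add: field_simps)
    also have "fact ?N / (fact n * fact (?N - n)) = (of_nat (?N choose n) :: 'k)"
      using n by (simp add: binomial_fact)
    finally show ?thesis .
  qed
  then have "wick (chaos_of J) (chaos_of J') ps = (\<Sum>n\<le>?N. of_nat (?N choose n) * ?W n / (fact ?N * fact ?N))"
    unfolding wick_def by (intro sum.cong) auto
  also have "\<dots> = (\<Sum>n\<le>?N. of_nat (?N choose n) * ?W n) / (fact ?N * fact ?N)"
    by (simp only: sum_divide_distrib)
  also have "(\<Sum>n\<le>?N. of_nat (?N choose n) * ?W n) = fact ?N * push merge (tensor J J') (map ?z ps)"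
    using fact_times_push_merge_tensor[OF J J', of "map ?z ps"] by simp
  finally show "wick (chaos_of J) (chaos_of J') ps = chaos_of (push merge (tensor J J')) ps"
    by (simp add: chaos_of_def[of "push merge (tensor J J')"])
qed

section \<open>The annihilation operators on chaoses\<close>

lemma fourier_basis_has_derivative:
  "(fourier_basis a k has_vector_derivative mode_deriv k s *\<^sub>R axis a 1) (at s)"
proof -
  have "((\<lambda>s. mode k s *\<^sub>R axis a 1) has_vector_derivative (mode k s *\<^sub>R 0 + mode_deriv k s *\<^sub>R axis a 1)) (at s)"
    by (intro has_vector_derivative_scaleR mode_has_derivative has_vector_derivative_const)
  then show ?thesis by (simp add: fourier_basis_mode[abs_def])
qed

text \<open>
  One integration by parts moves the derivative in the inner product of \<open>H\<close> from \<open>f\<close> to the mode.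
\<close>

lemma integral_mode_first_order:
  fixes f :: "real \<Rightarrow> 'k::euclidean_space"
  assumes f: "\<And>s. (f has_vector_derivative f' s) (at s)" and cont: "continuous_on {0..1} f'" and per: "f 1 = f 0"
  shows "integral {0..1} (\<lambda>s. mode k s *\<^sub>R f s + mode_deriv k s *\<^sub>R f' s) = coef k f"
proof -
  let ?w = "fourier_weight k"
  let ?g = "\<lambda>s. mode_deriv k s *\<^sub>R f s"
  have I: "((\<lambda>s. mode_deriv k s *\<^sub>R f' s + ((1 - ?w) * mode k s) *\<^sub>R f s) has_integral ?g 1 - ?g 0) {0..1}"
  proof (rule fundamental_theorem_of_calculus)
    show "(?g has_vector_derivative mode_deriv k s *\<^sub>R f' s + ((1 - ?w) * mode k s) *\<^sub>R f s) (at s within {0..1})" for s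
      by (rule has_vector_derivative_at_within) (intro has_vector_derivative_scaleR f mode_deriv_has_derivative)
  qed simp
  have cf: "continuous_on {0..1} f"
    by (rule continuous_at_imp_continuous_on) (auto intro: has_vector_derivative_continuous f)
  have "((\<lambda>s. ?w *\<^sub>R (mode k s *\<^sub>R f s)) has_integral ?w *\<^sub>R integral {0..1} (\<lambda>s. mode k s *\<^sub>R f s)) {0..1}"
    by (intro has_integral_cmul integrable_integral mode_integrable cf)
  from has_integral_add[OF this I]
  have "((\<lambda>s. mode k s *\<^sub>R f s + mode_deriv k s *\<^sub>R f' s) has_integral coef k f) {0..1}"
    by (simp add: per mode_periodic coef_def algebra_simps)
  then show ?thesis by (rule integral_unique)
qed

text \<open>
  All \<open>n + 1\<close> slots contribute the same integral, and \<open>(n + 1) / (n + 1)! = 1 / n!\<close>.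
\<close>

lemma annih_chaos_of:
  fixes J :: "('d::finite, 'k::{real_normed_field, euclidean_space}) jet"
  assumes J: "J \<in> jets"
  shows "annih (fourier_basis a k) (chaos_of J) = chaos_of (lower a k J)"
proof
  fix ps :: "(real \<times> 'd) list"
  let ?z = "\<lambda>(s, i). (s, i, 0::nat)"
  let ?n = "length ps"
  let ?f = "\<lambda>m s. J ((s, a, m) # map ?z ps)"
  have ins: "chaos_of J (take i ps @ (s, j) # drop i ps) = J ((s, j, 0) # map ?z ps) / fact (Suc ?n)" if "i \<le> ?n" for i s j
  proof -
    have "mset (map ?z (take i ps @ (s, j) # drop i ps)) = mset ((s, j, 0) # map ?z ps)"
    proof -
      have "mset (map ?z (take i ps @ (s, j) # drop i ps)) = mset ((s, j, 0) # map ?z (take i ps @ drop i ps))"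
        by (simp del: append_take_drop_id)
      then show ?thesis by (simp only: append_take_drop_id)
    qed
    from jets_perm[OF J this] show ?thesis using that by (simp add: chaos_of_def)
  qed
  have part: "chaos_partial i (chaos_of J) (take i ps @ (s, j) # drop i ps) = J ((s, j, 1) # map ?z ps) / fact (Suc ?n)"
    if i: "i \<le> ?n" for i s j
  proof -
    have li: "length (take i ps) = i" using i by simp
    have nth: "(take i ps @ (s, j) # drop i ps) ! i = (s, j)"
      by (metis li nth_append_length)
    have upd: "(take i ps @ (s, j) # drop i ps)[i := q] = take i ps @ q # drop i ps" for q
      by (metis li list_update_length)
    have "((\<lambda>t. J ((t, j, 0) # map ?z ps) * inverse (fact (Suc ?n))) has_vector_derivative
        J ((s, j, Suc 0) # map ?z ps) * inverse (fact (Suc ?n))) (at s)"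
      by (intro has_vector_derivative_mult_left jets_deriv[OF J])
    then show ?thesis
      unfolding chaos_partial_def nth upd
      by (simp add: ins[OF i] divide_inverse vector_derivative_at)
  qed
  have sel: "(\<Sum>j\<in>UNIV. (c *\<^sub>R axis a 1) $ j *\<^sub>R g j) = c *\<^sub>R g a" for c :: real and g :: "'d \<Rightarrow> 'k"
    by (subst sum.remove[of _ a]) (auto simp: axis_def intro!: sum.neutral)
  have "annih (fourier_basis a k) (chaos_of J) ps =
     (\<Sum>i\<le>?n. integral {0..1} (\<lambda>s. mode k s *\<^sub>R (?f 0 s / fact (Suc ?n)) + mode_deriv k s *\<^sub>R (?f 1 s / fact (Suc ?n))))"
    unfolding annih_def
  proof (intro sum.cong refl arg_cong2[where f = integral] ext)
    fix i s assume "i \<in> {..?n}"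
    then have i: "i \<le> ?n" by simp
    show "(\<Sum>j\<in>UNIV. fourier_basis a k s $ j *\<^sub>R chaos_of J (take i ps @ (s, j) # drop i ps)) +
       (\<Sum>j\<in>UNIV. vector_derivative (fourier_basis a k) (at s) $ j *\<^sub>R chaos_partial i (chaos_of J) (take i ps @ (s, j) # drop i ps)) =
       mode k s *\<^sub>R (?f 0 s / fact (Suc ?n)) + mode_deriv k s *\<^sub>R (?f 1 s / fact (Suc ?n))"
      unfolding vector_derivative_at[OF fourier_basis_has_derivative] fourier_basis_mode sel ins[OF i] part[OF i] ..
  qed
  also have "\<dots> = (\<Sum>i\<le>?n. coef k (\<lambda>s. ?f 0 s / fact (Suc ?n)))"
  proof (intro sum.cong refl integral_mode_first_order)
    show "((\<lambda>s. ?f 0 s / fact (Suc ?n)) has_vector_derivative ?f 1 s / fact (Suc ?n)) (at s)" for s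
      unfolding divide_inverse One_nat_def by (intro has_vector_derivative_mult_left jets_deriv[OF J])
    show "continuous_on {0..1} (\<lambda>s. ?f 1 s / fact (Suc ?n))"
      unfolding divide_inverse by (intro continuous_intros continuous_on_jets_head[OF J])
    show "?f 0 1 / fact (Suc ?n) = ?f 0 0 / fact (Suc ?n)"
      using jets_periodic[OF J, of 0] by simp
  qed
  also have "\<dots> = of_nat (Suc ?n) * (coef k (?f 0) * inverse (fact (Suc ?n)))"
    unfolding divide_inverse by (simp add: coef_mult continuous_on_jets_head[OF J] del: fact_Suc)
  also have "\<dots> = chaos_of (lower a k J) ps"
    by (simp add: chaos_of_def lower_def field_simps del: of_nat_Suc)
  finally show "annih (fourier_basis a k) (chaos_of J) ps = chaos_of (lower a k J) ps" .
qed

definition lowers :: "'d list \<Rightarrow> int list \<Rightarrow> ('d, 'k::euclidean_space) jet \<Rightarrow> ('d, 'k) jet" where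
  "lowers is ks J = foldr (\<lambda>(i, k). lower i k) (zip is ks) J"

lemma lowers_simps [simp]: "lowers [] ks J = J" "lowers (i # is) (k # ks) J = lower i k (lowers is ks J)"
  by (simp_all add: lowers_def)

lemma lowers_in_jets: "J \<in> jets \<Longrightarrow> lowers is ks J \<in> jets"
proof -
  assume J: "J \<in> jets"
  have "foldr (\<lambda>(i, k). lower i k) xs J \<in> jets" for xs
    by (induction xs) (auto simp: J lower_in_jets)
  then show ?thesis by (simp add: lowers_def)
qed

section \<open>Convergence in the Connes space\<close>

lemma chaos_of_add: "chaos_of (J + J') = chaos_of J + chaos_of J'"
  and chaos_of_diff: "chaos_of (J - J') = chaos_of J - chaos_of J'"
  and chaos_of_zero: "chaos_of 0 = 0"
  by (auto simp: chaos_of_def add_divide_distrib diff_divide_distrib fun_eq_iff)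

lemma chaos_of_scale: "chaos_of (jet_scale c J) = chaos_scale c (chaos_of J)"
  by (simp add: chaos_of_def jet_scale_def chaos_scale_def fun_eq_iff)

lemma chaos_of_sum: "chaos_of (sum f X) = (\<Sum>x\<in>X. chaos_of (f x))"
  by (intro ext) (simp add: chaos_of_def sum_fun_apply sum_divide_distrib)

lemma chaos_of_infsum:
  fixes f :: "'i \<Rightarrow> ('d::finite, 'k::{real_normed_field, euclidean_space}) jet"
  assumes "jet_summable f A"
  shows "chaos_of (jet_infsum f A) ps = (\<Sum>\<^sub>\<infinity>x\<in>A. chaos_of (f x) ps)"
  unfolding chaos_of_def jet_infsum_def divide_inverse
  by (rule infsum_cmult_left[symmetric]) (rule jet_summable_pointwise(2)[OF assms])

text \<open>
  The difference of the sum and a finite partial sum is the chaos of the tail, whose norm is bounded by the tail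
  of a convergent series.
\<close>

theorem CO_has_sum_chaos_of:
  fixes f :: "'i \<Rightarrow> ('d::finite, 'k::{real_normed_field, euclidean_space}) jet"
  assumes f: "jet_summable f A"
  shows "CO_has_sum (\<lambda>x. chaos_of (f x)) A (chaos_of (jet_infsum f A))"
  unfolding CO_has_sum_def
proof (intro conjI ballI allI impI)
  show "chaos_of (f x) \<in> CO_inf" if "x \<in> A" for x
    by (rule chaos_of_in_CO_inf[OF jet_summableD[OF f that]])
  show "chaos_of (jet_infsum f A) \<in> CO_inf"
    by (rule chaos_of_in_CO_inf[OF jet_infsum_in_jets[OF f]])
  fix k :: nat and C :: real assume C: "C > 0"
  define D where "D = 2 * real (k + 1) * real CARD('d) * C"
  have D: "D > 0" using C by (simp add: D_def)
  obtain g where g: "g summable_on A" "\<And>x. x \<in> A \<Longrightarrow> jet_bounded k D (g x) (f x)"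
    by (rule jet_summable_bounds[OF f D, of k]) (rule that)
  have up: "\<forall>\<^sub>F X in finite_subsets_at_top A.
      CO_norm k C (sum (\<lambda>x. chaos_of (f x)) X - chaos_of (jet_infsum f A)) \<le> ennreal (2 * infsum g (A - X))"
  proof (rule eventually_finite_subsets_at_top_weakI)
    fix X assume X: "finite X" "X \<subseteq> A"
    have f': "jet_summable f (A - X)" using f by (rule jet_summable_subset) auto
    let ?R = "jet_scale (-1) (jet_infsum f (A - X))"
    have "sum f X - jet_infsum f A = ?R"
      unfolding jet_infsum_finite_split[OF f X] by (simp add: jet_scale_def fun_eq_iff)
    then have eq: "sum (\<lambda>x. chaos_of (f x)) X - chaos_of (jet_infsum f A) = chaos_of ?R"
      by (simp flip: chaos_of_sum chaos_of_diff)
    have "jet_bounded k D (infsum g (A - X)) (jet_infsum f (A - X))"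
      using g by (intro jet_bounded_infsum f' D) (auto intro: summable_on_subset_banach)
    from jet_bounded_scale[OF this, of "-1"]
    have "jet_bounded k D (infsum g (A - X)) ?R" by simp
    then have "jet_bounded k D (infsum g (A - X)) (jet_of (chaos_of ?R))"
      by (simp add: jet_of_chaos_of jets_scale jet_infsum_in_jets f')
    from CO_norm_le[OF this[unfolded D_def] C]
    show "CO_norm k C (sum (\<lambda>x. chaos_of (f x)) X - chaos_of (jet_infsum f A)) \<le> ennreal (2 * infsum g (A - X))"
      unfolding eq .
  qed
  have "((\<lambda>X. ennreal (2 * infsum g (A - X))) \<longlongrightarrow> ennreal (2 * 0)) (finite_subsets_at_top A)"
    by (intro tendsto_ennrealI tendsto_mult tendsto_const infsum_tail_tendsto g)
  then have "((\<lambda>X. ennreal (2 * infsum g (A - X))) \<longlongrightarrow> 0) (finite_subsets_at_top A)" by simp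
  from tendsto_sandwich[OF always_eventually up tendsto_const this]
  show "((\<lambda>X. CO_norm k C (sum (\<lambda>x. chaos_of (f x)) X - chaos_of (jet_infsum f A))) \<longlongrightarrow> 0) (finite_subsets_at_top A)"
    by simp
qed

text \<open>
  The homogeneous component of degree \<open>n\<close>; by \<open>jet_bounded_component\<close> the components of a jet form a family that is
  dominated by a geometric series.
\<close>

definition component_jet :: "nat \<Rightarrow> ('l, 'k::zero) jet \<Rightarrow> ('l, 'k) jet" where
  "component_jet n J = (\<lambda>qs. if length qs = n then J qs else 0)"

lemma chaos_component_chaos_of: "chaos_component n (chaos_of J) = chaos_of (component_jet n J)"
  by (auto simp: chaos_component_def chaos_of_def component_jet_def fun_eq_iff)

lemma jet_bounded_component:
  fixes J :: "('l, 'k::real_normed_field) jet"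
  assumes bd: "jet_bounded k (2 * C) B J" and C: "C > 0"
  shows "jet_bounded k C (B * (1 / 2) ^ n) (component_jet n J)"
  unfolding jet_bounded_def
proof (intro allI impI)
  fix qs :: "(real \<times> 'l \<times> nat) list" assume qs: "\<forall>q\<in>set qs. order_of q \<le> k"
  show "C ^ length qs * norm (component_jet n J qs) \<le> B * (1 / 2) ^ n * fact (length qs)"
  proof (cases "length qs = n")
    case True
    have "(2 * C) ^ length qs * norm (J qs) \<le> B * fact (length qs)"
      using qs by (intro jet_boundedD[OF bd]) auto
    then show ?thesis using True by (simp add: component_jet_def field_simps power_mult_distrib)
  next
    case False
    then show ?thesis using jet_bounded_nonneg[OF bd] by (simp add: component_jet_def)
  qed
qed

lemma component_jet_in_jets:
  fixes J :: "('l, 'k::real_normed_field) jet"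
  assumes J: "J \<in> jets"
  shows "component_jet n J \<in> jets"
proof (rule jetsI)
  show "component_jet n J ps = component_jet n J qs" if "mset ps = mset qs" for ps qs
    using jets_perm[OF J that] mset_eq_length[OF that] by (simp add: component_jet_def)
  show "component_jet n J ((s + 1, a, m) # qs) = component_jet n J ((s, a, m) # qs)" for s a m qs
    by (simp add: component_jet_def jets_periodic[OF J])
  show "((\<lambda>t. component_jet n J ((t, a, m) # qs)) has_vector_derivative component_jet n J ((s, a, Suc m) # qs)) (at s)" for s a m qs
    by (cases "Suc (length qs) = n") (auto simp: component_jet_def jets_deriv[OF J])
  show "\<exists>B. jet_bounded k C B (component_jet n J)" if C: "C > 0" for k C
  proof -
    have "2 * C > 0" using C by simp
    then obtain B where "jet_bounded k (2 * C) B J" using jets_bounded[OF J] by blast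
    from jet_bounded_component[OF this C] show ?thesis by blast
  qed
qed

lemma jet_summable_tensor_components:
  fixes J :: "('l, 'k::{real_normed_field, banach}) jet" and J' :: "('m, 'k) jet"
  assumes J: "J \<in> jets" and J': "J' \<in> jets"
  shows "jet_summable (\<lambda>(n, m). tensor (component_jet n J) (component_jet m J')) UNIV"
  unfolding jet_summable_def
proof (intro conjI ballI allI impI)
  show "(case x of (n, m) \<Rightarrow> tensor (component_jet n J) (component_jet m J')) \<in> jets" for x
    by (auto split: prod.splits intro!: tensor_in_jets component_jet_in_jets J J')
  fix k :: nat and C :: real assume C: "C > 0"
  then have C2: "2 * C > 0" by simp
  obtain B where B: "jet_bounded k (2 * C) B J" using jets_bounded[OF J C2] by blast
  obtain B' where B': "jet_bounded k (2 * C) B' J'" using jets_bounded[OF J' C2] by blast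
  have s: "(\<lambda>n. D * (1 / 2) ^ n) summable_on UNIV" for D :: real
  proof (rule norm_summable_imp_summable_on)
    have "(\<lambda>n. norm (D * (1 / 2) ^ n)) = (\<lambda>n. \<bar>D\<bar> * (1 / 2) ^ n)"
      by (simp add: abs_mult fun_eq_iff)
    then show "summable (\<lambda>n. norm (D * (1 / 2) ^ n))"
      by (simp only:) (intro summable_mult summable_geometric, simp)
  qed
  have "(\<lambda>(n, m). (B * (1 / 2) ^ n) * (B' * (1 / 2) ^ m)) summable_on UNIV \<times> UNIV"
    by (rule summable_on_Times_mult[OF s s]) (use jet_bounded_nonneg[OF B] jet_bounded_nonneg[OF B'] in auto)
  then show "\<exists>g. g summable_on UNIV \<and> (\<forall>x\<in>UNIV. jet_bounded k C (g x) (case x of (n, m) \<Rightarrow> tensor (component_jet n J) (component_jet m J')))"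
    using jet_bounded_tensor[OF jet_bounded_component[OF B C] jet_bounded_component[OF B' C] C]
    by (intro exI[of _ "\<lambda>(n, m). (B * (1 / 2) ^ n) * (B' * (1 / 2) ^ m)"]) auto
qed

lemma jet_infsum_tensor_components:
  fixes J :: "('l, 'k::{real_normed_field, banach}) jet" and J' :: "('m, 'k) jet"
  shows "jet_infsum (\<lambda>(n, m). tensor (component_jet n J) (component_jet m J')) UNIV = tensor J J'"
proof
  fix qs :: "(real \<times> ('l + 'm) \<times> nat) list"
  have "(\<Sum>\<^sub>\<infinity>x. (case x of (n, m) \<Rightarrow> tensor (component_jet n J) (component_jet m J')) qs)
     = (\<Sum>\<^sub>\<infinity>x\<in>{(length (lefts qs), length (rights qs))}. tensor J J' qs)"
    by (rule infsum_cong_neutral) (auto simp: tensor_def component_jet_def split: prod.splits if_splits)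
  then show "jet_infsum (\<lambda>(n, m). tensor (component_jet n J) (component_jet m J')) UNIV qs = tensor J J' qs"
    by (simp add: jet_infsum_def)
qed

lemma jet_summable_reindex:
  assumes f: "jet_summable f B" and h: "inj_on h A" "h ` A \<subseteq> B"
  shows "jet_summable (\<lambda>x. f (h x)) A"
  unfolding jet_summable_def
proof (intro conjI ballI allI impI)
  note f' = jet_summable_subset[OF f h(2)]
  show "f (h x) \<in> jets" if "x \<in> A" for x using jet_summableD[OF f'] that by blast
  fix k :: nat and C :: real assume C: "C > 0"
  obtain g where g: "g summable_on h ` A" "\<And>x. x \<in> h ` A \<Longrightarrow> jet_bounded k C (g x) (f x)"
    by (rule jet_summable_bounds[OF f' C, of k]) (rule that)
  then show "\<exists>g. g summable_on A \<and> (\<forall>x\<in>A. jet_bounded k C (g x) (f (h x)))"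
    using h(1) by (intro exI[of _ "\<lambda>x. g (h x)"]) (auto simp: summable_on_reindex o_def)
qed

section \<open>The Moyal product of chaoses\<close>

lemma iter_annih_chaos_of:
  fixes J :: "('d::finite, 'k::{real_normed_field, euclidean_space}) jet"
  assumes J: "J \<in> jets"
  shows "iter_annih is ks (chaos_of J) = chaos_of (lowers is ks J)"
proof -
  have "foldr (\<lambda>(i, k). annih (fourier_basis i k)) xs (chaos_of J) = chaos_of (foldr (\<lambda>(i, k). lower i k) xs J)
     \<and> foldr (\<lambda>(i, k). lower i k) xs J \<in> jets" for xs
    by (induction xs) (auto simp: J annih_chaos_of lower_in_jets)
  then show ?thesis by (simp add: iter_annih_def lowers_def)
qed

text \<open>
  The multi-indices of \<open>P\<^sup>r\<close> as words of contractions between the first and the second factor.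
\<close>

definition triples :: "'d list \<Rightarrow> 'd list \<Rightarrow> int list \<Rightarrow> (('d + 'd) \<times> ('d + 'd) \<times> int) list" where
  "triples is js ks = zip (map Inl is) (zip (map Inr js) ks)"

lemma foldr_pair_op_tensor:
  fixes F G :: "('d::finite, 'k::{real_normed_field, euclidean_space}) jet"
  assumes F: "F \<in> jets" and G: "G \<in> jets" and len: "length is = length js" "length js = length ks"
  shows "foldr (pair_op (cross W)) (triples is js ks) (tensor F G) =
    jet_scale (of_real ((\<Prod>l<length ks. fourier_weight (ks ! l)) * (\<Prod>l<length ks. W (is ! l) (js ! l))))
      (tensor (lowers is ks F) (lowers js ks G))"
  using len
proof (induction "is" js ks rule: list_induct3)
  case Nil
  then show ?case by (simp add: triples_def)
next
  case (Cons i "is" j js k ks)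
  have t: "triples (i # is) (j # js) (k # ks) = (Inl i, Inr j, k) # triples is js ks" by (simp add: triples_def)
  have "lower (Inl i) k (lower (Inr j) k (tensor (lowers is ks F) (lowers js ks G))) =
      tensor (lower i k (lowers is ks F)) (lower j k (lowers js ks G))"
    by (simp add: lower_tensor_Inl lower_tensor_Inr lowers_in_jets F G)
  then show ?case
    unfolding t
    by (simp add: Cons jet_op_scale[OF jet_op_lower] lower_in_jets tensor_in_jets lowers_in_jets F G
        prod.lessThan_Suc_shift mult_ac del: prod.lessThan_Suc)
qed

lemma moyal_term_chaos_of:
  fixes F G :: "('d::finite, 'k::{real_normed_field, euclidean_space}) jet"
  assumes F: "F \<in> jets" and G: "G \<in> jets" and len: "length is = r" "length js = r" "length ks = r"
  shows "moyal_term \<omega> r (chaos_of F) (chaos_of G) (n, m, is, js, ks) = chaos_of (push merge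
    (foldr (pair_op (cross (inv_form \<omega>))) (triples is js ks) (tensor (component_jet n F) (component_jet m G))))"
proof -
  note cj = component_jet_in_jets[OF F] component_jet_in_jets[OF G]
  have "moyal_term \<omega> r (chaos_of F) (chaos_of G) (n, m, is, js, ks) =
     chaos_of (jet_scale (of_real ((\<Prod>l<r. fourier_weight (ks ! l)) * (\<Prod>l<r. inv_form \<omega> (is ! l) (js ! l))))
       (push merge (tensor (lowers is ks (component_jet n F)) (lowers js ks (component_jet m G)))))"
    by (simp add: chaos_component_chaos_of iter_annih_chaos_of wick_chaos_of cj lowers_in_jets chaos_of_scale)
  also have "\<dots> = chaos_of (push merge
    (foldr (pair_op (cross (inv_form \<omega>))) (triples is js ks) (tensor (component_jet n F) (component_jet m G))))"
    using len by (simp add: foldr_pair_op_tensor[OF cj] jet_op_scale[OF jet_op_push] tensor_in_jets lowers_in_jets cj)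
  finally show ?thesis .
qed

definition moyal_jet ::
  "('d \<Rightarrow> 'd \<Rightarrow> real) \<Rightarrow> ('d::finite, 'k::{real_normed_field, euclidean_space}) jet \<Rightarrow> ('d, 'k) jet \<Rightarrow>
     nat \<times> nat \<times> 'd list \<times> 'd list \<times> int list \<Rightarrow> ('d, 'k) jet" where
  "moyal_jet W F G = (\<lambda>(n, m, is, js, ks). push merge
     (foldr (pair_op (cross W)) (triples is js ks) (tensor (component_jet n F) (component_jet m G))))"

text \<open>
  Only contractions from the first to the second factor have a non-zero weight, so the words that do not come from
  a multi-index of \<open>P\<^sup>r\<close> contribute nothing.
\<close>

lemma foldr_pair_op_outside:
  fixes J :: "('d::finite + 'd, 'k::{real_normed_field, euclidean_space}) jet"
  assumes "xs \<notin> {triples is js ks |is js ks. length is = length xs \<and> length js = length xs \<and> length ks = length xs}"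
  shows "foldr (pair_op (cross W)) xs J = 0"
  using assms
proof (induction xs)
  case Nil
  then have False by (auto simp: triples_def)
  then show ?case ..
next
  case (Cons x xs)
  obtain a b k where x: "x = (a, b, k)" by (cases x)
  show ?case
  proof (cases "\<exists>i j. a = Inl i \<and> b = Inr j")
    case True
    then obtain i j where ab: "a = Inl i" "b = Inr j" by blast
    have "xs \<notin> {triples is js ks |is js ks. length is = length xs \<and> length js = length xs \<and> length ks = length xs}"
    proof
      assume "xs \<in> {triples is js ks |is js ks. length is = length xs \<and> length js = length xs \<and> length ks = length xs}"
      then obtain "is" js ks where e: "xs = triples is js ks"
        and l: "length is = length xs" "length js = length xs" "length ks = length xs"
        by blast
      have "x # xs = triples (i # is) (j # js) (k # ks)" unfolding e by (simp add: triples_def x ab)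
      moreover have "length (i # is) = length (x # xs)" "length (j # js) = length (x # xs)" "length (k # ks) = length (x # xs)"
        using l by (simp_all only: list.size)
      ultimately show False using Cons.prems by blast
    qed
    then have "foldr (pair_op (cross W)) xs J = 0" by (rule Cons.IH)
    then show ?thesis
      unfolding foldr.simps o_apply by (simp only: jet_op_zero[OF jet_op_pair])
  next
    case False
    then have "cross W a b = 0" by (cases a; cases b) auto
    then show ?thesis by (simp add: x)
  qed
qed

lemma inj_on_triples:
  "inj_on (\<lambda>(n, m, is, js, ks). (triples is js ks, n, m)) (moyal_indices r)"
proof (rule inj_on_inverseI[where g = "\<lambda>(xs, n, m). (n, m, map (projl \<circ> fst) xs, map (projr \<circ> (fst \<circ> snd)) xs, map (snd \<circ> snd) xs)"])
  fix x :: "nat \<times> nat \<times> 'a list \<times> 'a list \<times> int list" assume x: "x \<in> moyal_indices r"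
  obtain n m "is" js ks where x_eq: "x = (n, m, is, js, ks)" by (cases x)
  with x have len: "length is = r" "length js = r" "length ks = r" by (auto simp: moyal_indices_def)
  have "map (projl \<circ> fst) (triples is js ks) = is" "map (projr \<circ> (fst \<circ> snd)) (triples is js ks) = js"
    "map (snd \<circ> snd) (triples is js ks) = ks"
    using len by (auto simp: triples_def intro!: nth_equalityI)
  then show "(\<lambda>(xs, n, m). (n, m, map (projl \<circ> fst) xs, map (projr \<circ> (fst \<circ> snd)) xs, map (snd \<circ> snd) xs))
     ((\<lambda>(n, m, is, js, ks). (triples is js ks, n, m)) x) = x"
    unfolding x_eq by simp
qed

text \<open>
  The sum over the degrees \<open>n, m\<close> reassembles \<open>F \<otimes> G\<close>, and the sum over the words of contractions is a power of a
  single contraction. The joint family is a family of operators applied to a summable family, so the order of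
  summation does not matter.
\<close>

lemma moyal_jet_sum:
  fixes F G :: "('d::finite, 'k::{real_normed_field, euclidean_space}) jet"
  assumes F: "F \<in> jets" and G: "G \<in> jets"
  shows "jet_summable (moyal_jet W F G) (moyal_indices r)"
    and "jet_infsum (moyal_jet W F G) (moyal_indices r) = star_jet W r F G"
proof -
  let ?L = "{xs :: (('d + 'd) \<times> ('d + 'd) \<times> int) list. length xs = r}"
  let ?f = "\<lambda>(n, m). tensor (component_jet n F) (component_jet m G)"
  let ?U = "\<lambda>xs. foldr (pair_op (cross W)) xs"
  let ?V = "\<lambda>z. push merge ((\<lambda>(xs, x). ?U xs (?f x)) z)"
  let ?h = "\<lambda>(n, m, is, js, ks). (triples is js ks, n, m)"
  have U: "jet_op_family (?U :: _ \<Rightarrow> ('d + 'd, 'k) jet \<Rightarrow> ('d + 'd, 'k) jet) ?L"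
    by (rule jet_op_family_lists[OF jet_op_family_pair])
  note f = jet_summable_tensor_components[OF F G]
  have UV: "jet_summable (\<lambda>(xs, x). ?U xs (?f x)) (?L \<times> UNIV)"
    by (rule jet_summable_op_family[OF U f])
  have V: "jet_summable ?V (?L \<times> UNIV)"
    by (rule jet_summable_op[OF jet_op_push UV])
  have h: "inj_on ?h (moyal_indices r)" "?h ` moyal_indices r \<subseteq> ?L \<times> UNIV"
    using inj_on_triples by (auto simp: moyal_indices_def triples_def)
  have eq: "moyal_jet W F G = (\<lambda>x. ?V (?h x))"
    by (auto simp: moyal_jet_def fun_eq_iff)
  show "jet_summable (moyal_jet W F G) (moyal_indices r)"
    unfolding eq by (rule jet_summable_reindex[OF V h])
  have out: "?V z = 0" if z: "z \<in> ?L \<times> UNIV" "z \<notin> ?h ` moyal_indices r" for z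
  proof -
    obtain n m xs where z': "z = (xs, n, m)" "length xs = r" using z(1) by auto
    have "xs \<notin> {triples is js ks |is js ks. length is = length xs \<and> length js = length xs \<and> length ks = length xs}"
    proof
      assume "xs \<in> {triples is js ks |is js ks. length is = length xs \<and> length js = length xs \<and> length ks = length xs}"
      then obtain "is" js ks where "xs = triples is js ks" "length is = r" "length js = r" "length ks = r" using z' by auto
      then have "z = ?h (n, m, is, js, ks)" "(n, m, is, js, ks) \<in> moyal_indices r" by (auto simp: z' moyal_indices_def)
      with z(2) show False by blast
    qed
    then show ?thesis by (simp add: z' foldr_pair_op_outside jet_op_zero[OF jet_op_push])
  qed
  have "jet_infsum (moyal_jet W F G) (moyal_indices r) = jet_infsum ?V (?h ` moyal_indices r)"
    unfolding eq using jet_infsum_reindex[OF inj_on_imp_bij_betw[OF h(1)], of ?V] .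
  also have "\<dots> = jet_infsum ?V (?L \<times> UNIV)"
    unfolding jet_infsum_def using h(2) out by (intro ext infsum_cong_neutral) auto
  also have "\<dots> = push merge (jet_infsum (\<lambda>(xs, x). ?U xs (?f x)) (?L \<times> UNIV))"
    by (rule jet_op_infsum[OF jet_op_push UV, symmetric])
  also have "\<dots> = push merge (jet_infsum (\<lambda>xs. ?U xs (tensor F G)) ?L)"
    unfolding jet_infsum_op_family[OF U f] jet_infsum_tensor_components ..
  also have "\<dots> = star_jet W r F G"
    unfolding jet_infsum_lists[OF jet_op_family_pair tensor_in_jets[OF F G]] star_jet_def contr_def[abs_def] ..
  finally show "jet_infsum (moyal_jet W F G) (moyal_indices r) = star_jet W r F G" .
qed

lemma moyal_term_moyal_jet:
  fixes F G :: "('d::finite, 'k::{real_normed_field, euclidean_space}) jet"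
  assumes "F \<in> jets" "G \<in> jets" "x \<in> moyal_indices r"
  shows "moyal_term \<omega> r (chaos_of F) (chaos_of G) x = chaos_of (moyal_jet (inv_form \<omega>) F G x)"
  using assms by (auto simp: moyal_indices_def moyal_jet_def moyal_term_chaos_of simp del: moyal_term.simps)

theorem moyal_chaos_of:
  fixes F G :: "('d::finite, 'k::{real_normed_field, euclidean_space}) jet"
  assumes F: "F \<in> jets" and G: "G \<in> jets"
  shows "moyal \<omega> r (chaos_of F) (chaos_of G) = chaos_of (star_jet (inv_form \<omega>) r F G)"
proof (cases "r = 0")
  case True
  then show ?thesis by (simp add: moyal_def wick_chaos_of F G star_jet_def)
next
  case False
  show ?thesis
  proof
    fix ps
    have "moyal \<omega> r (chaos_of F) (chaos_of G) ps = (\<Sum>\<^sub>\<infinity>x\<in>moyal_indices r. chaos_of (moyal_jet (inv_form \<omega>) F G x) ps)"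
      using False unfolding moyal_def by (auto intro!: infsum_cong simp: moyal_term_moyal_jet[OF F G] simp del: moyal_term.simps)
    then show "moyal \<omega> r (chaos_of F) (chaos_of G) ps = chaos_of (star_jet (inv_form \<omega>) r F G) ps"
      by (simp add: chaos_of_infsum[OF moyal_jet_sum(1)[OF F G], symmetric] moyal_jet_sum(2)[OF F G])
  qed
qed

lemma CO_has_sum_cong:
  "(\<And>x. x \<in> A \<Longrightarrow> f x = g x) \<Longrightarrow> CO_has_sum f A S \<Longrightarrow> CO_has_sum g A S"
proof -
  assume eq: "\<And>x. x \<in> A \<Longrightarrow> f x = g x" and f: "CO_has_sum f A S"
  show ?thesis
    unfolding CO_has_sum_def
  proof (intro conjI ballI allI impI)
    show "g x \<in> CO_inf" if "x \<in> A" for x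
      using f that unfolding CO_has_sum_def by (simp flip: eq)
    show "S \<in> CO_inf" using f unfolding CO_has_sum_def by blast
    fix k :: nat and C :: real assume C: "C > 0"
    have "\<forall>\<^sub>F X in finite_subsets_at_top A. CO_norm k C (sum f X - S) = CO_norm k C (sum g X - S)"
    proof (rule eventually_finite_subsets_at_top_weakI)
      fix X assume "X \<subseteq> A"
      then have "sum f X = sum g X" using eq by (intro sum.cong) auto
      then show "CO_norm k C (sum f X - S) = CO_norm k C (sum g X - S)" by simp
    qed
    from tendsto_cong[OF this] show "((\<lambda>X. CO_norm k C (sum g X - S)) \<longlongrightarrow> 0) (finite_subsets_at_top A)"
      using f C unfolding CO_has_sum_def by blast
  qed
qed

lemma CO_has_sum_moyal:
  fixes F G :: "('d::finite, 'k::{real_normed_field, euclidean_space}) jet"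
  assumes F: "F \<in> jets" and G: "G \<in> jets"
  shows "CO_has_sum (moyal_term \<omega> r (chaos_of F) (chaos_of G)) (moyal_indices r) (moyal \<omega> r (chaos_of F) (chaos_of G))"
  using CO_has_sum_chaos_of[OF moyal_jet_sum(1)[OF F G, of "inv_form \<omega>" r]]
  unfolding moyal_jet_sum(2)[OF F G] moyal_chaos_of[OF F G]
  by (rule CO_has_sum_cong[rotated]) (simp only: moyal_term_moyal_jet[OF F G])

abbreviation poisson_index :: "nat \<times> nat \<times> 'd \<times> 'd \<times> int \<Rightarrow> nat \<times> nat \<times> 'd list \<times> 'd list \<times> int list" where
  "poisson_index \<equiv> \<lambda>(n, m, i, j, k). (n, m, [i], [j], [k])"

lemma bij_poisson_index: "bij_betw poisson_index UNIV (moyal_indices 1)"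
  by (rule bij_betwI[where g = "\<lambda>(n, m, is, js, ks). (n, m, hd is, hd js, hd ks)"])
     (auto simp: moyal_indices_def length_Suc_conv)

lemma poisson_term_moyal_term: "poisson_term \<omega> F G x = moyal_term \<omega> 1 F G (poisson_index x)"
  by (cases x) (simp add: iter_annih_def)

lemma poisson_eq_moyal: "poisson \<omega> F G = moyal \<omega> 1 F G"
proof
  fix ps
  show "poisson \<omega> F G ps = moyal \<omega> 1 F G ps"
    unfolding poisson_def moyal_def poisson_term_moyal_term
    using infsum_reindex_bij_betw[OF bij_poisson_index, of "\<lambda>x. moyal_term \<omega> 1 F G x ps"] by simp
qed

lemma CO_has_sum_poisson:
  fixes F G :: "('d::finite, 'k::{real_normed_field, euclidean_space}) jet"
  assumes F: "F \<in> jets" and G: "G \<in> jets"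
  shows "CO_has_sum (poisson_term \<omega> (chaos_of F) (chaos_of G)) UNIV (poisson \<omega> (chaos_of F) (chaos_of G))"
proof -
  let ?J = "moyal_jet (inv_form \<omega>) F G"
  have "jet_summable (\<lambda>x. ?J (poisson_index x)) UNIV"
    by (rule jet_summable_reindex[OF moyal_jet_sum(1)[OF F G, of _ 1]])
       (auto simp: inj_on_def moyal_indices_def)
  from CO_has_sum_chaos_of[OF this]
  have "CO_has_sum (\<lambda>x. chaos_of (?J (poisson_index x))) UNIV (poisson \<omega> (chaos_of F) (chaos_of G))"
    unfolding jet_infsum_reindex[OF bij_poisson_index, of ?J] moyal_jet_sum(2)[OF F G] poisson_eq_moyal moyal_chaos_of[OF F G] .
  then show ?thesis
  proof (rule CO_has_sum_cong[rotated])
    fix x :: "nat \<times> nat \<times> 'd \<times> 'd \<times> int"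
    have "poisson_index x \<in> moyal_indices 1" using bij_poisson_index by (auto simp: bij_betw_def)
    then show "chaos_of (?J (poisson_index x)) = poisson_term \<omega> (chaos_of F) (chaos_of G) x"
      unfolding poisson_term_moyal_term by (rule moyal_term_moyal_jet[OF F G, symmetric])
  qed
qed

section \<open>Deformation quantization\<close>

text \<open>
  With \<open>A\<close> antisymmetric, minus the transpose of its inverse is again an inverse of \<open>A\<close>.
\<close>

lemma inv_form_antisymmetric:
  fixes \<omega> :: "real ^ 'd::finite \<Rightarrow> real ^ 'd \<Rightarrow> real"
  assumes "symplectic_form \<omega>"
  shows "inv_form \<omega> i j = - inv_form \<omega> j i"
proof -
  have bil: "bilinear \<omega>" and anti: "\<And>x y. \<omega> x y = - \<omega> y x" and nd: "\<And>x. (\<forall>y. \<omega> x y = 0) \<Longrightarrow> x = 0"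
    using assms unfolding symplectic_form_def by blast+
  let ?A = "form_matrix \<omega>"
  have exp: "\<omega> x y = (\<Sum>j\<in>UNIV. y $ j * \<omega> x (axis j 1))" for x y
  proof -
    have lin: "linear (\<omega> x)" using bil unfolding bilinear_def by blast
    have "\<omega> x y = \<omega> x (\<Sum>j\<in>UNIV. y $ j *\<^sub>R axis j 1)"
      using basis_expansion[of y] by (simp add: scalar_mult_eq_scaleR)
    then show ?thesis by (simp add: linear_sum[OF lin] linear_scale[OF lin])
  qed
  have ker: "y = 0" if y: "?A *v y = 0" for y
  proof (rule nd, rule allI)
    fix x
    have "\<omega> (axis i 1) y = 0" for i
    proof -
      have "\<omega> (axis i 1) y = (?A *v y) $ i"
        unfolding exp[of "axis i 1" y] by (simp add: matrix_vector_mult_def form_matrix_def mult.commute)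
      then show ?thesis using y by simp
    qed
    then have "\<omega> y (axis i 1) = 0" for i using anti[of y "axis i 1"] by simp
    then show "\<omega> y x = 0" unfolding exp[of y x] by simp
  qed
  then have inv: "invertible ?A"
    unfolding invertible_left_inverse matrix_left_invertible_ker by blast
  define B where "B = matrix_inv ?A"
  have BA: "B ** ?A = mat 1" and AB: "?A ** B = mat 1"
    using someI_ex[OF inv[unfolded invertible_def]] unfolding B_def matrix_inv_def by auto
  \<comment> \<open>minus the transpose of the inverse, shown to be a right inverse of the matrix as well\<close>
  define C where "C = (\<chi> i j. - B $ j $ i)"
  have anti': "?A $ i $ j = - ?A $ j $ i" for i j
    unfolding form_matrix_def by (simp, rule anti)
  have "?A ** C = mat 1"
  proof -
    have "(?A ** C) $ i $ j = (B ** ?A) $ j $ i" for i j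
    proof -
      have "?A $ i $ k * C $ k $ j = B $ j $ k * ?A $ k $ i" for k
        using anti'[of i k] by (simp add: C_def)
      then show ?thesis by (simp add: matrix_matrix_mult_def)
    qed
    then show ?thesis unfolding BA by (simp add: vec_eq_iff mat_def)
  qed
  then have "C = B"
    using BA by (metis matrix_mul_assoc matrix_mul_lid matrix_mul_rid)
  then have "B $ i $ j = - B $ j $ i" unfolding C_def by (metis vec_lambda_beta)
  then show ?thesis by (simp add: inv_form_def B_def)
qed

lemma jet_op_star: "jet_op (\<lambda>J. push merge ((contr (cross M) ^^ r) J))"
  by (rule jet_op_comp[OF jet_op_push jet_op_funpow[OF jet_op_contr]])

lemma star_jet_add_left:
  assumes "F \<in> jets" "F' \<in> jets" "G \<in> jets"
  shows "star_jet M r (F + F') G = star_jet M r F G + star_jet M r F' G"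
proof -
  have "tensor (F + F') G = tensor F G + tensor F' G" by (simp add: fun_eq_iff tensor_def algebra_simps)
  then show ?thesis by (simp only: star_jet_def jet_op_add[OF jet_op_star] tensor_in_jets assms)
qed

lemma star_jet_add_right:
  assumes "F \<in> jets" "G \<in> jets" "G' \<in> jets"
  shows "star_jet M r F (G + G') = star_jet M r F G + star_jet M r F G'"
proof -
  have "tensor F (G + G') = tensor F G + tensor F G'" by (simp add: fun_eq_iff tensor_def algebra_simps)
  then show ?thesis by (simp only: star_jet_def jet_op_add[OF jet_op_star] tensor_in_jets assms)
qed

lemma star_jet_scale_left:
  assumes "F \<in> jets" "G \<in> jets"
  shows "star_jet M r (jet_scale c F) G = jet_scale c (star_jet M r F G)"
proof -
  have "tensor (jet_scale c F) G = jet_scale c (tensor F G)" by (simp add: fun_eq_iff tensor_def jet_scale_def)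
  then show ?thesis by (simp only: star_jet_def jet_op_scale[OF jet_op_star] tensor_in_jets assms)
qed

lemma star_jet_scale_right:
  assumes "F \<in> jets" "G \<in> jets"
  shows "star_jet M r F (jet_scale c G) = jet_scale c (star_jet M r F G)"
proof -
  have "tensor F (jet_scale c G) = jet_scale c (tensor F G)" by (simp add: fun_eq_iff tensor_def jet_scale_def)
  then show ?thesis by (simp only: star_jet_def jet_op_scale[OF jet_op_star] tensor_in_jets assms)
qed

lemma bilinear_on_CO_moyal:
  "bilinear_on_CO (moyal \<omega> r :: ('d::finite, 'k::{real_normed_field, euclidean_space}) chaos \<Rightarrow> _)"
  unfolding bilinear_on_CO_def
proof (intro conjI ballI allI)
  fix F G :: "('d, 'k) chaos" assume "F \<in> CO_inf" "G \<in> CO_inf"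
  then obtain A B where J: "A \<in> jets" "B \<in> jets" and eq: "F = chaos_of A" "G = chaos_of B"
    by (metis CO_inf_cases)
  show "moyal \<omega> r F G \<in> CO_inf"
    by (simp add: eq moyal_chaos_of J chaos_of_in_CO_inf star_jet_in_jets)
  fix c
  show "moyal \<omega> r (chaos_scale c F) G = chaos_scale c (moyal \<omega> r F G)"
    "moyal \<omega> r F (chaos_scale c G) = chaos_scale c (moyal \<omega> r F G)"
    unfolding eq
    by (simp_all only: chaos_of_scale[symmetric] moyal_chaos_of J jets_scale star_jet_scale_left star_jet_scale_right)
next
  fix F F' G :: "('d, 'k) chaos" assume "F \<in> CO_inf" "F' \<in> CO_inf" "G \<in> CO_inf"
  then obtain A A' B where J: "A \<in> jets" "A' \<in> jets" "B \<in> jets" and eq: "F = chaos_of A" "F' = chaos_of A'" "G = chaos_of B"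
    by (metis CO_inf_cases)
  show "moyal \<omega> r (F + F') G = moyal \<omega> r F G + moyal \<omega> r F' G"
    "moyal \<omega> r G (F + F') = moyal \<omega> r G F + moyal \<omega> r G F'"
    unfolding eq chaos_of_add[symmetric] moyal_chaos_of[OF jets_add[OF J(1,2)] J(3)] moyal_chaos_of[OF J(3) jets_add[OF J(1,2)]]
      star_jet_add_left[OF J(1,2,3)] star_jet_add_right[OF J(3,1,2)]
    by (simp_all only: moyal_chaos_of J chaos_of_add)
qed

text \<open>
  The product is the tensor product followed by a continuous operator. The summand 1 in \<open>2 K + 1\<close> and
  the successor in \<open>Suc k'\<close> make these constants positive.
\<close>

lemma moyal_continuous:
  assumes C: "C > 0"
  shows "\<exists>K>0. \<exists>k1>0. \<exists>C1>0. \<forall>F1\<in>CO_inf. \<forall>F2\<in>(CO_inf :: ('d::finite, 'k::{real_normed_field, euclidean_space}) chaos set).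
    CO_norm k C (moyal \<omega> r F1 F2) \<le> ennreal K * CO_norm k1 C1 F1 * CO_norm k1 C1 F2"
proof -
  let ?W = "inv_form \<omega>"
  define D where "D = 2 * real (k + 1) * real CARD('d) * C"
  have D: "D > 0" using C by (simp add: D_def)
  obtain k' C' K where K: "C' > 0" "K \<ge> 0" "\<And>J B. J \<in> jets \<Longrightarrow> jet_bounded k' C' B J \<Longrightarrow>
      jet_bounded k D (K * B) (push merge ((contr (cross ?W) ^^ r) (J :: ('d + 'd, 'k) jet)))"
    by (rule jet_op_bound[OF jet_op_star D, of k]) (rule that)
  have "CO_norm k C (moyal \<omega> r F1 F2) \<le> ennreal (2 * K + 1) * CO_norm (Suc k') C' F1 * CO_norm (Suc k') C' F2"
    if F: "F1 \<in> CO_inf" "F2 \<in> CO_inf" for F1 F2 :: "('d, 'k) chaos"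
  proof -
    define a b where "a = enn2real (CO_norm (Suc k') C' F1)" and "b = enn2real (CO_norm (Suc k') C' F2)"
    have ab: "CO_norm (Suc k') C' F1 = ennreal a" "CO_norm (Suc k') C' F2 = ennreal b" "a \<ge> 0" "b \<ge> 0"
      using CO_infD[OF F(1) K(1), of "Suc k'"] CO_infD[OF F(2) K(1), of "Suc k'"] by (simp_all add: a_def b_def less_top)
    have J: "jet_of F1 \<in> jets" "jet_of F2 \<in> jets" using F by (simp_all add: jet_of_in_jets)
    have "jet_bounded k' C' a (jet_of F1)" "jet_bounded k' C' b (jet_of F2)"
      unfolding a_def b_def using K(1)
      by (auto intro: jet_bounded_mono[OF jet_bounded_CO_norm[OF CO_infD[OF F(1) K(1), of "Suc k'"] K(1)]]
          jet_bounded_mono[OF jet_bounded_CO_norm[OF CO_infD[OF F(2) K(1), of "Suc k'"] K(1)]])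
    from K(3)[OF tensor_in_jets[OF J] jet_bounded_tensor[OF this K(1)]]
    have "jet_bounded k D (K * (a * b)) (star_jet ?W r (jet_of F1) (jet_of F2))"
      by (simp add: star_jet_def)
    then have "jet_bounded k D (K * (a * b)) (jet_of (chaos_of (star_jet ?W r (jet_of F1) (jet_of F2))))"
      by (simp add: jet_of_chaos_of star_jet_in_jets J)
    from CO_norm_le[OF this[unfolded D_def] C]
    have "CO_norm k C (moyal \<omega> r F1 F2) \<le> ennreal (2 * (K * (a * b)))"
      using moyal_chaos_of[OF J, of \<omega> r] by (simp add: chaos_of_jet_of)
    also have "\<dots> \<le> ennreal ((2 * K + 1) * a * b)"
      using ab(3,4) K(2) by (intro ennreal_leI) (simp add: algebra_simps)
    also have "\<dots> = ennreal (2 * K + 1) * CO_norm (Suc k') C' F1 * CO_norm (Suc k') C' F2"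
      unfolding ab(1,2) using ab(3,4) K(2) by (simp add: ennreal_mult)
    finally show ?thesis .
  qed
  moreover have "2 * K + 1 > 0" "Suc k' > 0" using K(2) by auto
  ultimately show ?thesis using K(1) by meson
qed

lemma chaos_scale_zero: "chaos_scale (c :: 'k::mult_zero) 0 = 0"
  by (simp add: chaos_scale_def fun_eq_iff)

lemma moyal_star_const_left:
  fixes F :: "('d::finite, 'k::{real_normed_field, euclidean_space}) jet"
  assumes F: "F \<in> jets" and G: "\<And>n. G n \<in> jets"
  shows "fps_nth (moyal_star \<omega> (fps_const (chaos_of F)) (Abs_fps (\<lambda>n. chaos_of (G n)))) N =
    (\<Sum>r\<le>N. chaos_scale (1 / fact r) (chaos_of (star_jet (inv_form \<omega>) r F (G (N - r)))))"
proof -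
  have zero: "star_jet W r 0 J = 0" if "J \<in> jets" for W r and J :: "('d, 'k) jet"
    using star_jet_scale_left[OF F that, of W r 0] by simp
  have fc: "fps_nth (fps_const (chaos_of F)) a = chaos_of (if a = 0 then F else 0)" for a
    by (simp add: chaos_of_zero)
  have m: "moyal \<omega> r (fps_nth (fps_const (chaos_of F)) a) (chaos_of (G n)) = (if a = 0 then chaos_of (star_jet (inv_form \<omega>) r F (G n)) else 0)" for r a n
    unfolding fc by (subst moyal_chaos_of) (auto simp: F G jets_zero zero chaos_of_zero)
  have "fps_nth (moyal_star \<omega> (fps_const (chaos_of F)) (Abs_fps (\<lambda>n. chaos_of (G n)))) N =
     (\<Sum>r\<le>N. \<Sum>a\<le>N - r. if a = 0 then chaos_scale (1 / fact r) (chaos_of (star_jet (inv_form \<omega>) r F (G (N - r)))) else 0)"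
    unfolding moyal_star_def fps_nth_Abs_fps m by (intro sum.cong refl) (auto simp: chaos_scale_zero)
  then show ?thesis by (simp add: sum.delta)
qed

lemma moyal_star_const_right:
  fixes F :: "nat \<Rightarrow> ('d::finite, 'k::{real_normed_field, euclidean_space}) jet"
  assumes F: "\<And>n. F n \<in> jets" and G: "G \<in> jets"
  shows "fps_nth (moyal_star \<omega> (Abs_fps (\<lambda>n. chaos_of (F n))) (fps_const (chaos_of G))) N =
    (\<Sum>r\<le>N. chaos_scale (1 / fact r) (chaos_of (star_jet (inv_form \<omega>) r (F (N - r)) G)))"
proof -
  have zero: "star_jet W r J 0 = 0" if "J \<in> jets" for W r and J :: "('d, 'k) jet"
    using star_jet_scale_right[OF that G, of W r 0] by simp
  have fc: "fps_nth (fps_const (chaos_of G)) a = chaos_of (if a = 0 then G else 0)" for a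
    by (simp add: chaos_of_zero)
  have m: "moyal \<omega> r (chaos_of (F n)) (fps_nth (fps_const (chaos_of G)) a) = (if a = 0 then chaos_of (star_jet (inv_form \<omega>) r (F n) G) else 0)" for r a n
    unfolding fc by (subst moyal_chaos_of) (auto simp: F G jets_zero zero chaos_of_zero)
  have "fps_nth (moyal_star \<omega> (Abs_fps (\<lambda>n. chaos_of (F n))) (fps_const (chaos_of G))) N =
     (\<Sum>r\<le>N. \<Sum>a\<le>N - r. if a = N - r then chaos_scale (1 / fact r) (chaos_of (star_jet (inv_form \<omega>) r (F (N - r)) G)) else 0)"
    unfolding moyal_star_def fps_nth_Abs_fps m by (intro sum.cong refl) (auto simp: chaos_scale_zero)
  then show ?thesis by (simp add: sum.delta)
qed

lemma moyal_star_const_const: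
  fixes F G :: "('d::finite, 'k::{real_normed_field, euclidean_space}) jet"
  assumes F: "F \<in> jets" and G: "G \<in> jets"
  shows "moyal_star \<omega> (fps_const (chaos_of F)) (fps_const (chaos_of G)) =
    Abs_fps (\<lambda>n. chaos_of (jet_scale (1 / fact n) (star_jet (inv_form \<omega>) n F G)))"
proof (rule fps_ext)
  fix N
  let ?G = "\<lambda>n. if n = 0 then G else 0"
  have zero: "star_jet W r F 0 = 0" for W r
    using star_jet_scale_right[OF F G, of W r 0] by simp
  have "fps_const (chaos_of G) = Abs_fps (\<lambda>n. chaos_of (?G n))"
    by (rule fps_ext) (simp add: chaos_of_zero)
  then have "fps_nth (moyal_star \<omega> (fps_const (chaos_of F)) (fps_const (chaos_of G))) N =
     (\<Sum>r\<le>N. chaos_scale (1 / fact r) (chaos_of (star_jet (inv_form \<omega>) r F (?G (N - r)))))"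
    using moyal_star_const_left[OF F, of ?G \<omega> N] by (simp add: G jets_zero)
  also have "\<dots> = (\<Sum>r\<le>N. if r = N then chaos_of (jet_scale (1 / fact r) (star_jet (inv_form \<omega>) r F G)) else 0)"
    by (intro sum.cong refl) (auto simp: chaos_of_scale zero chaos_of_zero chaos_scale_zero)
  finally show "fps_nth (moyal_star \<omega> (fps_const (chaos_of F)) (fps_const (chaos_of G))) N =
    fps_nth (Abs_fps (\<lambda>n. chaos_of (jet_scale (1 / fact n) (star_jet (inv_form \<omega>) n F G)))) N"
    by (simp add: sum.delta)
qed

text \<open>
  \<open>1 / (r! (N - r)!)\<close> is \<open>(N choose r) / N!\<close>, so the coefficient of \<open>\<hbar>\<^sup>N\<close> is the identity \<open>star_jet_assoc\<close>.
\<close>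

theorem moyal_star_assoc:
  fixes F G H :: "('d::finite, 'k::{real_normed_field, euclidean_space}) jet"
  assumes F: "F \<in> jets" and G: "G \<in> jets" and H: "H \<in> jets"
  shows "moyal_star \<omega> (fps_const (chaos_of F)) (moyal_star \<omega> (fps_const (chaos_of G)) (fps_const (chaos_of H))) =
    moyal_star \<omega> (moyal_star \<omega> (fps_const (chaos_of F)) (fps_const (chaos_of G))) (fps_const (chaos_of H))"
proof (rule fps_ext)
  fix N
  let ?S = "star_jet (inv_form \<omega>)"
  have inj: "jet_scale c (?S n A B) \<in> jets" if "A \<in> jets" "B \<in> jets" for c n and A B :: "('d, 'k) jet"
    by (intro jets_scale star_jet_in_jets that)
  have coeff: "(1 / fact r) * ((1 / fact (N - r)) * x) = of_nat (N choose r) * x / fact N" if "r \<le> N" for r and x :: 'k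
    using binomial_fact[OF that, where 'a = 'k] by (simp add: field_simps)
  have "(\<Sum>r\<le>N. chaos_scale (1 / fact r) (chaos_of (?S r F (jet_scale (1 / fact (N - r)) (?S (N - r) G H))))) =
      (\<Sum>r\<le>N. chaos_scale (1 / fact r) (chaos_of (?S r (jet_scale (1 / fact (N - r)) (?S (N - r) F G)) H)))"
  proof
    fix ps :: "(real \<times> 'd) list"
    let ?z = "map (\<lambda>(s, i). (s, i, 0::nat)) ps"
    have "(\<Sum>r\<le>N. chaos_scale (1 / fact r) (chaos_of (?S r F (jet_scale (1 / fact (N - r)) (?S (N - r) G H))))) ps
      = (\<Sum>r\<le>N. of_nat (N choose r) * ?S r F (?S (N - r) G H) ?z) / (fact N * fact (length ps))"
      unfolding sum_fun_apply sum_divide_distrib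
    proof (intro sum.cong refl)
      fix r assume "r \<in> {..N}"
      then show "chaos_scale (1 / fact r) (chaos_of (?S r F (jet_scale (1 / fact (N - r)) (?S (N - r) G H)))) ps =
         of_nat (N choose r) * ?S r F (?S (N - r) G H) ?z / (fact N * fact (length ps))"
        unfolding star_jet_scale_right[OF F star_jet_in_jets[OF G H]]
        using coeff[of r "?S r F (?S (N - r) G H) ?z / fact (length ps)"]
        by (simp add: chaos_scale_def chaos_of_def jet_scale_def mult_ac)
    qed
    also have "\<dots> = (\<Sum>r\<le>N. of_nat (N choose r) * ?S r (?S (N - r) F G) H ?z) / (fact N * fact (length ps))"
      by (simp only: star_jet_assoc[OF F G H])
    also have "\<dots> = (\<Sum>r\<le>N. chaos_scale (1 / fact r) (chaos_of (?S r (jet_scale (1 / fact (N - r)) (?S (N - r) F G)) H))) ps"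
      unfolding sum_fun_apply sum_divide_distrib
    proof (intro sum.cong refl)
      fix r assume "r \<in> {..N}"
      then show "of_nat (N choose r) * ?S r (?S (N - r) F G) H ?z / (fact N * fact (length ps)) =
         chaos_scale (1 / fact r) (chaos_of (?S r (jet_scale (1 / fact (N - r)) (?S (N - r) F G)) H)) ps"
        unfolding star_jet_scale_left[OF star_jet_in_jets[OF F G] H]
        using coeff[of r "?S r (?S (N - r) F G) H ?z / fact (length ps)"]
        by (simp add: chaos_scale_def chaos_of_def jet_scale_def mult_ac)
    qed
    finally show "(\<Sum>r\<le>N. chaos_scale (1 / fact r) (chaos_of (?S r F (jet_scale (1 / fact (N - r)) (?S (N - r) G H))))) ps =
      (\<Sum>r\<le>N. chaos_scale (1 / fact r) (chaos_of (?S r (jet_scale (1 / fact (N - r)) (?S (N - r) F G)) H))) ps" .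
  qed
  then show "fps_nth (moyal_star \<omega> (fps_const (chaos_of F)) (moyal_star \<omega> (fps_const (chaos_of G)) (fps_const (chaos_of H)))) N =
    fps_nth (moyal_star \<omega> (moyal_star \<omega> (fps_const (chaos_of F)) (fps_const (chaos_of G))) (fps_const (chaos_of H))) N"
    unfolding moyal_star_const_const[OF G H] moyal_star_const_const[OF F G]
      moyal_star_const_left[OF F inj[OF G H]] moyal_star_const_right[OF inj[OF F G] H] .
qed

theorem theorem3:
  fixes \<omega> :: "real ^ 'd::finite \<Rightarrow> real ^ 'd \<Rightarrow> real"
  assumes "symplectic_form \<omega>"
  defines "P \<equiv> (moyal \<omega> ::
      nat \<Rightarrow> ('d, 'k::{real_normed_field, euclidean_space}) chaos \<Rightarrow> ('d, 'k) chaos \<Rightarrow> ('d, 'k) chaos)"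
  shows "(\<forall>r. bilinear_on_CO (P r)) \<and>
    (\<forall>r>0. \<forall>F\<in>CO_inf. \<forall>G\<in>CO_inf. CO_has_sum (moyal_term \<omega> r F G) (moyal_indices r) (P r F G)) \<and>
    (\<forall>F\<in>(CO_inf :: ('d, 'k) chaos set). \<forall>G\<in>CO_inf.
       CO_has_sum (poisson_term \<omega> F G) UNIV (poisson \<omega> F G)) \<and>
    (\<forall>F1\<in>CO_inf. \<forall>F2\<in>CO_inf. P 0 F1 F2 = wick F1 F2) \<and>
    (\<forall>F1\<in>CO_inf. \<forall>F2\<in>CO_inf. P 1 F1 F2 - P 1 F2 F1 = chaos_scale 2 (poisson \<omega> F1 F2)) \<and>
    (\<forall>r>0. \<forall>k>0. \<forall>C>0. \<exists>K>0. \<exists>k1>0. \<exists>C1>0. \<forall>F1\<in>CO_inf. \<forall>F2\<in>CO_inf.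
       CO_norm k C (P r F1 F2) \<le> ennreal K * CO_norm k1 C1 F1 * CO_norm k1 C1 F2) \<and>
    (\<forall>F1\<in>(CO_inf :: ('d, 'k) chaos set). \<forall>F2\<in>CO_inf. \<forall>F3\<in>CO_inf.
       moyal_star \<omega> (fps_const F1) (moyal_star \<omega> (fps_const F2) (fps_const F3)) =
       moyal_star \<omega> (moyal_star \<omega> (fps_const F1) (fps_const F2)) (fps_const F3))"
proof (intro conjI allI impI ballI)
  show "bilinear_on_CO (P r)" for r unfolding P_def by (rule bilinear_on_CO_moyal)
  show "\<exists>K>0. \<exists>k1>0. \<exists>C1>0. \<forall>F1\<in>CO_inf. \<forall>F2\<in>CO_inf.
       CO_norm k C (P r F1 F2) \<le> ennreal K * CO_norm k1 C1 F1 * CO_norm k1 C1 F2" if "C > 0" for r k :: nat and C :: real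
    unfolding P_def by (rule moyal_continuous[OF that])
  fix F1 F2 :: "('d, 'k) chaos" assume F: "F1 \<in> CO_inf" "F2 \<in> CO_inf"
  obtain J1 where J1: "J1 \<in> jets" "F1 = chaos_of J1" by (rule CO_inf_cases[OF F(1)])
  obtain J2 where J2: "J2 \<in> jets" "F2 = chaos_of J2" by (rule CO_inf_cases[OF F(2)])
  show "CO_has_sum (moyal_term \<omega> r F1 F2) (moyal_indices r) (P r F1 F2)" for r
    unfolding P_def J1 J2 by (rule CO_has_sum_moyal[OF J1(1) J2(1)])
  show "CO_has_sum (poisson_term \<omega> F1 F2) UNIV (poisson \<omega> F1 F2)"
    unfolding J1 J2 by (rule CO_has_sum_poisson[OF J1(1) J2(1)])
  show "P 0 F1 F2 = wick F1 F2" by (simp add: P_def moyal_def)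
  show "P 1 F1 F2 - P 1 F2 F1 = chaos_scale 2 (poisson \<omega> F1 F2)"
  proof -
    have "star_jet (inv_form \<omega>) 1 J2 J1 = - star_jet (inv_form \<omega>) 1 J1 J2"
      by (rule star_jet_antisymmetric[OF J1(1) J2(1) inv_form_antisymmetric[OF assms(1)]])
    then have "P 1 F2 F1 = - P 1 F1 F2"
      unfolding P_def J1(2) J2(2) moyal_chaos_of[OF J1(1) J2(1)] moyal_chaos_of[OF J2(1) J1(1)]
      by (simp add: chaos_of_def fun_eq_iff)
    then show ?thesis by (simp add: poisson_eq_moyal P_def chaos_scale_def fun_eq_iff)
  qed
  fix F3 :: "('d, 'k) chaos" assume F3: "F3 \<in> CO_inf"
  obtain J3 where J3: "J3 \<in> jets" "F3 = chaos_of J3" by (rule CO_inf_cases[OF F3])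
  show "moyal_star \<omega> (fps_const F1) (moyal_star \<omega> (fps_const F2) (fps_const F3)) =
       moyal_star \<omega> (moyal_star \<omega> (fps_const F1) (fps_const F2)) (fps_const F3)"
    unfolding J1(2) J2(2) J3(2) by (rule moyal_star_assoc[OF J1(1) J2(1) J3(1)])
qed

end
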